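(* Let $S$ be a polynomial ring over a field $k$ and let $I \subset S$ be a monomial ideal of height $c$. If $I$ is not a complete intersection, then $$\sum_i \beta_i(S/I) \geq 2^c + 2^{c-1}.$$ Furthermore, equality holds if and only if the generating function $\sum_i \beta_i(S/I)t^i$ is either $$(1 + 3t + 2t^2)(1+t)^{c-2} \quad \text{or} \quad (1 + 5t + 5t^2 + t^3)(1+t)^{c-3}.$$
   Context: $\beta_i(S/I)$ denotes the rank of the $i$-th free module in a minimal (graded) free resolution of $S/I$ over $S$. "$I$ is a complete intersection" means $I$ is generated by a regular sequence. *)

theory Defs
  imports "HOL-Library.Poly_Mapping" "HOL-Library.Extended_Nat" "HOL-Computational_Algebra.Polynomial"
begin

definition is_ideal :: "'a::comm_ring_1 set \<Rightarrow> bool" where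
  "is_ideal J \<longleftrightarrow> 0 \<in> J \<and> (\<forall>x\<in>J. \<forall>y\<in>J. x + y \<in> J) \<and> (\<forall>r. \<forall>x\<in>J. r * x \<in> J)"

definition ideal_gen :: "'a::comm_ring_1 set \<Rightarrow> 'a set" where
  "ideal_gen A = \<Inter>{J. is_ideal J \<and> A \<subseteq> J}"

definition is_prime_ideal :: "'a::comm_ring_1 set \<Rightarrow> bool" where
  "is_prime_ideal P \<longleftrightarrow> is_ideal P \<and> P \<noteq> UNIV \<and> (\<forall>a b. a * b \<in> P \<longrightarrow> a \<in> P \<or> b \<in> P)"

definition prime_height :: "'a::comm_ring_1 set \<Rightarrow> enat" where
  "prime_height Q = Sup {enat n | n. \<exists>P :: nat \<Rightarrow> 'a set.
      (\<forall>i\<le>n. is_prime_ideal (P i)) \<and> (\<forall>i<n. P i \<subset> P (Suc i)) \<and> P n = Q}"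

text \<open>Height of an ideal: infimum of heights of primes containing it (infinite for the unit ideal).\<close>
definition ideal_height :: "'a::comm_ring_1 set \<Rightarrow> enat" where
  "ideal_height I = (INF Q\<in>{Q. is_prime_ideal Q \<and> I \<subseteq> Q}. prime_height Q)"

definition regular_sequence :: "'a::comm_ring_1 list \<Rightarrow> bool" where
  "regular_sequence fs \<longleftrightarrow> ideal_gen (set fs) \<noteq> UNIV \<and>
     (\<forall>i<length fs. \<forall>g. fs ! i * g \<in> ideal_gen (set (take i fs)) \<longrightarrow> g \<in> ideal_gen (set (take i fs)))"

definition complete_intersection :: "'a::comm_ring_1 set \<Rightarrow> bool" where
  "complete_intersection I \<longleftrightarrow> (\<exists>fs. regular_sequence fs \<and> ideal_gen (set fs) = I)"

type_synonym ('v, 'k) mpoly = "('v \<Rightarrow>\<^sub>0 nat) \<Rightarrow>\<^sub>0 'k"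

definition monomial :: "('v::finite, 'k::field) mpoly \<Rightarrow> bool" where
  "monomial f \<longleftrightarrow> (\<exists>\<alpha>. f = Poly_Mapping.single \<alpha> 1)"

definition monomial_ideal :: "('v::finite, 'k::field) mpoly set \<Rightarrow> bool" where
  "monomial_ideal I \<longleftrightarrow> (\<exists>G. (\<forall>g\<in>G. monomial g) \<and> I = ideal_gen G)"

definition mdeg :: "('v::finite \<Rightarrow>\<^sub>0 nat) \<Rightarrow> nat" where
  "mdeg \<alpha> = (\<Sum>v\<in>UNIV. Poly_Mapping.lookup \<alpha> v)"

definition max_ideal :: "('v::finite, 'k::field) mpoly set" where
  "max_ideal = {f. Poly_Mapping.lookup f 0 = 0}"

definition fvec :: "nat \<Rightarrow> (nat \<Rightarrow> 'a::comm_ring_1) set" where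
  "fvec m = {v. \<forall>j\<ge>m. v j = 0}"

definition mat_apply :: "(nat \<Rightarrow> nat \<Rightarrow> 'a::comm_ring_1) \<Rightarrow> nat \<Rightarrow> nat \<Rightarrow> (nat \<Rightarrow> 'a) \<Rightarrow> (nat \<Rightarrow> 'a)" where
  "mat_apply d n m v = (\<lambda>r. if r < n then (\<Sum>j<m. d r j * v j) else 0)"

text \<open>A minimal graded free resolution of S/I of length N:
  0 \<rightarrow> F_N \<rightarrow> ... \<rightarrow> F_1 \<rightarrow> F_0 = S, with F_i = \<oplus>_{j<b i} S(-deg i j),
  differential d i : F_i \<rightarrow> F_(i-1) given by a (b (i-1)) x (b i) matrix with homogeneous
  entries of the correct degrees, exact, with image of d 1 equal to I, and minimal
  (all matrix entries in the homogeneous maximal ideal).\<close>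
definition min_graded_free_res ::
  "('v::finite, 'k::field) mpoly set \<Rightarrow> nat \<Rightarrow> (nat \<Rightarrow> nat) \<Rightarrow> (nat \<Rightarrow> nat \<Rightarrow> nat)
     \<Rightarrow> (nat \<Rightarrow> nat \<Rightarrow> nat \<Rightarrow> ('v, 'k) mpoly) \<Rightarrow> bool" where
  "min_graded_free_res I N b deg d \<longleftrightarrow>
     b 0 = 1 \<and> deg 0 0 = 0 \<and> (\<forall>i>N. b i = 0) \<and>
     (\<forall>i\<ge>1. \<forall>r<b (i - 1). \<forall>j<b i.
         d i r j \<in> max_ideal \<and> (\<forall>\<alpha>\<in>Poly_Mapping.keys (d i r j). mdeg \<alpha> + deg (i - 1) r = deg i j)) \<and>
     (\<lambda>v. v 0) ` (mat_apply (d 1) 1 (b 1) ` fvec (b 1)) = I \<and>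
     (\<forall>i\<ge>1. {v \<in> fvec (b i). mat_apply (d i) (b (i - 1)) (b i) v = (\<lambda>_. 0)}
              = mat_apply (d (Suc i)) (b i) (b (Suc i)) ` fvec (b (Suc i)))"

end

theory Submission
  imports Defs "HOL-Library.Function_Algebras" "HOL-Library.FuncSet" "HOL-Library.Disjoint_Sets"
begin

text \<open>Polarization turns the exponents generating \<open>I\<close> into finite sets. Comparing a minimal resolution with the
  Taylor resolution modulo the variables expresses the Betti numbers as homology dimensions of the complexes of those
  families of generators that have a prescribed union. Localizing at a variable \<open>x\<close> (deleting \<open>x\<close> from all generators)
  gives a long exact sequence pairing the degrees \<open>m\<close> and \<open>m \<union> {x}\<close>, so that it never increases Betti numbers,
  and it reduces the lower bound to families all of whose localizations are complete intersections. Such a family has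
  a cover \<open>D\<close> and a variable \<open>x \<notin> D\<close> such that inverting everything outside \<open>D \<union> {x}\<close> leaves the variables in \<open>D\<close> among
  the generators without \<open>x\<close>. The ranks of the connecting maps, hidden after inverting \<open>x\<close>, then force the Betti
  numbers to dominate coefficientwise \<open>(1 + 2t)(1 + t)\<^bsup>c-1\<^esup>\<close> or \<open>(1 + 4t + t\<^sup>2)(1 + t)\<^bsup>c-2\<^esup>\<close>. Both polynomials have the
  value \<open>2\<^sup>c + 2\<^bsup>c-1\<^esup>\<close> at \<open>1\<close>, so equality of the sums forces equality of all coefficients.\<close>

section \<open>Linear algebra of finitely supported functions\<close>

context vector_space
begin

lemma span_Int_span_independent:
  assumes "independent B" "K \<subseteq> B" "x \<in> span K" "x \<in> span (B - K)"
  shows "x = 0"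
proof -
  have "representation B x b = 0" for b
  proof -
    have "representation B x b = representation K x b"
      "representation B x b = representation (B - K) x b"
      using representation_extend[OF assms(1,3,2)] representation_extend[OF assms(1,4) Diff_subset] by simp_all
    then show ?thesis
      using representation_ne_zero by (metis Diff_iff)
  qed
  moreover have "x \<in> span B"
    using assms(2,3) span_mono by blast
  ultimately show "x = 0"
    using sum_nonzero_representation_eq[OF assms(1), of x] by simp
qed

lemma dim_mono_finite:
  assumes "V \<subseteq> W" "finite F" "W \<subseteq> span F"
  shows "dim V \<le> dim W"
proof -
  obtain C where C: "C \<subseteq> W" "independent C" "W \<subseteq> span C" "card C = dim W"
    using basis_exists by blast
  then have "finite C"
    using independent_span_bound assms(2,3) by blast
  then show ?thesis
    using dim_le_card[of V C] assms(1) C by auto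
qed

end

context vector_space_pair
begin

lemma rank_nullity:
  assumes f: "Vector_Spaces.linear s1 s2 f" and V: "vs1.subspace V" and W: "finite W" "V \<subseteq> vs1.span W"
  shows "vs1.dim V = vs1.dim {v \<in> V. f v = 0} + vs2.dim (f ` V)"
proof -
  obtain K where K: "K \<subseteq> {v \<in> V. f v = 0}" "vs1.independent K" "{v \<in> V. f v = 0} \<subseteq> vs1.span K"
      "card K = vs1.dim {v \<in> V. f v = 0}"
    using vs1.basis_exists by blast
  obtain B where B: "K \<subseteq> B" "B \<subseteq> V" "vs1.independent B" "V \<subseteq> vs1.span B"
    using vs1.maximal_independent_subset_extend[of K V] K by blast
  have finB: "finite B"
    using vs1.independent_span_bound[OF W(1) B(3)] B(2) W(2) by blast
  have spanB: "vs1.span B = V"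
    using B V vs1.span_minimal by blast
  have inj: "inj_on f (vs1.span (B - K))"
    unfolding linear_inj_on_iff_eq_0[OF f vs1.subspace_span]
  proof (intro ballI impI)
    fix x assume x: "x \<in> vs1.span (B - K)" "f x = 0"
    then have "x \<in> vs1.span K"
      using K(3) spanB vs1.span_mono[of "B - K" B] by blast
    then show "x = 0"
      using vs1.span_Int_span_independent B(1,3) x(1) by blast
  qed
  have indep: "vs2.independent (f ` (B - K))"
    using linear_independent_injective_image[OF f vs1.independent_mono[OF B(3)] inj] by blast
  have "f ` V = vs2.span (f ` B)"
    using linear_span_image[OF f, of B] spanB by simp
  also have "\<dots> = vs2.span (f ` (B - K))"
  proof -
    have "f ` B \<subseteq> insert 0 (f ` (B - K))"
      using K(1) by auto
    then have "vs2.span (f ` B) \<subseteq> vs2.span (f ` (B - K))"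
      using vs2.span_mono[of "f ` B"] vs2.span_insert_0 by metis
    then show ?thesis
      using vs2.span_mono[of "f ` (B - K)" "f ` B"] by blast
  qed
  finally have "vs2.dim (f ` V) = card (f ` (B - K))"
    using indep vs2.dim_span_eq_card_independent by simp
  also have "\<dots> = card (B - K)"
    by (rule card_image[OF inj_on_subset[OF inj vs1.span_superset]])
  finally have "vs2.dim (f ` V) = card B - card K"
    using B(1) finB by (simp add: card_Diff_subset finite_subset)
  moreover have "card K \<le> card B"
    using card_mono B(1) finB by blast
  ultimately show ?thesis
    using K(4) vs1.basis_card_eq_dim[OF B(2,4,3)] by linarith
qed

end

lemma sum_fun_apply: "(\<Sum>x\<in>A. f x) y = (\<Sum>x\<in>A. f x y)"
  by (induction A rule: infinite_finite_induct) auto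

definition scale_fun :: "'k::field \<Rightarrow> ('x \<Rightarrow> 'k) \<Rightarrow> 'x \<Rightarrow> 'k" where
  "scale_fun a f = (\<lambda>x. a * f x)"

interpretation fun_vs: vector_space "scale_fun :: 'k::field \<Rightarrow> ('x \<Rightarrow> 'k) \<Rightarrow> 'x \<Rightarrow> 'k"
  by unfold_locales (auto simp: scale_fun_def fun_eq_iff algebra_simps)

interpretation fun_vs_pair: vector_space_pair
  "scale_fun :: 'k::field \<Rightarrow> ('x \<Rightarrow> 'k) \<Rightarrow> 'x \<Rightarrow> 'k" "scale_fun :: 'k::field \<Rightarrow> ('y \<Rightarrow> 'k) \<Rightarrow> 'y \<Rightarrow> 'k"
  ..

abbreviation fun_linear :: "(('x \<Rightarrow> 'k::field) \<Rightarrow> 'y \<Rightarrow> 'k) \<Rightarrow> bool" where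
  "fun_linear \<equiv> Vector_Spaces.linear scale_fun scale_fun"

lemma fun_linearI:
  assumes "\<And>u v x. f (\<lambda>y. u y + v y) x = f u x + f v x" "\<And>c v x. f (\<lambda>y. c * v y) x = c * f v x"
  shows "fun_linear f"
  using assms by unfold_locales (auto simp: fun_eq_iff scale_fun_def plus_fun_def)

definition supported_on :: "'x set \<Rightarrow> ('x \<Rightarrow> 'a::zero) set" where
  "supported_on X = {v. \<forall>x. x \<notin> X \<longrightarrow> v x = 0}"

lemma supported_onD: "v \<in> supported_on X \<Longrightarrow> x \<notin> X \<Longrightarrow> v x = 0"
  by (auto simp: supported_on_def)

lemma supported_on_mono: "X \<subseteq> Y \<Longrightarrow> supported_on X \<subseteq> supported_on Y"
  by (auto simp: supported_on_def)

lemma zero_supported_on [simp]: "0 \<in> supported_on X"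
  by (simp add: supported_on_def)

lemma supported_on_nonempty [simp]: "supported_on X \<noteq> {}"
  using zero_supported_on by fast

lemma subspace_supported_on: "fun_vs.subspace (supported_on X :: ('x \<Rightarrow> 'k::field) set)"
  by (auto simp: fun_vs.subspace_def supported_on_def scale_fun_def)

lemma subspace_linear_constraint:
  assumes "fun_linear f" "fun_vs.subspace V" "fun_vs.subspace W"
  shows "fun_vs.subspace {v \<in> V. f v \<in> W}"
  using fun_vs.subspace_inter[OF assms(2) fun_vs_pair.linear_subspace_vimage[OF assms(1,3)]]
  by (simp add: vimage_def Int_def)

definition unit_fun :: "'x \<Rightarrow> 'x \<Rightarrow> 'a::{zero,one}" where
  "unit_fun x = (\<lambda>y. if y = x then 1 else 0)"

lemma inj_unit_fun: "inj (unit_fun :: 'x \<Rightarrow> 'x \<Rightarrow> 'a::zero_neq_one)"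
  by (metis injI unit_fun_def zero_neq_one)

lemma unit_fun_supported_on: "x \<in> X \<Longrightarrow> unit_fun x \<in> supported_on X"
  by (auto simp: unit_fun_def supported_on_def)

lemma sum_scale_unit_fun:
  assumes "finite X"
  shows "(\<Sum>x\<in>X. scale_fun (a x) (unit_fun x)) y = (if y \<in> X then a y else 0)"
proof -
  have "(\<Sum>x\<in>X. scale_fun (a x) (unit_fun x)) y = (\<Sum>x\<in>X. if y = x then a x else 0)"
    unfolding sum_fun_apply by (intro sum.cong) (auto simp: scale_fun_def unit_fun_def)
  then show ?thesis
    using assms by simp
qed

lemma supported_on_subset_span:
  assumes "finite X"
  shows "supported_on X \<subseteq> fun_vs.span (unit_fun ` X :: ('x \<Rightarrow> 'k::field) set)"
proof
  fix v :: "'x \<Rightarrow> 'k" assume "v \<in> supported_on X"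
  then have "v = (\<Sum>x\<in>X. scale_fun (v x) (unit_fun x))"
    by (auto simp: fun_eq_iff sum_scale_unit_fun[OF assms] supported_on_def)
  also have "\<dots> \<in> fun_vs.span (unit_fun ` X)"
    by (intro fun_vs.span_sum fun_vs.span_scale fun_vs.span_base) auto
  finally show "v \<in> fun_vs.span (unit_fun ` X)" .
qed

lemma independent_unit_funs:
  assumes "finite X"
  shows "fun_vs.independent (unit_fun ` X :: ('x \<Rightarrow> 'k::field) set)"
proof (rule fun_vs.independent_if_scalars_zero)
  fix a :: "('x \<Rightarrow> 'k) \<Rightarrow> 'k" and u :: "'x \<Rightarrow> 'k"
  assume zero: "(\<Sum>w\<in>unit_fun ` X. scale_fun (a w) w) = 0" and "u \<in> unit_fun ` X"
  then obtain x where x: "x \<in> X" "u = unit_fun x"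
    by auto
  have "(\<Sum>w\<in>unit_fun ` X. scale_fun (a w) w) = (\<Sum>x\<in>X. scale_fun (a (unit_fun x)) (unit_fun x))"
    using inj_unit_fun by (subst sum.reindex) (auto simp: inj_on_def inj_def)
  then have "(\<Sum>x\<in>X. scale_fun (a (unit_fun x)) (unit_fun x)) x = 0"
    using zero by simp
  then show "a u = 0"
    unfolding sum_scale_unit_fun[OF assms] using x by simp
qed (use assms in auto)

lemma dim_supported_on:
  assumes "finite X"
  shows "fun_vs.dim (supported_on X :: ('x \<Rightarrow> 'k::field) set) = card X"
proof -
  have "fun_vs.dim (supported_on X :: ('x \<Rightarrow> 'k) set) = card (unit_fun ` X :: ('x \<Rightarrow> 'k) set)"
    using unit_fun_supported_on
    by (intro fun_vs.dim_unique[OF _ supported_on_subset_span[OF assms] independent_unit_funs[OF assms]]) auto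
  also have "\<dots> = card X"
    by (rule card_image[OF inj_on_subset[OF inj_unit_fun]]) simp
  finally show ?thesis .
qed

lemma fun_dim_mono:
  fixes V W :: "('x \<Rightarrow> 'k::field) set"
  assumes "V \<subseteq> W" "finite X" "W \<subseteq> supported_on X"
  shows "fun_vs.dim V \<le> fun_vs.dim W"
  using assms(1) finite_imageI[OF assms(2)] order_trans[OF assms(3) supported_on_subset_span[OF assms(2)]]
  by (rule fun_vs.dim_mono_finite)

lemma fun_rank_nullity:
  fixes f :: "('x \<Rightarrow> 'k::field) \<Rightarrow> 'y \<Rightarrow> 'k"
  assumes "fun_linear f" "fun_vs.subspace V" "finite X" "V \<subseteq> supported_on X"
  shows "fun_vs.dim V = fun_vs.dim {v \<in> V. f v = 0} + fun_vs.dim (f ` V)"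
  using assms(1,2) finite_imageI[OF assms(3)] order_trans[OF assms(4) supported_on_subset_span[OF assms(3)]]
  by (rule fun_vs_pair.rank_nullity)

lemma fun_dim_zero: "fun_vs.dim {0 :: 'x \<Rightarrow> 'k::field} = 0"
  by (rule fun_vs.dim_unique[of "{}"]) (simp_all add: fun_vs.independent_empty)

definition coord_proj :: "'x set \<Rightarrow> ('x \<Rightarrow> 'a::zero) \<Rightarrow> 'x \<Rightarrow> 'a" where
  "coord_proj X v = (\<lambda>x. if x \<in> X then v x else 0)"

lemma fun_linear_coord_proj: "fun_linear (coord_proj X :: ('x \<Rightarrow> 'k::field) \<Rightarrow> _)"
  by (rule fun_linearI) (simp_all add: coord_proj_def)

lemma coord_proj_coord_proj: "coord_proj X (coord_proj Y v) = coord_proj (X \<inter> Y) v"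
  by (auto simp: coord_proj_def)

lemma coord_proj_supported: "coord_proj X v \<in> supported_on X"
  by (auto simp: coord_proj_def supported_on_def)

lemma coord_proj_id: "v \<in> supported_on X \<Longrightarrow> coord_proj X v = v"
  by (auto simp: coord_proj_def supported_on_def)

lemma dim_coord_split:
  fixes V :: "('x \<Rightarrow> 'k::field) set"
  assumes V: "fun_vs.subspace V" "V \<subseteq> supported_on (X \<union> Y)" and fin: "finite (X \<union> Y)" and disj: "X \<inter> Y = {}"
    and closed: "\<And>v. v \<in> V \<Longrightarrow> coord_proj X v \<in> V"
  shows "fun_vs.dim V = fun_vs.dim (coord_proj X ` V) + fun_vs.dim (coord_proj Y ` V)"
proof -
  have split: "coord_proj Y v = v - coord_proj X v" if "v \<in> V" for v
    using subsetD[OF V(2) that] disj by (auto simp: coord_proj_def supported_on_def fun_eq_iff)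
  have "{v \<in> V. coord_proj X v = 0} = coord_proj Y ` V"
  proof (intro equalityI subsetI)
    fix v assume "v \<in> {v \<in> V. coord_proj X v = 0}"
    then show "v \<in> coord_proj Y ` V"
      using split[of v] by (intro image_eqI[of _ _ v]) simp_all
  next
    fix w assume "w \<in> coord_proj Y ` V"
    then obtain v where v: "v \<in> V" "w = coord_proj Y v"
      by blast
    then have "w \<in> V"
      using split closed fun_vs.subspace_diff[OF V(1)] by simp
    moreover have "coord_proj X w = 0"
      using disj v(2) by (auto simp: coord_proj_def fun_eq_iff)
    ultimately show "w \<in> {v \<in> V. coord_proj X v = 0}"
      by simp
  qed
  then show ?thesis
    using fun_rank_nullity[OF fun_linear_coord_proj[of X] V(1) fin V(2)] by simp
qed

lemma dim_coord_blocks: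
  fixes V :: "('x \<Rightarrow> 'k::field) set"
  assumes "finite M" "\<And>m. m \<in> M \<Longrightarrow> finite (B m)" "disjoint_family_on B M"
    and "fun_vs.subspace V" "V \<subseteq> supported_on (\<Union>m\<in>M. B m)"
    and "\<And>m v. m \<in> M \<Longrightarrow> v \<in> V \<Longrightarrow> coord_proj (B m) v \<in> V"
  shows "fun_vs.dim V = (\<Sum>m\<in>M. fun_vs.dim (coord_proj (B m) ` V))"
  using assms
proof (induction M arbitrary: V rule: finite_induct)
  case empty
  then have "V = {0}"
    using fun_vs.subspace_0[OF empty.prems(3)] by (auto simp: supported_on_def fun_eq_iff)
  then show ?case
    using fun_dim_zero by simp
next
  case (insert m M)
  define Y where "Y = (\<Union>m\<in>M. B m)"
  let ?W = "coord_proj Y ` V"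
  have disj: "B m \<inter> Y = {}"
    using insert.hyps(2) insert.prems(2) by (auto simp: Y_def disjoint_family_on_insert)
  have below: "B m' \<inter> Y = B m'" if "m' \<in> M" for m'
    using that by (auto simp: Y_def)
  have proj_W: "coord_proj (B m') ` ?W = coord_proj (B m') ` V" if "m' \<in> M" for m'
    using below[OF that] by (simp add: image_image coord_proj_coord_proj)
  have "fun_vs.dim ?W = (\<Sum>m'\<in>M. fun_vs.dim (coord_proj (B m') ` ?W))"
  proof (rule insert.IH)
    show "fun_vs.subspace ?W"
      by (rule fun_vs_pair.linear_subspace_image[OF fun_linear_coord_proj insert.prems(3)])
    show "?W \<subseteq> supported_on (\<Union>m\<in>M. B m)"
      unfolding Y_def by (auto intro: coord_proj_supported)
    fix m' w assume m': "m' \<in> M" and "w \<in> ?W"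
    then obtain v where v: "v \<in> V" "coord_proj (B m') w = coord_proj (B m') v"
      using proj_W by blast
    then have "coord_proj (B m') v \<in> V"
      using insert.prems(5) m' by simp
    then show "coord_proj (B m') w \<in> ?W"
      using v below[OF m']
      by (intro image_eqI[of _ _ "coord_proj (B m') v"]) (simp_all add: coord_proj_coord_proj Int_commute)
  qed (use insert.prems(1,2) in \<open>auto simp: disjoint_family_on_def\<close>)
  moreover have "fun_vs.dim V = fun_vs.dim (coord_proj (B m) ` V) + fun_vs.dim ?W"
    by (rule dim_coord_split[OF insert.prems(3) _ _ disj])
      (use insert.prems insert.hyps(1) in \<open>auto simp: Y_def\<close>)
  ultimately show ?case
    using insert.hyps by (simp add: proj_W)
qed

section \<open>Complexes of finite sets\<close>

definition vertex_sign :: "nat \<Rightarrow> nat set \<Rightarrow> 'a::comm_ring_1" where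
  "vertex_sign g \<tau> = (-1) ^ card {h \<in> \<tau>. h < g}"

lemma vertex_sign_square: "vertex_sign g \<tau> * vertex_sign g \<tau> = 1"
  by (simp add: vertex_sign_def power_add[symmetric] mult_2[symmetric])

lemma vertex_sign_insert:
  assumes "finite \<tau>" "a \<notin> \<tau>"
  shows "vertex_sign b (insert a \<tau>) = (if a < b then - vertex_sign b \<tau> else vertex_sign b \<tau>)"
proof (cases "a < b")
  case True
  then have "{h \<in> insert a \<tau>. h < b} = insert a {h \<in> \<tau>. h < b}"
    by auto
  then show ?thesis
    using assms True by (simp add: vertex_sign_def)
next
  case False
  then have "{h \<in> insert a \<tau>. h < b} = {h \<in> \<tau>. h < b}"
    by auto
  then show ?thesis
    using False by (simp add: vertex_sign_def)
qed

definition link_vertices :: "nat set set \<Rightarrow> nat set \<Rightarrow> nat set" where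
  "link_vertices X \<tau> = {g. g \<notin> \<tau> \<and> insert g \<tau> \<in> X}"

definition boundary :: "nat set set \<Rightarrow> (nat set \<Rightarrow> 'a::comm_ring_1) \<Rightarrow> nat set \<Rightarrow> 'a" where
  "boundary X v = (\<lambda>\<tau>. if \<tau> \<in> X then \<Sum>g\<in>link_vertices X \<tau>. vertex_sign g \<tau> * v (insert g \<tau>) else 0)"

lemma fun_linear_boundary: "fun_linear (boundary X :: (nat set \<Rightarrow> 'k::field) \<Rightarrow> _)"
  by (rule fun_linearI) (auto simp: boundary_def algebra_simps sum.distrib sum_distrib_left)

lemma boundary_cong: "(\<And>\<sigma>. \<sigma> \<in> X \<Longrightarrow> u \<sigma> = w \<sigma>) \<Longrightarrow> boundary X u = boundary X w"
  unfolding boundary_def by (auto intro!: ext sum.cong simp: link_vertices_def)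

lemma boundary_supported: "boundary X v \<in> supported_on X"
  by (simp add: boundary_def supported_on_def)

lemma boundary_nonzeroE:
  assumes "boundary X v \<tau> \<noteq> 0"
  obtains g where "\<tau> \<in> X" "g \<notin> \<tau>" "insert g \<tau> \<in> X" "v (insert g \<tau>) \<noteq> 0"
proof -
  have "\<tau> \<in> X" "(\<Sum>g\<in>link_vertices X \<tau>. vertex_sign g \<tau> * v (insert g \<tau>)) \<noteq> 0"
    using assms by (auto simp: boundary_def split: if_splits)
  moreover from this obtain g where "g \<in> link_vertices X \<tau>" "vertex_sign g \<tau> * v (insert g \<tau>) \<noteq> 0"
    by (auto dest: sum.not_neutral_contains_not_neutral)
  moreover from this have "v (insert g \<tau>) \<noteq> 0"
    by auto
  ultimately show ?thesis
    by (intro that[of g]) (simp_all add: link_vertices_def)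
qed

definition set_complex :: "nat set set \<Rightarrow> bool" where
  "set_complex X \<longleftrightarrow> finite X \<and> (\<forall>\<sigma>\<in>X. finite \<sigma>) \<and>
     (\<forall>\<tau>\<in>X. \<forall>\<sigma>\<in>X. \<forall>\<rho>. \<tau> \<subseteq> \<rho> \<longrightarrow> \<rho> \<subseteq> \<sigma> \<longrightarrow> \<rho> \<in> X)"

lemma set_complex_finite: "set_complex X \<Longrightarrow> finite X"
  by (simp add: set_complex_def)

lemma set_complex_finite_face: "set_complex X \<Longrightarrow> \<sigma> \<in> X \<Longrightarrow> finite \<sigma>"
  by (simp add: set_complex_def)

lemma set_complex_between: "set_complex X \<Longrightarrow> \<tau> \<in> X \<Longrightarrow> \<sigma> \<in> X \<Longrightarrow> \<tau> \<subseteq> \<rho> \<Longrightarrow> \<rho> \<subseteq> \<sigma> \<Longrightarrow> \<rho> \<in> X"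
  unfolding set_complex_def by blast

lemma set_complex_Pow: "finite A \<Longrightarrow> set_complex (Pow A)"
  unfolding set_complex_def using finite_subset by auto

lemma finite_link_vertices:
  assumes "set_complex X"
  shows "finite (link_vertices X \<tau>)"
proof (rule finite_subset)
  show "link_vertices X \<tau> \<subseteq> \<Union>X"
    by (auto simp: link_vertices_def)
  show "finite (\<Union>X)"
    using assms by (simp add: set_complex_def)
qed

lemma boundary_boundary:
  assumes X: "set_complex X"
  shows "boundary X (boundary X v) = 0"
proof
  fix \<tau>
  show "boundary X (boundary X v) \<tau> = 0 \<tau>"
  proof (cases "\<tau> \<in> X")
    case True
    let ?P = "SIGMA a:link_vertices X \<tau>. link_vertices X (insert a \<tau>)"
    let ?term = "\<lambda>(a, b). vertex_sign a \<tau> * (vertex_sign b (insert a \<tau>) * v (insert b (insert a \<tau>)))"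
    have "boundary X (boundary X v) \<tau> = (\<Sum>a\<in>link_vertices X \<tau>. vertex_sign a \<tau> * boundary X v (insert a \<tau>))"
      using True by (simp add: boundary_def)
    also have "\<dots> = (\<Sum>a\<in>link_vertices X \<tau>. \<Sum>b\<in>link_vertices X (insert a \<tau>). ?term (a, b))"
      by (intro sum.cong) (auto simp: boundary_def link_vertices_def sum_distrib_left)
    also have "\<dots> = (\<Sum>p\<in>?P. ?term p)"
      by (subst sum.Sigma) (simp_all add: finite_link_vertices[OF X])
    also have "\<dots> = 0"
    proof (rule sum_involution_eq_0[where h = prod.swap])
      fix p assume "p \<in> ?P"
      then obtain a b where p: "p = (a, b)" "a \<notin> \<tau>" "b \<notin> \<tau>" "a \<noteq> b" "insert b (insert a \<tau>) \<in> X"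
        by (auto simp: link_vertices_def)
      have "vertex_sign a \<tau> * vertex_sign b (insert a \<tau>) + vertex_sign b \<tau> * vertex_sign a (insert b \<tau>) = (0::'a)"
        using p(2-4) set_complex_finite_face[OF X True] by (simp add: vertex_sign_insert)
      then show "?term (prod.swap p) + ?term p = 0"
        by (simp add: p(1) insert_commute mult.assoc[symmetric] distrib_right[symmetric] add.commute)
      have "insert b \<tau> \<in> X"
        using set_complex_between[OF X True p(5), of "insert b \<tau>"] by blast
      then show "prod.swap p \<in> ?P"
        using p by (auto simp: link_vertices_def insert_commute)
      show "prod.swap p \<noteq> p"
        using p by simp
    qed simp
    finally show ?thesis
      by simp
  qed (simp add: boundary_def)
qed

definition cone :: "nat \<Rightarrow> (nat set \<Rightarrow> 'a::comm_ring_1) \<Rightarrow> nat set \<Rightarrow> 'a" where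
  "cone g v = (\<lambda>\<sigma>. if g \<in> \<sigma> then vertex_sign g (\<sigma> - {g}) * v (\<sigma> - {g}) else 0)"

lemma cone_zero: "cone g 0 = 0"
  by (simp add: cone_def fun_eq_iff)

definition toggle_closed :: "nat \<Rightarrow> nat set set \<Rightarrow> bool" where
  "toggle_closed g X \<longleftrightarrow> (\<forall>\<sigma>\<in>X. insert g \<sigma> \<in> X \<and> \<sigma> - {g} \<in> X)"

lemma boundary_cone_notin:
  assumes X: "set_complex X" and tog: "toggle_closed g X" and \<tau>: "\<tau> \<in> X" and g: "g \<notin> \<tau>"
  shows "boundary X (cone g v) \<tau> = v \<tau>"
proof -
  have "g \<in> link_vertices X \<tau>"
    using g tog \<tau> by (auto simp: toggle_closed_def link_vertices_def)
  moreover have "vertex_sign h \<tau> * cone g v (insert h \<tau>) = (if h = g then v \<tau> else 0)"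
    if "h \<in> link_vertices X \<tau>" for h
    using that g vertex_sign_square[of g \<tau>, where 'a='a]
    by (auto simp: cone_def mult.assoc[symmetric])
  ultimately show ?thesis
    using \<tau> finite_link_vertices[OF X] by (simp add: boundary_def)
qed

lemma boundary_cone_in:
  assumes X: "set_complex X" and tog: "toggle_closed g X" and \<tau>: "\<tau> \<in> X" and g: "g \<in> \<tau>"
  shows "boundary X (cone g v) \<tau> + cone g (boundary X v) \<tau> = v \<tau>"
proof -
  let ?\<rho> = "\<tau> - {g}" and ?L = "link_vertices X \<tau>"
  have \<rho>: "?\<rho> \<in> X" "insert g ?\<rho> = \<tau>" "finite ?\<rho>" and "g \<notin> ?\<rho>"
    using tog \<tau> g set_complex_finite_face[OF X \<tau>] by (auto simp: toggle_closed_def)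
  have "insert h ?\<rho> \<in> X \<longleftrightarrow> insert h \<tau> \<in> X" if "h \<notin> \<tau>" for h
  proof -
    have "insert g (insert h ?\<rho>) = insert h \<tau>" "insert h \<tau> - {g} = insert h ?\<rho>"
      using g that by auto
    then show ?thesis
      using tog by (metis toggle_closed_def)
  qed
  then have link: "link_vertices X ?\<rho> = insert g ?L"
    using g \<tau> \<rho>(2) by (auto simp: link_vertices_def)
  have "g \<notin> ?L" "finite ?L"
    using g finite_link_vertices[OF X] by (simp_all add: link_vertices_def)
  have "cone g (boundary X v) \<tau> =
      vertex_sign g ?\<rho> * (vertex_sign g ?\<rho> * v \<tau> + (\<Sum>h\<in>?L. vertex_sign h ?\<rho> * v (insert h ?\<rho>)))"
    using g \<rho> \<open>g \<notin> ?L\<close> \<open>finite ?L\<close> by (simp add: cone_def boundary_def link)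
  then have cone_boundary: "cone g (boundary X v) \<tau> =
      v \<tau> + (\<Sum>h\<in>?L. vertex_sign g ?\<rho> * vertex_sign h ?\<rho> * v (insert h ?\<rho>))"
    using vertex_sign_square[of g ?\<rho>, where 'a='a]
    by (simp add: distrib_left sum_distrib_left mult.assoc[symmetric])
  have "vertex_sign h \<tau> * cone g v (insert h \<tau>) = - (vertex_sign g ?\<rho> * vertex_sign h ?\<rho> * v (insert h ?\<rho>))"
    if "h \<in> ?L" for h
  proof -
    have h: "h \<noteq> g" "h \<notin> ?\<rho>" "insert h \<tau> - {g} = insert h ?\<rho>"
      using that g by (auto simp: link_vertices_def)
    then have "vertex_sign h (insert g ?\<rho>) * vertex_sign g (insert h ?\<rho>) = - (vertex_sign g ?\<rho> * vertex_sign h ?\<rho> :: 'a)"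
      unfolding vertex_sign_insert[OF \<rho>(3) h(2)] vertex_sign_insert[OF \<rho>(3) \<open>g \<notin> ?\<rho>\<close>]
      using h(1) by (auto simp: mult.commute)
    then show ?thesis
      using h(3) g unfolding \<rho>(2) by (simp add: cone_def mult.assoc[symmetric])
  qed
  then have "boundary X (cone g v) \<tau> = - (\<Sum>h\<in>?L. vertex_sign g ?\<rho> * vertex_sign h ?\<rho> * v (insert h ?\<rho>))"
    using \<tau> by (simp add: boundary_def sum_negf)
  then show ?thesis
    unfolding cone_boundary by simp
qed

lemma boundary_cone:
  assumes "set_complex X" "toggle_closed g X" "\<tau> \<in> X"
  shows "boundary X (cone g v) \<tau> + cone g (boundary X v) \<tau> = v \<tau>"
  using boundary_cone_in[OF assms] boundary_cone_notin[OF assms] by (cases "g \<in> \<tau>") (simp_all add: cone_def)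

definition level :: "nat set set \<Rightarrow> nat \<Rightarrow> nat set set" where
  "level X i = {\<sigma> \<in> X. card \<sigma> = i}"

lemma level_subset: "level X i \<subseteq> X"
  by (auto simp: level_def)

lemma supported_on_level: "v \<in> supported_on (level X i) \<Longrightarrow> v \<in> supported_on X"
  using supported_on_mono[OF level_subset] by blast

lemma supported_on_level_subset:
  assumes "Y \<subseteq> X"
  shows "v \<in> supported_on (level Y i) \<longleftrightarrow> v \<in> supported_on (level X i) \<and> v \<in> supported_on Y"
  using assms by (auto simp: supported_on_def level_def)

lemma boundary_level:
  assumes X: "set_complex X" and v: "v \<in> supported_on (level X (Suc i))"
  shows "boundary X v \<in> supported_on (level X i)"
  unfolding supported_on_def
proof (intro CollectI allI impI, rule ccontr)
  fix \<tau> assume "\<tau> \<notin> level X i" "boundary X v \<tau> \<noteq> 0"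
  moreover from this(2) obtain g where "\<tau> \<in> X" "g \<notin> \<tau>" "v (insert g \<tau>) \<noteq> 0"
    by (rule boundary_nonzeroE)
  moreover have "card (insert g \<tau>) = Suc i"
    using supported_onD[OF v, of "insert g \<tau>"] \<open>v (insert g \<tau>) \<noteq> 0\<close> by (auto simp: level_def)
  ultimately show False
    using set_complex_finite_face[OF X] by (simp add: level_def)
qed

lemma boundary_level_0:
  assumes X: "set_complex X" and v: "v \<in> supported_on (level X 0)"
  shows "boundary X v = 0"
proof (rule ext, rule ccontr)
  fix \<tau> assume "boundary X v \<tau> \<noteq> 0 \<tau>"
  then have "boundary X v \<tau> \<noteq> 0"
    by simp
  then obtain g where g: "insert g \<tau> \<in> X" "v (insert g \<tau>) \<noteq> 0"
    by (rule boundary_nonzeroE)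
  then have "card (insert g \<tau>) = 0"
    using supported_onD[OF v, of "insert g \<tau>"] by (auto simp: level_def)
  then show False
    using set_complex_finite_face[OF X g(1)] by simp
qed

definition cycles :: "nat set set \<Rightarrow> nat \<Rightarrow> (nat set \<Rightarrow> 'k::field) set" where
  "cycles X i = {v \<in> supported_on (level X i). boundary X v = 0}"

definition boundaries :: "nat set set \<Rightarrow> nat \<Rightarrow> (nat set \<Rightarrow> 'k::field) set" where
  "boundaries X i = boundary X ` supported_on (level X i)"

definition homology_dim :: "'k::field itself \<Rightarrow> nat set set \<Rightarrow> nat \<Rightarrow> int" where
  "homology_dim _ X i = int (fun_vs.dim (cycles X i :: (nat set \<Rightarrow> 'k) set))
     - int (fun_vs.dim (boundaries X (Suc i) :: (nat set \<Rightarrow> 'k) set))"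

lemma subspace_cycles: "fun_vs.subspace (cycles X i)"
  using subspace_linear_constraint[OF fun_linear_boundary subspace_supported_on fun_vs.subspace_single_0]
  by (simp add: cycles_def)

lemma subspace_boundaries: "fun_vs.subspace (boundaries X i)"
  unfolding boundaries_def by (rule fun_vs_pair.linear_subspace_image[OF fun_linear_boundary subspace_supported_on])

lemma cycles_supported: "cycles X i \<subseteq> supported_on X"
  by (auto simp: cycles_def supported_on_level)

lemma boundaries_supported: "boundaries X i \<subseteq> supported_on X"
  by (auto simp: boundaries_def boundary_supported)

lemma boundaries_subset_cycles: "set_complex X \<Longrightarrow> boundaries X (Suc i) \<subseteq> cycles X i"
  by (auto simp: boundaries_def cycles_def boundary_boundary boundary_level)

lemma boundaries_0:
  assumes "set_complex X"
  shows "boundaries X 0 = ({0} :: (nat set \<Rightarrow> 'k::field) set)"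
proof -
  let ?C = "supported_on (level X 0) :: (nat set \<Rightarrow> 'k) set"
  have "boundary X ` ?C = (\<lambda>_. 0) ` ?C"
    by (intro image_cong refl boundary_level_0[OF assms])
  then show ?thesis
    by (simp add: boundaries_def image_constant_conv)
qed

lemma homology_dim_nonneg:
  assumes X: "set_complex X"
  shows "homology_dim TYPE('k::field) X i \<ge> 0"
  using fun_dim_mono[OF boundaries_subset_cycles[OF X] set_complex_finite[OF X] cycles_supported, where 'k='k]
  by (simp add: homology_dim_def)

lemma card_level_eq:
  assumes "set_complex X"
  shows "card (level X i) =
    fun_vs.dim (cycles X i :: (nat set \<Rightarrow> 'k::field) set) + fun_vs.dim (boundaries X i :: (nat set \<Rightarrow> 'k) set)"
proof -
  have fin: "finite (level X i)"
    by (rule finite_subset[OF level_subset set_complex_finite[OF assms]])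
  show ?thesis
    using fun_rank_nullity[OF fun_linear_boundary[of X, where 'k='k] subspace_supported_on fin order_refl]
    unfolding dim_supported_on[OF fin] cycles_def boundaries_def by simp
qed

lemma cone_level:
  assumes X: "set_complex X" and tog: "toggle_closed g X" and v: "v \<in> supported_on (level X i)"
  shows "cone g v \<in> supported_on (level X (Suc i))"
  unfolding supported_on_def
proof (intro CollectI allI impI, rule ccontr)
  fix \<sigma> assume \<sigma>: "\<sigma> \<notin> level X (Suc i)" "cone g v \<sigma> \<noteq> 0"
  then have "g \<in> \<sigma>" "v (\<sigma> - {g}) \<noteq> 0"
    by (auto simp: cone_def split: if_splits)
  then have face: "\<sigma> - {g} \<in> X" "card (\<sigma> - {g}) = i"
    using supported_onD[OF v, of "\<sigma> - {g}"] by (auto simp: level_def)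
  then have "\<sigma> \<in> X"
    using tog \<open>g \<in> \<sigma>\<close> by (metis insert_Diff toggle_closed_def)
  then show False
    using \<sigma>(1) face card.remove[OF set_complex_finite_face[OF X] \<open>g \<in> \<sigma>\<close>] by (simp add: level_def)
qed

lemma boundary_cone_cycle:
  assumes X: "set_complex X" and tog: "toggle_closed g X" and v: "v \<in> cycles X i"
  shows "boundary X (cone g v) = v"
proof
  have supp: "v \<in> supported_on (level X i)" and cycle: "boundary X v = 0"
    using v by (simp_all add: cycles_def)
  fix \<tau> show "boundary X (cone g v) \<tau> = v \<tau>"
  proof (cases "\<tau> \<in> X")
    case True
    then show ?thesis
      using boundary_cone[OF X tog True, of v] by (simp add: cycle cone_zero)
  next
    case False
    then show ?thesis
      using supported_onD[OF supported_on_level[OF supp]] by (simp add: boundary_def)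
  qed
qed

lemma homology_dim_toggle:
  assumes X: "set_complex X" and tog: "toggle_closed g X"
  shows "homology_dim TYPE('k::field) X i = 0"
proof -
  have "v \<in> boundaries X (Suc i)" if v: "v \<in> cycles X i" for v :: "nat set \<Rightarrow> 'k"
    unfolding boundaries_def
  proof (rule image_eqI)
    show "v = boundary X (cone g v)"
      by (rule boundary_cone_cycle[OF X tog v, symmetric])
    show "cone g v \<in> supported_on (level X (Suc i))"
      using v by (intro cone_level[OF X tog]) (simp add: cycles_def)
  qed
  then have "cycles X i = (boundaries X (Suc i) :: (nat set \<Rightarrow> 'k) set)"
    using boundaries_subset_cycles[OF X, of i] by blast
  then show ?thesis
    by (simp add: homology_dim_def)
qed

lemma homology_dim_singleton:
  assumes "finite \<sigma>"
  shows "homology_dim TYPE('k::field) {\<sigma>} i = (if card \<sigma> = i then 1 else 0)"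
proof -
  have X: "set_complex {\<sigma>}"
    using assms by (auto simp: set_complex_def)
  have zero: "boundary {\<sigma>} v = (0 :: nat set \<Rightarrow> 'k)" for v
    by (auto simp: boundary_def fun_eq_iff link_vertices_def intro!: sum.neutral)
  have "boundaries {\<sigma>} j = ({0} :: (nat set \<Rightarrow> 'k) set)" for j
    by (simp add: boundaries_def zero image_constant_conv)
  moreover have "level {\<sigma>} i = (if card \<sigma> = i then {\<sigma>} else {})"
    by (auto simp: level_def)
  ultimately show ?thesis
    using card_level_eq[OF X, of i, where 'k='k] fun_dim_zero[where 'x="nat set" and 'k='k]
    by (simp add: homology_dim_def split: if_splits)
qed

lemma homology_dim_empty: "homology_dim TYPE('k::field) {} i = 0"
  by (rule homology_dim_toggle) (simp_all add: set_complex_def toggle_closed_def)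

text \<open>\<open>connecting_rank TYPE('k) X Y i\<close> is the rank of the connecting map
  \<open>H\<^sub>i(X - Y) \<rightarrow> H\<^sub>i\<^sub>-\<^sub>1(Y)\<close>, computed as the dimension of the kernel of \<open>H\<^sub>i\<^sub>-\<^sub>1(Y) \<rightarrow> H\<^sub>i\<^sub>-\<^sub>1(X)\<close>.\<close>

definition connecting_rank :: "'k::field itself \<Rightarrow> nat set set \<Rightarrow> nat set set \<Rightarrow> nat \<Rightarrow> int" where
  "connecting_rank _ X Y i = int (fun_vs.dim (boundaries X i \<inter> supported_on Y :: (nat set \<Rightarrow> 'k) set))
     - int (fun_vs.dim (boundaries Y i :: (nat set \<Rightarrow> 'k) set))"

locale subcomplex =
  fixes X Y :: "nat set set"
  assumes X: "set_complex X" and YX: "Y \<subseteq> X"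
    and down_closed: "\<And>\<sigma> \<tau>. \<sigma> \<in> Y \<Longrightarrow> \<tau> \<in> X \<Longrightarrow> \<tau> \<subseteq> \<sigma> \<Longrightarrow> \<tau> \<in> Y"
begin

lemma set_complex_subcomplex: "set_complex Y"
  unfolding set_complex_def
proof (intro conjI ballI allI impI)
  show "finite Y"
    by (rule finite_subset[OF YX set_complex_finite[OF X]])
  show "finite \<sigma>" if "\<sigma> \<in> Y" for \<sigma>
    using that YX set_complex_finite_face[OF X] by blast
  show "\<rho> \<in> Y" if "\<tau> \<in> Y" "\<sigma> \<in> Y" "\<tau> \<subseteq> \<rho>" "\<rho> \<subseteq> \<sigma>" for \<tau> \<sigma> \<rho>
    using down_closed[OF that(2) _ that(4)] set_complex_between[OF X _ _ that(3,4)] that(1,2) YX by blast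
qed

lemma set_complex_quotient: "set_complex (X - Y)"
  unfolding set_complex_def
proof (intro conjI ballI allI impI)
  show "finite (X - Y)"
    using set_complex_finite[OF X] by simp
  show "finite \<sigma>" if "\<sigma> \<in> X - Y" for \<sigma>
    using that set_complex_finite_face[OF X] by blast
  show "\<rho> \<in> X - Y" if "\<tau> \<in> X - Y" "\<sigma> \<in> X - Y" "\<tau> \<subseteq> \<rho>" "\<rho> \<subseteq> \<sigma>" for \<tau> \<sigma> \<rho>
    using down_closed[OF _ _ that(3)] set_complex_between[OF X _ _ that(3,4)] that(1,2) by blast
qed

lemma link_vertices_quotient: "\<tau> \<in> X - Y \<Longrightarrow> link_vertices (X - Y) \<tau> = link_vertices X \<tau>"
  using down_closed[of "insert _ \<tau>" \<tau>] by (auto simp: link_vertices_def)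

lemma boundary_subcomplex:
  assumes v: "v \<in> supported_on Y"
  shows "boundary X v = boundary Y v"
proof
  fix \<tau>
  show "boundary X v \<tau> = boundary Y v \<tau>"
  proof (cases "\<tau> \<in> Y")
    case True
    have "(\<Sum>g\<in>link_vertices X \<tau>. vertex_sign g \<tau> * v (insert g \<tau>)) =
        (\<Sum>g\<in>link_vertices Y \<tau>. vertex_sign g \<tau> * v (insert g \<tau>))"
    proof (rule sum.mono_neutral_right[OF finite_link_vertices[OF X]])
      show "\<forall>g\<in>link_vertices X \<tau> - link_vertices Y \<tau>. vertex_sign g \<tau> * v (insert g \<tau>) = 0"
      proof
        fix g assume "g \<in> link_vertices X \<tau> - link_vertices Y \<tau>"
        then have "insert g \<tau> \<notin> Y"
          by (auto simp: link_vertices_def)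
        then show "vertex_sign g \<tau> * v (insert g \<tau>) = 0"
          by (simp add: supported_onD[OF v])
      qed
    qed (use YX in \<open>auto simp: link_vertices_def\<close>)
    then show ?thesis
      using True YX by (auto simp: boundary_def)
  next
    case False
    have "boundary X v \<tau> = 0"
      using False down_closed supported_onD[OF v] by (metis boundary_nonzeroE subset_insertI)
    then show ?thesis
      using False by (simp add: boundary_def)
  qed
qed

lemma boundary_quotient: "coord_proj (X - Y) (boundary X v) = boundary (X - Y) (coord_proj (X - Y) v)"
proof
  fix \<tau>
  have "insert g \<tau> \<in> X - Y" if "\<tau> \<in> X - Y" "g \<in> link_vertices X \<tau>" for g
    using that link_vertices_quotient[OF that(1)] by (auto simp: link_vertices_def)
  then show "coord_proj (X - Y) (boundary X v) \<tau> = boundary (X - Y) (coord_proj (X - Y) v) \<tau>"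
    unfolding coord_proj_def boundary_def by (auto simp: link_vertices_quotient)
qed

lemma coord_proj_quotient_eq_0_iff:
  assumes "v \<in> supported_on X"
  shows "coord_proj (X - Y) v = 0 \<longleftrightarrow> v \<in> supported_on Y"
  using assms YX by (auto simp: coord_proj_def supported_on_def fun_eq_iff)

lemma boundary_supported_sub: "v \<in> supported_on Y \<Longrightarrow> boundary X v \<in> supported_on Y"
  by (simp add: boundary_subcomplex boundary_supported)

lemma cycles_subcomplex: "cycles X i \<inter> supported_on Y = cycles Y i"
  by (auto simp: cycles_def supported_on_level_subset[OF YX] boundary_subcomplex)

lemma boundaries_subcomplex: "boundaries Y i \<subseteq> boundaries X i \<inter> supported_on Y"
proof
  fix w assume "w \<in> boundaries Y i"
  then obtain v where "v \<in> supported_on (level X i)" "v \<in> supported_on Y" "w = boundary X v"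
    by (auto simp: boundaries_def supported_on_level_subset[OF YX] boundary_subcomplex)
  then show "w \<in> boundaries X i \<inter> supported_on Y"
    by (simp add: boundaries_def boundary_supported_sub)
qed

lemma coord_proj_level:
  "v \<in> supported_on (level X i) \<Longrightarrow> coord_proj (X - Y) v \<in> supported_on (level (X - Y) i)"
  by (auto simp: supported_on_def coord_proj_def level_def)

lemma quotient_level:
  assumes "v \<in> supported_on (level (X - Y) i)"
  shows "v \<in> supported_on (level X i)" "coord_proj (X - Y) v = v"
  using assms by (auto simp: supported_on_level_subset[of "X - Y" X] coord_proj_id)

lemma coord_proj_boundaries:
  "coord_proj (X - Y) ` boundaries X i = (boundaries (X - Y) i :: (nat set \<Rightarrow> 'k::field) set)"
proof -
  have "coord_proj (X - Y) ` boundaries X i =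
      boundary (X - Y) ` coord_proj (X - Y) ` (supported_on (level X i) :: (nat set \<Rightarrow> 'k) set)"
    by (simp add: boundaries_def image_image boundary_quotient)
  also have "coord_proj (X - Y) ` (supported_on (level X i) :: (nat set \<Rightarrow> 'k) set) = supported_on (level (X - Y) i)"
    using coord_proj_level quotient_level by (force simp: image_iff)
  finally show ?thesis
    by (simp add: boundaries_def)
qed

lemma dim_coord_proj:
  fixes V :: "(nat set \<Rightarrow> 'k::field) set"
  assumes "fun_vs.subspace V" "V \<subseteq> supported_on X"
  shows "fun_vs.dim V = fun_vs.dim (V \<inter> supported_on Y) + fun_vs.dim (coord_proj (X - Y) ` V)"
proof -
  have "{v \<in> V. coord_proj (X - Y) v = 0} = V \<inter> supported_on Y"
    using coord_proj_quotient_eq_0_iff assms(2) by auto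
  then show ?thesis
    using fun_rank_nullity[OF fun_linear_coord_proj[of "X - Y"] assms(1) set_complex_finite[OF X] assms(2)] by simp
qed

lemma dim_boundaries:
  "fun_vs.dim (boundaries X i :: (nat set \<Rightarrow> 'k::field) set) =
    fun_vs.dim (boundaries X i \<inter> supported_on Y :: (nat set \<Rightarrow> 'k) set) + fun_vs.dim (boundaries (X - Y) i :: (nat set \<Rightarrow> 'k) set)"
  using dim_coord_proj[OF subspace_boundaries boundaries_supported, of i, where 'k='k]
  unfolding coord_proj_boundaries .

lemma connecting_rank_nonneg: "connecting_rank TYPE('k::field) X Y i \<ge> 0"
proof -
  have "fun_vs.dim (boundaries Y i :: (nat set \<Rightarrow> 'k) set) \<le> fun_vs.dim (boundaries X i \<inter> supported_on Y :: (nat set \<Rightarrow> 'k) set)"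
    by (rule fun_dim_mono[OF boundaries_subcomplex set_complex_finite[OF set_complex_subcomplex]]) simp
  then show ?thesis
    by (simp add: connecting_rank_def)
qed

lemma connecting_rank_0: "connecting_rank TYPE('k::field) X Y 0 = 0"
  by (simp add: connecting_rank_def boundaries_0[OF X] boundaries_0[OF set_complex_subcomplex])

lemma connecting_rank_le: "connecting_rank TYPE('k::field) X Y (Suc i) \<le> homology_dim TYPE('k) Y i"
proof -
  have "boundaries X (Suc i) \<inter> supported_on Y \<subseteq> (cycles Y i :: (nat set \<Rightarrow> 'k) set)"
    using boundaries_subset_cycles[OF X] cycles_subcomplex by blast
  from fun_dim_mono[OF this set_complex_finite[OF set_complex_subcomplex] cycles_supported] show ?thesis
    by (simp add: connecting_rank_def homology_dim_def)
qed

text \<open>The image of \<open>H\<^sub>i(Y)\<close> in \<open>H\<^sub>i(X)\<close> has dimension at most that of \<open>H\<^sub>i(X)\<close>.\<close>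

lemma homology_dim_subcomplex_le:
  "homology_dim TYPE('k::field) Y i \<le> homology_dim TYPE('k) X i + connecting_rank TYPE('k) X Y (Suc i)"
proof -
  let ?Z = "cycles X i :: (nat set \<Rightarrow> 'k) set"
  have "fun_vs.dim ?Z = fun_vs.dim (cycles Y i :: (nat set \<Rightarrow> 'k) set) + fun_vs.dim (coord_proj (X - Y) ` ?Z)"
    using dim_coord_proj[OF subspace_cycles cycles_supported] cycles_subcomplex by metis
  moreover have "fun_vs.dim (boundaries (X - Y) (Suc i) :: (nat set \<Rightarrow> 'k) set) \<le> fun_vs.dim (coord_proj (X - Y) ` ?Z)"
  proof (rule fun_dim_mono[OF _ set_complex_finite[OF set_complex_quotient]])
    show "boundaries (X - Y) (Suc i) \<subseteq> coord_proj (X - Y) ` ?Z"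
      using coord_proj_boundaries boundaries_subset_cycles[OF X] by blast
    show "coord_proj (X - Y) ` ?Z \<subseteq> supported_on (X - Y)"
      by (auto intro: coord_proj_supported)
  qed
  ultimately show ?thesis
    using dim_boundaries[of "Suc i", where 'k='k] by (simp add: homology_dim_def connecting_rank_def)
qed

definition relative_cycles :: "nat \<Rightarrow> (nat set \<Rightarrow> 'k::field) set" where
  "relative_cycles i = {v \<in> supported_on (level X i). boundary X v \<in> supported_on Y}"

lemma subspace_relative_cycles: "fun_vs.subspace (relative_cycles i)"
  unfolding relative_cycles_def
  by (rule subspace_linear_constraint[OF fun_linear_boundary subspace_supported_on subspace_supported_on])

lemma relative_cycles_supported: "relative_cycles i \<subseteq> supported_on X"
  by (auto simp: relative_cycles_def supported_on_level)

lemma coord_proj_relative_cycles: "coord_proj (X - Y) ` relative_cycles i = (cycles (X - Y) i :: (nat set \<Rightarrow> 'k::field) set)"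
proof (intro equalityI subsetI)
  fix w :: "nat set \<Rightarrow> 'k" assume "w \<in> coord_proj (X - Y) ` relative_cycles i"
  then obtain v where v: "v \<in> supported_on (level X i)" "boundary X v \<in> supported_on Y" "w = coord_proj (X - Y) v"
    by (auto simp: relative_cycles_def)
  have "boundary (X - Y) w = 0"
    using v by (simp add: boundary_quotient[symmetric] coord_proj_quotient_eq_0_iff[OF boundary_supported])
  then show "w \<in> cycles (X - Y) i"
    using coord_proj_level[OF v(1)] v(3) by (simp add: cycles_def)
next
  fix w :: "nat set \<Rightarrow> 'k" assume "w \<in> cycles (X - Y) i"
  then have w: "w \<in> supported_on (level X i)" "coord_proj (X - Y) w = w" "boundary (X - Y) w = 0"
    using quotient_level by (auto simp: cycles_def)
  then have "boundary X w \<in> supported_on Y"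
    using boundary_quotient[of w] by (simp add: coord_proj_quotient_eq_0_iff[OF boundary_supported])
  then show "w \<in> coord_proj (X - Y) ` relative_cycles i"
    using w by (intro image_eqI[of _ _ w]) (simp_all add: relative_cycles_def)
qed

lemma dim_relative_cycles_quotient:
  "fun_vs.dim (relative_cycles i :: (nat set \<Rightarrow> 'k::field) set) =
    card (level Y i) + fun_vs.dim (cycles (X - Y) i :: (nat set \<Rightarrow> 'k) set)"
proof -
  have "relative_cycles i \<inter> supported_on Y = (supported_on (level Y i) :: (nat set \<Rightarrow> 'k) set)"
    by (auto simp: relative_cycles_def supported_on_level_subset[OF YX] boundary_supported_sub)
  moreover have "finite (level Y i)"
    by (rule finite_subset[OF level_subset set_complex_finite[OF set_complex_subcomplex]])
  ultimately show ?thesis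
    using dim_coord_proj[OF subspace_relative_cycles relative_cycles_supported, of i, where 'k='k]
    unfolding coord_proj_relative_cycles by (simp add: dim_supported_on)
qed

lemma dim_relative_cycles_boundary:
  "fun_vs.dim (relative_cycles i :: (nat set \<Rightarrow> 'k::field) set) =
    fun_vs.dim (cycles X i :: (nat set \<Rightarrow> 'k) set) + fun_vs.dim (boundaries X i \<inter> supported_on Y :: (nat set \<Rightarrow> 'k) set)"
proof -
  have "{v \<in> relative_cycles i. boundary X v = 0} = (cycles X i :: (nat set \<Rightarrow> 'k) set)"
    by (auto simp: relative_cycles_def cycles_def)
  moreover have "boundary X ` relative_cycles i = (boundaries X i \<inter> supported_on Y :: (nat set \<Rightarrow> 'k) set)"
    by (auto simp: relative_cycles_def boundaries_def)
  ultimately show ?thesis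
    using fun_rank_nullity[OF fun_linear_boundary[of X, where 'k='k] subspace_relative_cycles set_complex_finite[OF X]
        relative_cycles_supported, of i] by simp
qed

theorem homology_dim_exact:
  "homology_dim TYPE('k::field) (X - Y) i + homology_dim TYPE('k) Y i =
    homology_dim TYPE('k) X i + connecting_rank TYPE('k) X Y i + connecting_rank TYPE('k) X Y (Suc i)"
  using dim_boundaries[of "Suc i", where 'k='k] dim_relative_cycles_quotient[of i, where 'k='k]
    dim_relative_cycles_boundary[of i, where 'k='k] card_level_eq[OF set_complex_subcomplex, of i, where 'k='k]
  by (simp add: homology_dim_def connecting_rank_def)

lemma homology_dim_acyclic_quotient:
  assumes "\<And>j. homology_dim TYPE('k::field) (X - Y) j = 0"
  shows "homology_dim TYPE('k) X i = homology_dim TYPE('k) Y i"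
proof -
  have "connecting_rank TYPE('k) X Y i = 0" for i
    using homology_dim_exact[of i, where 'k='k] homology_dim_subcomplex_le[of i, where 'k='k]
      assms[of i] connecting_rank_nonneg[of i, where 'k='k] by linarith
  then show ?thesis
    using homology_dim_exact[of i, where 'k='k] assms[of i] by simp
qed

end

section \<open>Nearly complete intersections\<close>

definition min_sets :: "'a set set \<Rightarrow> 'a set set" where
  "min_sets S = {g \<in> S. \<forall>h\<in>S. h \<subseteq> g \<longrightarrow> h = g}"

lemma min_sets_subset: "min_sets S \<subseteq> S"
  by (auto simp: min_sets_def)

lemma min_setsD: "f \<in> min_sets S \<Longrightarrow> h \<in> S \<Longrightarrow> h \<subseteq> f \<Longrightarrow> h = f"
  by (simp add: min_sets_def)

lemma min_setsI: "f \<in> S \<Longrightarrow> (\<And>h. h \<in> S \<Longrightarrow> h \<subseteq> f \<Longrightarrow> h = f) \<Longrightarrow> f \<in> min_sets S"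
  by (simp add: min_sets_def)

lemma min_sets_below:
  assumes "finite S" "g \<in> S"
  obtains f where "f \<in> min_sets S" "f \<subseteq> g"
proof -
  have "finite {h \<in> S. h \<subseteq> g}" "{h \<in> S. h \<subseteq> g} \<noteq> {}"
    using assms by auto
  from finite_has_minimal[OF this] obtain f where "f \<in> S" "f \<subseteq> g"
    and "\<forall>h\<in>{h \<in> S. h \<subseteq> g}. h \<subseteq> f \<longrightarrow> f = h"
    by auto
  then have "f \<in> min_sets S"
    by (intro min_setsI) auto
  then show ?thesis
    using \<open>f \<subseteq> g\<close> that by blast
qed

lemma min_sets_image_mono:
  assumes "finite S" "\<And>g h. g \<subseteq> h \<Longrightarrow> \<phi> g \<subseteq> \<phi> h"
  shows "min_sets (\<phi> ` min_sets S) = min_sets (\<phi> ` S)"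
proof -
  have below: "\<exists>e\<in>\<phi> ` min_sets S. e \<subseteq> f" if "f \<in> \<phi> ` S" for f
  proof -
    from that obtain h where h: "h \<in> S" "f = \<phi> h"
      by blast
    obtain g where "g \<in> min_sets S" "g \<subseteq> h"
      using min_sets_below[OF assms(1) h(1)] .
    then show ?thesis
      using assms(2) h(2) by blast
  qed
  have sub: "\<phi> ` min_sets S \<subseteq> \<phi> ` S"
    by (rule image_mono[OF min_sets_subset])
  show ?thesis
  proof (intro equalityI subsetI)
    fix f assume f: "f \<in> min_sets (\<phi> ` min_sets S)"
    show "f \<in> min_sets (\<phi> ` S)"
    proof (rule min_setsI)
      show "f \<in> \<phi> ` S"
        using subsetD[OF min_sets_subset f] sub by blast
      fix h assume h: "h \<in> \<phi> ` S" "h \<subseteq> f"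
      then obtain e where "e \<in> \<phi> ` min_sets S" "e \<subseteq> h"
        using below[OF h(1)] by blast
      then show "h = f"
        using min_setsD[OF f, of e] h(2) by blast
    qed
  next
    fix f assume f: "f \<in> min_sets (\<phi> ` S)"
    then obtain e where e: "e \<in> \<phi> ` min_sets S" "e \<subseteq> f"
      using below[OF subsetD[OF min_sets_subset f]] by blast
    then have "e = f"
      using min_setsD[OF f subsetD[OF sub e(1)]] by simp
    then show "f \<in> min_sets (\<phi> ` min_sets S)"
      using e(1) min_setsD[OF f subsetD[OF sub]] by (intro min_setsI) simp_all
  qed
qed

definition contract :: "'a \<Rightarrow> 'a set set \<Rightarrow> 'a set set" where
  "contract x G = min_sets ((\<lambda>g. g - {x}) ` G)"

definition deletion :: "'a \<Rightarrow> 'a set set \<Rightarrow> 'a set set" where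
  "deletion x G = {g \<in> G. x \<notin> g}"

definition minimal_cover :: "'a set set \<Rightarrow> 'a set \<Rightarrow> bool" where
  "minimal_cover G D \<longleftrightarrow> finite D \<and> (\<forall>g\<in>G. g \<inter> D \<noteq> {}) \<and> (\<forall>d\<in>D. \<exists>g\<in>G. g \<inter> D = {d})"

lemma minimal_cover_finite: "minimal_cover G D \<Longrightarrow> finite D"
  and minimal_cover_meets: "minimal_cover G D \<Longrightarrow> g \<in> G \<Longrightarrow> g \<inter> D \<noteq> {}"
  and minimal_cover_private: "minimal_cover G D \<Longrightarrow> d \<in> D \<Longrightarrow> \<exists>g\<in>G. g \<inter> D = {d}"
  by (auto simp: minimal_cover_def)

lemma minimal_cover_avoiding:
  assumes "finite G" "\<And>g. g \<in> G \<Longrightarrow> finite g" "\<And>g. g \<in> G \<Longrightarrow> \<not> g \<subseteq> T"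
  obtains D where "minimal_cover G D" "D \<inter> T = {}"
proof -
  let ?C = "{D. D \<subseteq> \<Union>G - T \<and> (\<forall>g\<in>G. g \<inter> D \<noteq> {})}"
  have fin: "finite (\<Union>G - T)"
    using assms(1,2) by auto
  then have "finite ?C"
    by (rule finite_subset[rotated, OF finite_Pow_iff[THEN iffD2]]) auto
  moreover have "\<Union>G - T \<in> ?C"
    using assms(3) by blast
  then have "?C \<noteq> {}"
    by blast
  ultimately have "\<exists>D\<in>?C. \<forall>E\<in>?C. E \<subseteq> D \<longrightarrow> D = E"
    by (rule finite_has_minimal)
  then obtain D where D: "D \<in> ?C" and minimal: "\<forall>E\<in>?C. E \<subseteq> D \<longrightarrow> D = E"
    by (rule bexE)
  have "\<exists>g\<in>G. g \<inter> D = {d}" if "d \<in> D" for d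
  proof -
    have "D - {d} \<notin> ?C"
    proof
      assume "D - {d} \<in> ?C"
      then have "D = D - {d}"
        by (rule minimal[rule_format]) blast
      then show False
        using that by blast
    qed
    then obtain g where g: "g \<in> G" "g \<inter> (D - {d}) = {}"
      using D by blast
    moreover have "g \<inter> D \<noteq> {}"
      using D g(1) by blast
    ultimately have "g \<inter> D = {d}"
      by blast
    then show ?thesis
      using g(1) by blast
  qed
  then have "minimal_cover G D"
    unfolding minimal_cover_def using D finite_subset[OF _ fin] by blast
  then show ?thesis
    using D that by blast
qed

definition good_cover :: "'a set set \<Rightarrow> 'a \<Rightarrow> 'a set \<Rightarrow> bool" where
  "good_cover G x D \<longleftrightarrow> minimal_cover (deletion x G) D \<and>
     ((\<exists>d\<in>D. d \<notin> \<Union>(contract x G)) \<or>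
      (\<exists>f\<in>contract x G. \<exists>d\<in>D \<inter> f. \<exists>d'\<in>D \<inter> f. d \<noteq> d') \<or>
      ((\<forall>f\<in>contract x G. \<exists>v. f = {v}) \<and> (\<exists>d\<in>D. {d} \<notin> G)))"

lemma contractE:
  assumes "f \<in> contract x G"
  obtains g where "g \<in> G" "f = g - {x}"
  using assms by (auto simp: contract_def min_sets_def)

lemma contractI:
  "g \<in> G \<Longrightarrow> (\<And>e. e \<in> G \<Longrightarrow> e - {x} \<subseteq> g - {x} \<Longrightarrow> e - {x} = g - {x}) \<Longrightarrow> g - {x} \<in> contract x G"
  by (auto simp: contract_def min_sets_def)

locale nearly_complete_intersection =
  fixes G :: "'a set set"
  assumes finite_family: "finite G" and finite_edge: "\<And>g. g \<in> G \<Longrightarrow> finite g" and nonempty: "{} \<notin> G"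
    and antichain: "\<And>g h. g \<in> G \<Longrightarrow> h \<in> G \<Longrightarrow> g \<subseteq> h \<Longrightarrow> g = h"
    and not_disjoint: "\<not> disjoint G"
    and contract_disjoint: "\<And>x. x \<in> \<Union>G \<Longrightarrow> {x} \<notin> G \<Longrightarrow> disjoint (contract x G)"
begin

definition vertices :: "'a set" where
  "vertices = {v \<in> \<Union>G. {v} \<notin> G}"

definition adjacent :: "'a \<Rightarrow> 'a \<Rightarrow> bool" where
  "adjacent u v \<longleftrightarrow> {u, v} \<in> G \<and> u \<noteq> v"

lemma verticesD: "v \<in> vertices \<Longrightarrow> v \<in> \<Union>G" "v \<in> vertices \<Longrightarrow> {v} \<notin> G"
  by (auto simp: vertices_def)

lemma verticesI: "g \<in> G \<Longrightarrow> v \<in> g \<Longrightarrow> u \<in> g \<Longrightarrow> u \<noteq> v \<Longrightarrow> v \<in> vertices"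
  unfolding vertices_def using antichain[of "{v}" g] by auto

lemma adjacent_sym: "adjacent u v \<longleftrightarrow> adjacent v u"
  by (auto simp: adjacent_def insert_commute)

lemma adjacentD: "adjacent u v \<Longrightarrow> {u, v} \<in> G" "adjacent u v \<Longrightarrow> u \<noteq> v"
  by (auto simp: adjacent_def)

lemma adjacent_vertices: "adjacent u v \<Longrightarrow> u \<in> vertices" "adjacent u v \<Longrightarrow> v \<in> vertices"
  using verticesI[of "{u, v}"] by (auto simp: adjacent_def)

lemma edge_Diff_nonempty: "x \<in> vertices \<Longrightarrow> g \<in> G \<Longrightarrow> g - {x} \<noteq> {}"
  using verticesD(2) nonempty by (metis Diff_eq_empty_iff subset_singletonD)

lemma contract_nonempty: "x \<in> vertices \<Longrightarrow> f \<in> contract x G \<Longrightarrow> f \<noteq> {}"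
  by (metis contractE edge_Diff_nonempty)

lemma contract_singleton:
  assumes "x \<in> vertices" "g \<in> G" "g - {x} = {v}"
  shows "{v} \<in> contract x G"
proof -
  have "g - {x} \<in> contract x G"
  proof (rule contractI[OF assms(2)])
    fix e assume "e \<in> G" "e - {x} \<subseteq> g - {x}"
    then show "e - {x} = g - {x}"
      using edge_Diff_nonempty[OF assms(1), of e] assms(3) by auto
  qed
  then show ?thesis
    using assms(3) by simp
qed

lemma contract_adjacent: "adjacent x v \<Longrightarrow> {v} \<in> contract x G"
  by (rule contract_singleton[of x "{x, v}"]) (auto simp: adjacent_vertices adjacentD)

lemma contract_generator: "x \<in> vertices \<Longrightarrow> {v} \<in> G \<Longrightarrow> {v} \<in> contract x G"
  by (rule contract_singleton[of x "{v}"]) (use verticesD(2)[of x] in auto)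

lemma contract_unique:
  "x \<in> vertices \<Longrightarrow> f \<in> contract x G \<Longrightarrow> f' \<in> contract x G \<Longrightarrow> v \<in> f \<Longrightarrow> v \<in> f' \<Longrightarrow> f = f'"
  using disjointD[OF contract_disjoint] verticesD by (metis disjoint_iff)

lemma edges_meet_once:
  assumes "g \<in> G" "h \<in> G" "g \<noteq> h" "y \<in> g" "y \<in> h" "w \<in> g" "w \<in> h"
  shows "y = w"
proof (rule ccontr)
  assume "y \<noteq> w"
  then have y: "y \<in> vertices"
    using verticesI[OF assms(1,4,6)] by blast
  have "k - {y} \<in> contract y G" if k: "k \<in> G" "y \<in> k" for k
  proof (rule contractI[OF k(1)])
    fix e assume e: "e \<in> G" "e - {y} \<subseteq> k - {y}"
    then have "e \<subseteq> k"
      using k(2) by auto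
    then show "e - {y} = k - {y}"
      using antichain[OF e(1) k(1)] by simp
  qed
  then have "g - {y} = h - {y}"
    using contract_unique[OF y, of "g - {y}" "h - {y}" w] \<open>y \<noteq> w\<close> assms by blast
  then show False
    using assms(3-5) by (metis insert_Diff)
qed

lemma adjacent_of_not_contracted:
  assumes g: "g \<in> G" and y: "y \<in> vertices" and "g - {y} \<notin> contract y G"
  shows "y \<notin> g \<and> (\<exists>a\<in>g. adjacent y a)"
proof -
  obtain e where e: "e \<in> G" "e - {y} \<subseteq> g - {y}" "e - {y} \<noteq> g - {y}"
    using contractI[OF g] assms(3) by metis
  then have "\<not> e \<subseteq> g"
    using antichain[OF e(1) g] by auto
  then have ye: "y \<in> e" "y \<notin> g"
    using e(2) by auto
  obtain a where a: "a \<in> e" "a \<noteq> y" "a \<in> g"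
    using edge_Diff_nonempty[OF y e(1)] e(2) by blast
  have "b = a" if "b \<in> e" "b \<noteq> y" for b
    using edges_meet_once[OF e(1) g] that a ye e(2) by blast
  then have "e = {y, a}"
    using ye(1) a(1) by blast
  then show ?thesis
    using ye a e(1) by (auto simp: adjacent_def)
qed

text \<open>Contracting at \<open>y\<close> must not leave both \<open>g\<close> and \<open>h\<close> minimal, so one of them contains a neighbour of \<open>y\<close>.\<close>

lemma adjacent_to_meeting_edges:
  assumes "g \<in> G" "h \<in> G" "g \<noteq> h" "w \<in> g" "w \<in> h" "y \<in> vertices" "y \<noteq> w"
  obtains a where "y \<notin> g" "a \<in> g" "adjacent y a" | a where "y \<notin> h" "a \<in> h" "adjacent y a"
proof (cases "g - {y} \<in> contract y G \<and> h - {y} \<in> contract y G")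
  case True
  then have "g - {y} = h - {y}"
    using contract_unique[OF assms(6), of "g - {y}" "h - {y}" w] assms(4,5,7) by blast
  then have "g \<subseteq> h \<or> h \<subseteq> g"
    by blast
  then show ?thesis
    using antichain assms(1-3) by metis
next
  case False
  then show ?thesis
    using adjacent_of_not_contracted assms(1,2,6) that by blast
qed

lemma exists_minimal_cover:
  assumes "\<And>g. g \<in> G \<Longrightarrow> \<not> g \<subseteq> T"
  obtains D where "minimal_cover (deletion x G) D" "D \<inter> T = {}"
  using minimal_cover_avoiding[of "deletion x G" T] assms finite_family finite_edge by (auto simp: deletion_def)

lemma no_edge_in_singleton: "v \<in> vertices \<Longrightarrow> g \<in> G \<Longrightarrow> \<not> g \<subseteq> {v}"
  using nonempty verticesD(2) by (metis subset_singletonD)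

lemma neighbour_in_cover:
  assumes "minimal_cover (deletion x G) D" "D \<inter> T = {}" "adjacent v t" "t \<in> T" "v \<noteq> x" "t \<noteq> x"
  shows "v \<in> D"
proof -
  have "{v, t} \<in> deletion x G"
    using assms(3,5,6) by (auto simp: deletion_def adjacentD)
  then show ?thesis
    using minimal_cover_meets[OF assms(1)] assms(2,4) by blast
qed

lemma good_cover_of_nonneighbours:
  assumes x: "x \<in> vertices" and D: "minimal_cover (deletion x G) D"
    and nonneighbours: "\<And>v. v \<in> vertices \<Longrightarrow> v \<noteq> x \<Longrightarrow> \<not> adjacent x v \<Longrightarrow> v \<in> D"
    and d: "d \<in> D" "d \<in> vertices"
  shows "good_cover G x D"
proof (cases "D \<subseteq> \<Union>(contract x G) \<and> (\<forall>f\<in>contract x G. \<forall>d\<in>D \<inter> f. \<forall>d'\<in>D \<inter> f. d = d')")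
  case False
  then show ?thesis
    using D unfolding good_cover_def by blast
next
  case True
  then have once: "d = d'" if "f \<in> contract x G" "d \<in> D \<inter> f" "d' \<in> D \<inter> f" for f d d'
    using that by blast
  have "\<exists>v. f = {v}" if f: "f \<in> contract x G" for f
  proof (cases "f \<subseteq> D")
    case True
    obtain v where "v \<in> f"
      using contract_nonempty[OF x f] by blast
    then have "f = {v}"
      using once[OF f] True by blast
    then show ?thesis
      by blast
  next
    case False
    then obtain v g where v: "v \<in> f" "v \<notin> D" "g \<in> G" "f = g - {x}"
      using contractE[OF f] by blast
    then have "{v} \<in> G \<or> adjacent x v"
      using nonneighbours[of v] by (auto simp: vertices_def)
    then have "{v} \<in> contract x G"
      using contract_generator[OF x] contract_adjacent by blast
    then show ?thesis
      using contract_unique[OF x f _ v(1)] by blast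
  qed
  then show ?thesis
    using D d verticesD(2) unfolding good_cover_def by blast
qed

lemma large_edge_not_adjacent:
  assumes g: "g \<in> G" "3 \<le> card g" and ab: "a \<in> g" "b \<in> g"
  shows "\<not> adjacent a b"
proof
  assume adj: "adjacent a b"
  then have "{a, b} = g"
    using antichain[OF adjacentD(1) g(1)] ab by auto
  then show False
    using g(2) adjacentD(2)[OF adj] by auto
qed

lemma adjacent_to_large_edge:
  assumes g: "g \<in> G" "3 \<le> card g" and v: "v \<notin> g" "adjacent v a" "a \<in> g" and u: "u \<in> g" "u \<in> vertices"
  shows "adjacent u v"
proof (cases "u = a")
  case False
  have "g \<noteq> {v, a}"
    using v(1) by auto
  from adjacent_to_meeting_edges[OF g(1) adjacentD(1)[OF v(2)] this v(3) _ u(2) False]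
  show ?thesis
    using u(1) v large_edge_not_adjacent[OF g] by blast
qed (use v adjacent_sym in blast)

lemma good_cover_of_large_edge:
  assumes g: "g \<in> G" "3 \<le> card g" and h: "h \<in> G" "h \<noteq> g" and w: "w \<in> g" "w \<in> h"
  shows "\<exists>D. w \<in> vertices \<and> good_cover G w D"
proof -
  note not_adjacent = large_edge_not_adjacent[OF g]
  have "\<exists>b\<in>g. b \<noteq> a" for a
    using g(2) card_mono[of "{a}" g] by fastforce
  then obtain y where y: "y \<in> g" "y \<noteq> w" and g_vertices: "\<And>u. u \<in> g \<Longrightarrow> u \<in> vertices"
    using verticesI[OF g(1)] by metis
  have adjacent_all: "adjacent u v" if "v \<notin> g" "adjacent v a" "a \<in> g" "u \<in> g" for u v a
    by (rule adjacent_to_large_edge[OF g that g_vertices[OF that(4)]])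
  obtain z where z: "z \<in> h" "adjacent y z"
    using adjacent_to_meeting_edges[OF g(1) h(1) h(2)[symmetric] w g_vertices[OF y(1)] y(2)] y(1) by blast
  have "z \<noteq> w"
    using not_adjacent z(2) y(1) w(1) by blast
  then have "z \<notin> g"
    using edges_meet_once[OF g(1) h(1) h(2)[symmetric] _ z(1) w] by blast
  have w_or_z: "adjacent w v \<or> adjacent z v" if v: "v \<in> vertices" "v \<noteq> w" for v
  proof (cases "v \<in> g")
    case True
    then show ?thesis
      using adjacent_all[OF \<open>z \<notin> g\<close> _ y(1)] z(2) adjacent_sym by blast
  next
    case False
    have "g \<noteq> {y, z}"
      using \<open>z \<notin> g\<close> by auto
    from adjacent_to_meeting_edges[OF g(1) adjacentD(1)[OF z(2)] this y(1) _ v(1)]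
    show ?thesis
      using False y(1) adjacent_all[OF False _ _ w(1)] adjacent_sym by blast
  qed
  obtain D where D: "minimal_cover (deletion w G) D" "D \<inter> {z} = {}"
    using exists_minimal_cover no_edge_in_singleton adjacent_vertices(2)[OF z(2)] by metis
  have neighbours: "v \<in> D" if "adjacent z v" "v \<noteq> w" for v
    using neighbour_in_cover[OF D _ singletonI that(2) \<open>z \<noteq> w\<close>] that(1) adjacent_sym by blast
  have "good_cover G w D"
  proof (rule good_cover_of_nonneighbours[OF g_vertices[OF w(1)] D(1)])
    show "v \<in> D" if "v \<in> vertices" "v \<noteq> w" "\<not> adjacent w v" for v
      using w_or_z neighbours that by blast
    show "y \<in> D"
      using neighbours z(2) y(2) adjacent_sym by blast
  qed (rule g_vertices[OF y(1)])
  then show ?thesis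
    using g_vertices[OF w(1)] by blast
qed

end

locale nearly_complete_intersection_graph = nearly_complete_intersection +
  assumes edge_pair: "\<And>g v. g \<in> G \<Longrightarrow> v \<in> g \<Longrightarrow> v \<in> vertices \<Longrightarrow> \<exists>u. g = {v, u}"
begin

lemma edge_adjacent:
  assumes "g \<in> G" "v \<in> g" "v \<in> vertices"
  obtains u where "g = {v, u}" "adjacent v u"
proof -
  obtain u where "g = {v, u}"
    using edge_pair[OF assms] by blast
  moreover have "v \<noteq> u"
    using assms(1) verticesD(2)[OF assms(3)] \<open>g = {v, u}\<close> by auto
  ultimately show ?thesis
    using assms(1) that by (simp add: adjacent_def)
qed

lemma good_cover_of_uncovered:
  assumes x: "x \<in> vertices" and z: "z \<in> vertices" "z \<noteq> x" "z \<notin> \<Union>(contract x G)"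
  shows "\<exists>D. good_cover G x D"
proof -
  obtain n where n: "adjacent z n"
    using edge_adjacent verticesD(1)[OF z(1)] z(1) by (metis UnionE)
  obtain D where D: "minimal_cover (deletion x G) D" "D \<inter> {n} = {}"
    using exists_minimal_cover no_edge_in_singleton adjacent_vertices(2)[OF n] by metis
  have "n \<noteq> x"
    using contract_adjacent n z(3) adjacent_sym by blast
  then have "z \<in> D"
    using neighbour_in_cover[OF D n] z(2) by blast
  then show ?thesis
    using D(1) z(3) unfolding good_cover_def by blast
qed

lemma exists_partner:
  assumes x: "x \<in> vertices" and z: "z \<in> vertices" "\<not> adjacent x z" "z \<in> \<Union>(contract x G)"
  obtains q where "adjacent z q" "\<not> adjacent x q" "{z, q} \<in> contract x G"
proof -
  obtain f g where f: "f \<in> contract x G" "z \<in> f" "g \<in> G" "f = g - {x}"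
    using z(3) contractE by (metis UnionE)
  then obtain q where q: "g = {z, q}" "adjacent z q"
    using edge_adjacent[of g z] z(1) by blast
  then have "f = {z, q}"
    using f z(2) adjacent_sym by auto
  moreover have "\<not> adjacent x q"
    using contract_adjacent contract_unique[OF x f(1), of "{q}" q] \<open>f = {z, q}\<close> adjacentD(2)[OF q(2)] by blast
  ultimately show ?thesis
    using that q(2) f(1) by blast
qed

lemma partner_unique:
  assumes x: "x \<in> vertices" and z: "z \<noteq> x" "\<not> adjacent x z"
    and "adjacent z q" "\<not> adjacent x q" "adjacent z q'" "\<not> adjacent x q'"
  shows "q = q'"
proof -
  have "{z, r} \<in> contract x G" if r: "adjacent z r" "\<not> adjacent x r" for r
  proof -
    have "r \<noteq> x"
      using r(1) z(2) adjacent_sym by blast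
    have "{z, r} - {x} \<in> contract x G"
    proof (rule contractI[OF adjacentD(1)[OF r(1)]])
      fix e assume e: "e \<in> G" "e - {x} \<subseteq> {z, r} - {x}"
      show "e - {x} = {z, r} - {x}"
      proof (cases "x \<in> e")
        case True
        then obtain u where "e = {x, u}" "adjacent x u"
          using edge_adjacent[OF e(1) _ x] by blast
        then show ?thesis
          using e(2) z(2) r(2) adjacentD(2)[of x u] by auto
      next
        case False
        then have "e \<subseteq> {z, r}"
          using e(2) by auto
        then show ?thesis
          using antichain[OF e(1) adjacentD(1)[OF r(1)]] by simp
      qed
    qed
    moreover have "{z, r} - {x} = {z, r}"
      using z(1) \<open>r \<noteq> x\<close> by auto
    ultimately show ?thesis
      by simp
  qed
  then have "{z, q} = {z, q'}"
    using contract_unique[OF x, of "{z, q}" "{z, q'}" z] assms(4-7) by blast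
  then show ?thesis
    by (auto simp: doubleton_eq_iff)
qed

lemma good_cover_of_matched_pair:
  assumes pq: "{p, q} \<in> contract w G" "p \<noteq> q"
    and n: "adjacent p m" "adjacent w m" "adjacent q n" "adjacent w n" and indep: "\<not> adjacent m n"
  shows "\<exists>D. good_cover G w D"
proof -
  have not_w: "p \<noteq> w" "q \<noteq> w" "m \<noteq> w" "n \<noteq> w"
    using contractE[OF pq(1)] adjacentD(2)[OF n(2)] adjacentD(2)[OF n(4)] by blast+
  have "\<not> e \<subseteq> {m, n}" if "e \<in> G" for e
  proof
    assume "e \<subseteq> {m, n}"
    moreover have "e \<noteq> {}" "e \<noteq> {m}" "e \<noteq> {n}"
      using \<open>e \<in> G\<close> nonempty verticesD(2) adjacent_vertices n by blast+
    ultimately have "e = {m, n}" "m \<noteq> n"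
      by blast+
    then show False
      using indep \<open>e \<in> G\<close> by (simp add: adjacent_def)
  qed
  then obtain D where D: "minimal_cover (deletion w G) D" "D \<inter> {m, n} = {}"
    using exists_minimal_cover by metis
  have "p \<in> D" "q \<in> D"
    using neighbour_in_cover[OF D] n(1,3) not_w by blast+
  then show ?thesis
    using D(1) pq unfolding good_cover_def by blast
qed

lemma good_cover_of_dominating:
  assumes w: "w \<in> vertices" "\<And>v. v \<in> vertices \<Longrightarrow> v \<noteq> w \<Longrightarrow> adjacent w v"
    and dn: "adjacent d n" "d \<noteq> w" "n \<noteq> w"
  shows "\<exists>D. good_cover G w D"
proof -
  obtain D where D: "minimal_cover (deletion w G) D" "D \<inter> {n} = {}"
    using exists_minimal_cover no_edge_in_singleton adjacent_vertices(2)[OF dn(1)] by metis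
  have "d \<in> D"
    using neighbour_in_cover[OF D dn(1) singletonI dn(2,3)] .
  then show ?thesis
    using good_cover_of_nonneighbours[OF w(1) D(1)] w(2) adjacent_vertices(1)[OF dn(1)] by blast
qed

lemma good_cover_of_star:
  assumes ab: "adjacent w a" "adjacent w b" "a \<noteq> b"
    and star: "\<And>u v. adjacent u v \<Longrightarrow> u = w \<or> v = w"
  shows "\<exists>D. good_cover G a D"
proof (rule good_cover_of_uncovered)
  show verts: "a \<in> vertices" "b \<in> vertices" "b \<noteq> a"
    using ab adjacent_vertices by blast+
  show "b \<notin> \<Union>(contract a G)"
  proof
    assume "b \<in> \<Union>(contract a G)"
    moreover have "\<not> adjacent a b"
      using star[of a b] adjacentD(2) ab by blast
    ultimately obtain q where q: "adjacent b q" "\<not> adjacent a q"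
      using exists_partner[OF verts(1,2)] by blast
    then have "q = w"
      using star adjacentD(2)[OF ab(2)] by blast
    then show False
      using q(2) ab(1) adjacent_sym by blast
  qed
qed

text \<open>Away from the neighbourhood of a vertex the graph is a perfect matching, unless \<open>good_cover_of_uncovered\<close> applies.\<close>

lemma good_cover_of_nonneighbour:
  assumes ab: "adjacent w a" "adjacent w b" "a \<noteq> b" and p: "p \<in> vertices" "p \<noteq> w" "\<not> adjacent w p"
  shows "\<exists>x D. x \<in> vertices \<and> good_cover G x D"
proof (rule ccontr)
  assume none: "\<not> ?thesis"
  have w: "w \<in> vertices"
    by (rule adjacent_vertices(1)[OF ab(1)])
  have covered: "z \<in> \<Union>(contract x G)" if "x \<in> vertices" "z \<in> vertices" "z \<noteq> x" for x z
    using none good_cover_of_uncovered that by blast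
  obtain q where q: "adjacent p q" "\<not> adjacent w q" "{p, q} \<in> contract w G"
    using exists_partner[OF w p(1,3) covered[OF w p(1,2)]] .
  have "p \<noteq> q" "q \<noteq> w" "q \<in> vertices"
    using q p adjacentD(2) adjacent_sym adjacent_vertices by blast+
  have linked: "adjacent m n" if "adjacent p m" "adjacent w m" "adjacent q n" "adjacent w n" for m n
    using none good_cover_of_matched_pair[OF q(3) \<open>p \<noteq> q\<close>] that w by blast
  obtain m where m: "adjacent p m" "adjacent w m"
  proof (cases "adjacent p a \<or> adjacent p b")
    case False
    then have "a = b"
      using partner_unique[OF p(1), of w a b] p(2,3) ab adjacent_sym by blast
    then show ?thesis
      using ab(3) by blast
  qed (use ab that in blast)
  have "\<not> adjacent m q"
    using linked[OF m _ m(2)] adjacent_sym adjacentD(2) by blast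
  moreover have "q \<noteq> m"
    using q(2) m(2) by blast
  ultimately obtain r where r: "adjacent q r" "\<not> adjacent m r"
    using exists_partner[OF adjacent_vertices(2)[OF m(1)] \<open>q \<in> vertices\<close>] covered adjacent_vertices(2)[OF m(1)] \<open>q \<in> vertices\<close>
    by metis
  have "adjacent w r"
  proof (rule ccontr)
    assume "\<not> adjacent w r"
    then have "r = p"
      using partner_unique[OF w \<open>q \<noteq> w\<close> q(2) r(1)] q(1) p(3) adjacent_sym by blast
    then show False
      using r(2) m(1) adjacent_sym by blast
  qed
  then show False
    using linked[OF m r(1)] r(2) by blast
qed

lemma good_cover_of_two_neighbours:
  assumes ab: "adjacent w a" "adjacent w b" "a \<noteq> b"
  shows "\<exists>x D. x \<in> vertices \<and> good_cover G x D"
proof (cases "\<forall>v\<in>vertices. v \<noteq> w \<longrightarrow> adjacent w v")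
  case True
  show ?thesis
  proof (cases "\<exists>d n. adjacent d n \<and> d \<noteq> w \<and> n \<noteq> w")
    case True
    then show ?thesis
      using good_cover_of_dominating \<open>\<forall>v\<in>vertices. _ v\<close> adjacent_vertices(1)[OF ab(1)] by blast
  next
    case False
    then show ?thesis
      using good_cover_of_star[OF ab] adjacent_vertices(2)[OF ab(1)] by blast
  qed
next
  case False
  then show ?thesis
    using good_cover_of_nonneighbour[OF ab] by blast
qed

end

context nearly_complete_intersection
begin

lemma graph_of_small_edges:
  assumes small: "\<And>g h. g \<in> G \<Longrightarrow> h \<in> G \<Longrightarrow> g \<noteq> h \<Longrightarrow> g \<inter> h \<noteq> {} \<Longrightarrow> card g < 3"
  shows "nearly_complete_intersection_graph G"
proof
  obtain g h w where gh: "g \<in> G" "h \<in> G" "g \<noteq> h" "w \<in> g" "w \<in> h"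
    using not_disjoint unfolding disjoint_def by blast
  fix e v assume e: "e \<in> G" "v \<in> e" "v \<in> vertices"
  have "\<exists>k\<in>G. k \<noteq> e \<and> e \<inter> k \<noteq> {}"
  proof (cases "v = w")
    case True
    then show ?thesis
      using gh e(2) by blast
  next
    case False
    obtain a k where ak: "adjacent v a" "k \<in> G" "v \<notin> k" "a \<in> k"
      using adjacent_to_meeting_edges[OF gh e(3) False] gh(1,2) by metis
    show ?thesis
    proof (cases "e = {v, a}")
      case True
      then show ?thesis
        using ak by (intro bexI[of _ k]) auto
    next
      case False
      then show ?thesis
        using e(2) adjacentD(1)[OF ak(1)] by (intro bexI[of _ "{v, a}"]) auto
    qed
  qed
  then have "card e < 3"
    using small e(1) by blast
  moreover obtain u where u: "u \<in> e" "u \<noteq> v"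
    using edge_Diff_nonempty[OF e(3,1)] by blast
  moreover have "card {v, u} = 2"
    using u(2) by simp
  ultimately have "{v, u} = e"
    using e(2) finite_edge[OF e(1)] by (intro card_seteq) auto
  then show "\<exists>u. e = {v, u}"
    by blast
qed

theorem exists_good_cover:
  obtains x D where "x \<in> \<Union>G" "{x} \<notin> G" "good_cover G x D"
proof (cases "\<exists>g\<in>G. 3 \<le> card g \<and> (\<exists>h\<in>G. h \<noteq> g \<and> g \<inter> h \<noteq> {})")
  case True
  then show ?thesis
    using good_cover_of_large_edge that verticesD by (metis disjoint_iff)
next
  case False
  then have "nearly_complete_intersection_graph G"
    by (intro graph_of_small_edges) (metis not_le)
  then interpret nearly_complete_intersection_graph G .
  obtain g h w where gh: "g \<in> G" "h \<in> G" "g \<noteq> h" "w \<in> g" "w \<in> h"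
    using not_disjoint unfolding disjoint_def by blast
  then have "w \<in> vertices"
    using antichain[of "{w}" g] antichain[of "{w}" h] by (auto simp: vertices_def)
  then obtain a b where "g = {w, a}" "adjacent w a" "h = {w, b}" "adjacent w b"
    using edge_adjacent gh by metis
  then show ?thesis
    using good_cover_of_two_neighbours[of w a b] gh(3) that verticesD by blast
qed

end

section \<open>Betti numbers of set families\<close>

definition union_complex :: "nat set \<Rightarrow> (nat \<Rightarrow> 'u set) \<Rightarrow> 'u set \<Rightarrow> nat set set" where
  "union_complex A s m = {\<sigma>. \<sigma> \<subseteq> A \<and> \<Union>(s ` \<sigma>) = m}"

lemma set_complex_union_complex:
  assumes "finite A"
  shows "set_complex (union_complex A s m)"
  unfolding set_complex_def
proof (intro conjI ballI allI impI)
  show "finite (union_complex A s m)"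
    by (rule finite_subset[of _ "Pow A"]) (use assms in \<open>auto simp: union_complex_def\<close>)
  show "finite \<sigma>" if "\<sigma> \<in> union_complex A s m" for \<sigma>
    using that assms finite_subset by (auto simp: union_complex_def)
  show "\<rho> \<in> union_complex A s m"
    if "\<tau> \<in> union_complex A s m" "\<sigma> \<in> union_complex A s m" "\<tau> \<subseteq> \<rho>" "\<rho> \<subseteq> \<sigma>" for \<tau> \<sigma> \<rho>
  proof -
    have "\<Union>(s ` \<tau>) \<subseteq> \<Union>(s ` \<rho>)" "\<Union>(s ` \<rho>) \<subseteq> \<Union>(s ` \<sigma>)"
      using that(3,4) by blast+
    then show ?thesis
      using that by (auto simp: union_complex_def)
  qed
qed

lemma toggle_closed_unit: "g \<in> A \<Longrightarrow> s g = {} \<Longrightarrow> toggle_closed g (union_complex A s m)"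
  by (auto simp: toggle_closed_def union_complex_def)

lemma homology_dim_redundant_generator:
  assumes A: "finite A" and g: "g \<in> A" "g \<noteq> g'" "s g \<subseteq> s g'"
  shows "homology_dim TYPE('k::field) (union_complex A s m) i =
    homology_dim TYPE('k) (union_complex (A - {g'}) s m) i"
proof -
  let ?X = "union_complex A s m" and ?Y = "union_complex (A - {g'}) s m"
  interpret subcomplex ?X ?Y
    by (unfold_locales, rule set_complex_union_complex[OF A]) (auto simp: union_complex_def)
  have mem: "\<sigma> \<in> ?X - ?Y \<longleftrightarrow> \<sigma> \<subseteq> A \<and> \<Union>(s ` \<sigma>) = m \<and> g' \<in> \<sigma>" for \<sigma>
    by (auto simp: union_complex_def)
  have "toggle_closed g (?X - ?Y)"
    unfolding toggle_closed_def
  proof (intro ballI conjI)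
    fix \<sigma> assume "\<sigma> \<in> ?X - ?Y"
    then have \<sigma>: "\<sigma> \<subseteq> A" "\<Union>(s ` \<sigma>) = m" "g' \<in> \<sigma>"
      unfolding mem by auto
    then have "s g \<subseteq> m"
      using g(3) by blast
    then show "insert g \<sigma> \<in> ?X - ?Y"
      unfolding mem using \<sigma> g(1) by auto
    have "s g \<subseteq> \<Union>(s ` (\<sigma> - {g}))"
      using \<sigma>(3) g(2,3) by blast
    then have "\<Union>(s ` (\<sigma> - {g})) = m"
      using \<sigma>(2) by blast
    then show "\<sigma> - {g} \<in> ?X - ?Y"
      unfolding mem using \<sigma> g(2) by auto
  qed
  then show ?thesis
    by (rule homology_dim_acyclic_quotient[OF homology_dim_toggle[OF set_complex_quotient]])
qed

lemma homology_dim_generating_subfamily: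
  assumes "finite R" "finite M" "\<And>r. r \<in> R \<Longrightarrow> r \<notin> M" "\<And>r. r \<in> R \<Longrightarrow> \<exists>g\<in>M. s g \<subseteq> s r"
  shows "homology_dim TYPE('k::field) (union_complex (M \<union> R) s m) i = homology_dim TYPE('k) (union_complex M s m) i"
  using assms
proof (induction R rule: finite_induct)
  case (insert r R)
  then obtain g where "g \<in> M" "s g \<subseteq> s r"
    by blast
  then have "homology_dim TYPE('k) (union_complex (M \<union> insert r R) s m) i =
      homology_dim TYPE('k) (union_complex (M \<union> insert r R - {r}) s m) i"
    using insert by (intro homology_dim_redundant_generator[of _ g]) auto
  moreover have "M \<union> insert r R - {r} = M \<union> R"
    using insert by auto
  ultimately show ?case
    using insert by simp
qed simp

lemma subset_of_Union_subset_disjoint: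
  assumes "disjoint F" "{} \<notin> F" "S \<subseteq> F" "T \<subseteq> F" "\<Union>S \<subseteq> \<Union>T"
  shows "S \<subseteq> T"
proof
  fix f assume f: "f \<in> S"
  then obtain v where "v \<in> f"
    using assms(2,3) by (metis ex_in_conv subsetD)
  then obtain h where "h \<in> T" "v \<in> h"
    using f assms(5) by blast
  then show "f \<in> T"
    using disjointD[OF assms(1), of f h] f \<open>v \<in> f\<close> assms(3,4) by blast
qed

lemma inj_on_Union_disjoint:
  assumes "disjoint F" "{} \<notin> F"
  shows "inj_on Union (Pow F)"
proof (rule inj_onI)
  fix S T assume "S \<in> Pow F" "T \<in> Pow F" "\<Union>S = \<Union>T"
  then show "S = T"
    using subset_of_Union_subset_disjoint[OF assms, of S T] subset_of_Union_subset_disjoint[OF assms, of T S] by simp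
qed

lemma union_complex_disjoint:
  assumes "inj_on s M" "disjoint (s ` M)" "{} \<notin> s ` M" "\<sigma> \<subseteq> M"
  shows "union_complex M s (\<Union>(s ` \<sigma>)) = {\<sigma>}"
proof (intro equalityI subsetI)
  fix \<tau> assume "\<tau> \<in> union_complex M s (\<Union>(s ` \<sigma>))"
  then have \<tau>: "\<tau> \<subseteq> M" "\<Union>(s ` \<tau>) = \<Union>(s ` \<sigma>)"
    by (auto simp: union_complex_def)
  then have "s ` \<tau> = s ` \<sigma>"
    using inj_onD[OF inj_on_Union_disjoint[OF assms(2,3)] \<tau>(2)] assms(4) by blast
  then show "\<tau> \<in> {\<sigma>}"
    using inj_on_image_eq_iff[OF assms(1) \<tau>(1) assms(4)] by simp
qed (use assms(4) in \<open>simp add: union_complex_def\<close>)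

lemma homology_dim_disjoint_generators:
  assumes A: "finite A" and F: "disjoint (min_sets (s ` A))" "{} \<notin> min_sets (s ` A)"
  shows "homology_dim TYPE('k::field) (union_complex A s m) i =
    (if \<exists>S\<subseteq>min_sets (s ` A). m = \<Union>S \<and> card S = i then 1 else 0)"
proof -
  let ?F = "min_sets (s ` A)"
  obtain M where M: "M \<subseteq> A" "inj_on s M" "?F = s ` M"
    using min_sets_subset[of "s ` A"] unfolding subset_image_inj by blast
  have "\<exists>g\<in>M. s g \<subseteq> s r" if "r \<in> A" for r
    using min_sets_below[OF finite_imageI[OF A] imageI[OF that]] M(3) by (metis imageE)
  then have "homology_dim TYPE('k) (union_complex (M \<union> (A - M)) s m) i = homology_dim TYPE('k) (union_complex M s m) i"
    using A M(1) by (intro homology_dim_generating_subfamily) (auto intro: finite_subset)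
  then have reduced: "homology_dim TYPE('k) (union_complex A s m) i = homology_dim TYPE('k) (union_complex M s m) i"
    using M(1) by (simp add: Un_absorb1)
  show ?thesis
  proof (cases "\<exists>S\<subseteq>?F. m = \<Union>S")
    case True
    then obtain \<sigma> where \<sigma>: "\<sigma> \<subseteq> M" "m = \<Union>(s ` \<sigma>)"
      unfolding M(3) by (metis subset_imageE)
    have card: "card (s ` \<sigma>) = card \<sigma>"
      by (rule card_image[OF inj_on_subset[OF M(2) \<sigma>(1)]])
    have unique: "S = s ` \<sigma>" if "S \<subseteq> ?F" "m = \<Union>S" for S
      using inj_onD[OF inj_on_Union_disjoint[OF F], of S "s ` \<sigma>"] that \<sigma> M(3) by blast
    have "s ` \<sigma> \<subseteq> ?F"
      using \<sigma>(1) M(3) by blast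
    then have "(\<exists>S\<subseteq>?F. m = \<Union>S \<and> card S = i) \<longleftrightarrow> card \<sigma> = i"
      using unique \<sigma>(2) card by metis
    moreover have "union_complex M s m = {\<sigma>}"
      unfolding \<sigma>(2) using union_complex_disjoint[OF M(2) _ _ \<sigma>(1)] F M(3) by simp
    moreover have "finite \<sigma>"
      by (rule finite_subset[OF \<sigma>(1) finite_subset[OF M(1) A]])
    ultimately show ?thesis
      unfolding reduced by (simp add: homology_dim_singleton)
  next
    case False
    have "m \<noteq> \<Union>(s ` \<sigma>)" if "\<sigma> \<subseteq> M" for \<sigma>
      using False image_mono[OF that, of s] M(3) by metis
    then have "union_complex M s m = {}"
      by (auto simp: union_complex_def)
    then show ?thesis
      unfolding reduced using False by (auto simp: homology_dim_empty)
  qed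
qed

abbreviation localize :: "(nat \<Rightarrow> 'u set) \<Rightarrow> 'u set \<Rightarrow> nat \<Rightarrow> 'u set" where
  "localize s U \<equiv> \<lambda>g. s g - U"

lemma localize_insert: "localize s (insert x U) = localize (localize s U) {x}"
  by auto

lemma contract_localize:
  assumes "finite A"
  shows "contract x (min_sets (localize s U ` A)) = min_sets (localize s (insert x U) ` A)"
proof -
  have "contract x (min_sets (localize s U ` A)) = min_sets ((\<lambda>g. g - {x}) ` localize s U ` A)"
    unfolding contract_def using assms by (intro min_sets_image_mono) auto
  then show ?thesis
    by (simp add: image_image Diff_insert[of _ x U])
qed

lemma localize_no_unit:
  assumes A: "finite A" and s: "{} \<notin> localize s U ` A" "{x} \<notin> min_sets (localize s U ` A)"
  shows "{} \<notin> localize s (insert x U) ` A"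
proof
  assume "{} \<in> localize s (insert x U) ` A"
  then obtain g where g: "g \<in> A" "localize s U g \<subseteq> {x}"
    by auto
  then obtain h where h: "h \<in> min_sets (localize s U ` A)" "h \<subseteq> localize s U g"
    using min_sets_below[of "localize s U ` A" "localize s U g"] A by blast
  then have "h = {x}"
    using g(2) s(1) min_sets_subset[of "localize s U ` A"] by (metis subsetD subset_singletonD subset_trans)
  then show False
    using h(1) s(2) by simp
qed

lemma Union_localize: "\<Union>(localize s U ` \<sigma>) = \<Union>(s ` \<sigma>) - U"
  by auto

lemma
  assumes "finite A" "x \<notin> m"
  shows subcomplex_localize: "subcomplex (union_complex A (localize s {x}) m) (union_complex A s m)"
    and localize_quotient:
      "union_complex A (localize s {x}) m - union_complex A s m = union_complex A s (insert x m)"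
proof -
  show "subcomplex (union_complex A (localize s {x}) m) (union_complex A s m)"
  proof
    show "set_complex (union_complex A (localize s {x}) m)"
      by (rule set_complex_union_complex[OF assms(1)])
    show "union_complex A s m \<subseteq> union_complex A (localize s {x}) m"
      using assms(2) unfolding union_complex_def Union_localize by auto
    show "\<tau> \<in> union_complex A s m"
      if "\<sigma> \<in> union_complex A s m" "\<tau> \<in> union_complex A (localize s {x}) m" "\<tau> \<subseteq> \<sigma>" for \<sigma> \<tau>
    proof -
      have "\<Union>(s ` \<tau>) \<subseteq> m"
        using that(1,3) by (auto simp: union_complex_def)
      then show ?thesis
        using that(2) assms(2) unfolding union_complex_def Union_localize by blast
    qed
  qed
  have "\<Union>(s ` \<sigma>) - {x} = m \<and> \<Union>(s ` \<sigma>) \<noteq> m \<longleftrightarrow> \<Union>(s ` \<sigma>) = insert x m" for \<sigma>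
    using assms(2) by auto
  then show "union_complex A (localize s {x}) m - union_complex A s m = union_complex A s (insert x m)"
    unfolding union_complex_def Union_localize by blast
qed

lemma sum_Pow_insert:
  assumes "finite U" "x \<notin> U"
  shows "(\<Sum>m\<in>Pow (insert x U). f m) = (\<Sum>m\<in>Pow U. f m + f (insert x m) :: 'a::comm_monoid_add)"
proof -
  have "inj_on (insert x) (Pow U)"
    using assms(2) by (intro inj_onI) (metis PowD insert_ident subsetD)
  moreover have "(\<Sum>m\<in>Pow (insert x U). f m) = (\<Sum>m\<in>Pow U. f m) + (\<Sum>m\<in>insert x ` Pow U. f m)"
    unfolding Pow_insert using assms by (intro sum.union_disjoint) auto
  ultimately show ?thesis
    by (simp add: sum.reindex sum.distrib)
qed

locale generators =
  fixes ty :: "'k::field itself" and A :: "nat set"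
  assumes finite_generators: "finite A"
begin

definition graded_betti :: "(nat \<Rightarrow> 'u set) \<Rightarrow> 'u set \<Rightarrow> nat \<Rightarrow> int" where
  "graded_betti s m i = homology_dim TYPE('k) (union_complex A s m) i"

definition graded_local_rank :: "(nat \<Rightarrow> 'u set) \<Rightarrow> 'u \<Rightarrow> 'u set \<Rightarrow> nat \<Rightarrow> int" where
  "graded_local_rank s x m i =
    connecting_rank TYPE('k) (union_complex A (localize s {x}) m) (union_complex A s m) i"

definition betti :: "'u set \<Rightarrow> (nat \<Rightarrow> 'u set) \<Rightarrow> nat \<Rightarrow> int" where
  "betti V s i = (\<Sum>m\<in>Pow V. graded_betti s m i)"

definition local_rank :: "'u set \<Rightarrow> (nat \<Rightarrow> 'u set) \<Rightarrow> 'u \<Rightarrow> nat \<Rightarrow> int" where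
  "local_rank V s x i = (\<Sum>m\<in>Pow (V - {x}). graded_local_rank s x m i)"

lemma graded_betti_nonneg: "graded_betti s m i \<ge> 0"
  unfolding graded_betti_def by (rule homology_dim_nonneg[OF set_complex_union_complex[OF finite_generators]])

lemma graded_betti_exact:
  assumes "x \<notin> m"
  shows "graded_betti s (insert x m) i + graded_betti s m i =
    graded_betti (localize s {x}) m i + graded_local_rank s x m i + graded_local_rank s x m (Suc i)"
  using subcomplex.homology_dim_exact[OF subcomplex_localize[OF finite_generators assms], of s i, where 'k='k]
  unfolding localize_quotient[OF finite_generators assms] graded_betti_def graded_local_rank_def .

lemma graded_local_rank_nonneg: "x \<notin> m \<Longrightarrow> graded_local_rank s x m i \<ge> 0"
  unfolding graded_local_rank_def
  by (rule subcomplex.connecting_rank_nonneg[OF subcomplex_localize[OF finite_generators]])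

lemma graded_local_rank_0: "x \<notin> m \<Longrightarrow> graded_local_rank s x m 0 = 0"
  unfolding graded_local_rank_def
  by (rule subcomplex.connecting_rank_0[OF subcomplex_localize[OF finite_generators]])

lemma graded_local_rank_le: "x \<notin> m \<Longrightarrow> graded_local_rank s x m (Suc i) \<le> graded_betti s m i"
  unfolding graded_local_rank_def graded_betti_def
  by (rule subcomplex.connecting_rank_le[OF subcomplex_localize[OF finite_generators]])

lemma graded_betti_le_localized:
  "x \<notin> m \<Longrightarrow> graded_betti s m i \<le> graded_betti (localize s {x}) m i + graded_local_rank s x m (Suc i)"
  unfolding graded_local_rank_def graded_betti_def
  by (rule subcomplex.homology_dim_subcomplex_le[OF subcomplex_localize[OF finite_generators]])

lemma graded_betti_empty: "union_complex A s m = {} \<Longrightarrow> graded_betti s m i = 0"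
  by (simp add: graded_betti_def homology_dim_empty)

lemma graded_betti_unit: "g \<in> A \<Longrightarrow> s g = {} \<Longrightarrow> graded_betti s m i = 0"
  unfolding graded_betti_def
  by (rule homology_dim_toggle[OF set_complex_union_complex[OF finite_generators] toggle_closed_unit])

lemma graded_betti_localize_le:
  assumes "finite U"
  shows "m \<inter> U = {} \<Longrightarrow> graded_betti (localize s U) m i \<le> (\<Sum>W\<in>Pow U. graded_betti s (m \<union> W) i)"
  using assms
proof (induction U arbitrary: m rule: finite_induct)
  case (insert x U)
  then have x: "x \<notin> m" and m: "m \<inter> U = {}" "insert x m \<inter> U = {}"
    by auto
  have "graded_betti (localize s (insert x U)) m i \<le>
      graded_betti (localize s U) m i + graded_betti (localize s U) (insert x m) i"
    unfolding localize_insert[of s]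
    using graded_betti_exact[OF x, of "localize s U" i] graded_local_rank_nonneg[OF x, of "localize s U"]
    by (smt (verit))
  also have "\<dots> \<le> (\<Sum>W\<in>Pow U. graded_betti s (m \<union> W) i) + (\<Sum>W\<in>Pow U. graded_betti s (insert x m \<union> W) i)"
    by (rule add_mono[OF insert.IH[OF m(1)] insert.IH[OF m(2)]])
  also have "\<dots> = (\<Sum>W\<in>Pow (insert x U). graded_betti s (m \<union> W) i)"
    unfolding sum_Pow_insert[OF insert.hyps] sum.distrib by simp
  finally show ?case .
qed simp

lemma local_rank_nonneg: "local_rank V s x i \<ge> 0"
  unfolding local_rank_def by (intro sum_nonneg graded_local_rank_nonneg) auto

lemma betti_exact:
  assumes V: "finite V" "x \<in> V"
  shows "betti V s i = betti V (localize s {x}) i + local_rank V s x i + local_rank V s x (Suc i)"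
proof -
  let ?V = "V - {x}"
  have split: "betti V t i = (\<Sum>m\<in>Pow ?V. graded_betti t m i + graded_betti t (insert x m) i)" for t
    unfolding betti_def using sum_Pow_insert[of ?V x] V by (simp add: insert_absorb)
  have "graded_betti (localize s {x}) (insert x m) i = 0" for m
    by (rule graded_betti_empty) (auto simp: union_complex_def)
  moreover have "graded_betti s m i + graded_betti s (insert x m) i =
      graded_betti (localize s {x}) m i + graded_local_rank s x m i + graded_local_rank s x m (Suc i)"
    if "m \<in> Pow ?V" for m
  proof -
    have "x \<notin> m"
      using that by auto
    then show ?thesis
      using graded_betti_exact[of x m s i] by simp
  qed
  ultimately show ?thesis
    unfolding split local_rank_def by (simp add: sum.distrib)
qed

lemma betti_localize_le:
  assumes "finite V" "finite U" "U \<subseteq> V"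
  shows "betti V (localize s U) i \<le> betti V s i"
  using assms(2,3)
proof (induction U rule: finite_induct)
  case (insert x U)
  have "betti V (localize s (insert x U)) i \<le> betti V (localize s U) i"
    unfolding localize_insert[of s]
    using betti_exact[OF assms(1), of x "localize s U" i] insert.prems local_rank_nonneg[of V "localize s U" x]
    by (smt (verit) insert_subset)
  then show ?case
    using insert by simp
qed simp

lemma betti_disjoint:
  assumes F: "disjoint (min_sets (s ` A))" "{} \<notin> min_sets (s ` A)" and V: "finite V" "\<Union>(s ` A) \<subseteq> V"
  shows "betti V s i = int (card (min_sets (s ` A)) choose i)"
proof -
  let ?S = "{S. S \<subseteq> min_sets (s ` A) \<and> card S = i}"
  have "Union ` ?S \<subseteq> Pow V"
    using V(2) min_sets_subset[of "s ` A"] by blast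
  then have "Pow V \<inter> Union ` ?S = Union ` ?S"
    by blast
  moreover have "betti V s i = (\<Sum>m\<in>Pow V. if m \<in> Union ` ?S then 1 else 0)"
    unfolding betti_def graded_betti_def homology_dim_disjoint_generators[OF finite_generators F]
    by (intro sum.cong refl if_cong) (auto simp: image_iff)
  ultimately have "betti V s i = int (card (Union ` ?S))"
    using V(1) by (simp add: sum.If_cases)
  also have "card (Union ` ?S) = card ?S"
    by (rule card_image[OF inj_on_subset[OF inj_on_Union_disjoint[OF F]]]) auto
  also have "\<dots> = card (min_sets (s ` A)) choose i"
    using finite_subset[OF min_sets_subset finite_imageI[OF finite_generators]] by (rule n_subsets)
  finally show ?thesis .
qed

lemma graded_betti_insert_nonzero:
  assumes "x \<notin> m" "graded_betti s (insert x m) i \<noteq> 0"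
  shows "graded_betti (localize s {x}) m i \<noteq> 0 \<or> (\<exists>j. i = Suc j \<and> graded_betti s m j \<noteq> 0)"
proof -
  have "graded_betti s (insert x m) i \<le> graded_betti (localize s {x}) m i + graded_local_rank s x m i"
    using graded_betti_exact[OF assms(1), of s i] graded_local_rank_le[OF assms(1), of s i] by simp
  then have nonzero: "graded_betti (localize s {x}) m i \<noteq> 0 \<or> graded_local_rank s x m i > 0"
    using graded_betti_nonneg[of s "insert x m" i] assms(2) by linarith
  show ?thesis
  proof (cases i)
    case 0
    then show ?thesis
      using nonzero graded_local_rank_0[OF assms(1), of s] by simp
  next
    case (Suc j)
    then show ?thesis
      using nonzero graded_local_rank_le[OF assms(1), of s j] by auto
  qed
qed

lemma graded_betti_degree_le:
  assumes "finite m" "graded_betti s m i \<noteq> 0"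
  shows "i \<le> card m"
  using assms
proof (induction m arbitrary: s i rule: finite_induct)
  case empty
  have "{} \<notin> s ` A"
    using graded_betti_unit empty.prems by (metis imageE)
  then have "union_complex A s {} = {{}}"
    by (auto simp: union_complex_def)
  then show ?case
    using empty.prems by (simp add: graded_betti_def homology_dim_singleton split: if_splits)
next
  case (insert x m)
  then show ?case
    using graded_betti_insert_nonzero[OF insert.hyps(2) insert.prems] by fastforce
qed

lemma graded_betti_top_degree:
  assumes "finite m" "v \<notin> m" "graded_betti s (insert v m) (Suc (card m)) \<noteq> 0"
  shows "{v} \<in> s ` A"
  using assms
proof (induction m rule: finite_induct)
  case empty
  then obtain \<sigma> where \<sigma>: "\<sigma> \<subseteq> A" "\<Union>(s ` \<sigma>) = {v}"
    using graded_betti_empty[of s "{v}" "Suc 0"] by (auto simp: union_complex_def)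
  then obtain g where "g \<in> \<sigma>" "v \<in> s g"
    by blast
  then have "s g = {v}"
    using \<sigma>(2) by blast
  then show ?case
    using \<open>g \<in> \<sigma>\<close> \<sigma>(1) by force
next
  case (insert x m)
  have card: "card (insert v m) = Suc (card m)"
    using insert by simp
  have "graded_betti s (insert x (insert v m)) (Suc (Suc (card m))) \<noteq> 0"
    using insert by (simp add: insert_commute)
  moreover have "graded_betti (localize s {x}) (insert v m) (Suc (Suc (card m))) = 0"
    using graded_betti_degree_le[of "insert v m" "localize s {x}"] insert.hyps(1) unfolding card by fastforce
  ultimately have "graded_betti s (insert v m) (Suc (card m)) \<noteq> 0"
    using graded_betti_insert_nonzero[of x "insert v m"] insert by auto
  then show ?case
    using insert by blast
qed

end

section \<open>The lower bound for set families\<close>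

definition extremal_poly1 :: "nat \<Rightarrow> int poly" where
  "extremal_poly1 c = [:1, 2:] * [:1, 1:] ^ (c - 1)"

definition extremal_poly2 :: "nat \<Rightarrow> int poly" where
  "extremal_poly2 c = [:1, 4, 1:] * [:1, 1:] ^ (c - 2)"

definition extremal_bound :: "nat \<Rightarrow> (nat \<Rightarrow> int) \<Rightarrow> bool" where
  "extremal_bound c b \<longleftrightarrow> (\<forall>i. coeff (extremal_poly1 c) i \<le> b i) \<or>
     (2 \<le> c \<and> (\<forall>i. coeff (extremal_poly2 c) i \<le> b i))"

lemma extremal_bound_mono: "extremal_bound c b \<Longrightarrow> (\<And>i. b i \<le> b' i) \<Longrightarrow> extremal_bound c b'"
  unfolding extremal_bound_def by (meson order_trans)

lemma coeff_one_plus_X_power: "coeff ([:1, 1:] ^ n :: int poly) i = int (n choose i)"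
proof (cases "i \<le> n")
  case True
  then show ?thesis
    by (simp add: coeff_linear_poly_power)
next
  case False
  then have "degree ([:1, 1:] ^ n :: int poly) < i"
    using degree_power_le[of "[:1, 1:] :: int poly" n] by simp
  then show ?thesis
    using False by (simp add: coeff_eq_0)
qed

lemma coeff_extremal_poly1:
  "coeff (extremal_poly1 (Suc m)) i =
    int (Suc m choose i) + (case i of 0 \<Rightarrow> 0 | Suc j \<Rightarrow> int (m choose j))"
proof -
  have "extremal_poly1 (Suc m) = [:1, 1:] ^ Suc m + pCons 0 ([:1, 1:] ^ m)"
    by (simp add: extremal_poly1_def numeral_poly)
  then show ?thesis
    by (simp only: coeff_add coeff_one_plus_X_power coeff_pCons) (simp add: coeff_one_plus_X_power split: nat.split)
qed

lemma coeff_extremal_poly2: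
  "coeff (extremal_poly2 (Suc (Suc m))) i =
    int (Suc (Suc m) choose i) + (case i of 0 \<Rightarrow> 0 | Suc j \<Rightarrow> 2 * int (m choose j))"
proof -
  have "extremal_poly2 (Suc (Suc m)) = [:1, 1:] ^ Suc (Suc m) + pCons 0 (smult 2 ([:1, 1:] ^ m))"
    by (simp add: extremal_poly2_def numeral_poly smult_add_left[symmetric])
  then show ?thesis
    by (simp only: coeff_add coeff_one_plus_X_power coeff_pCons) (simp add: coeff_one_plus_X_power split: nat.split)
qed

lemma choose_Suc_mult_le:
  fixes K :: "nat \<Rightarrow> int"
  assumes "\<And>i. 0 \<le> K i" "\<And>j. e * int (n choose j) \<le> K (Suc (Suc j))"
  shows "e * int (Suc n choose j) \<le> K (Suc j) + K (Suc (Suc j))"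
proof (cases j)
  case 0
  then show ?thesis
    using assms(1)[of "Suc 0"] assms(2)[of 0] by simp
next
  case (Suc k)
  then show ?thesis
    using assms(2)[of k] assms(2)[of "Suc k"] by (simp add: distrib_left)
qed

lemma binomial_lower_bound_Suc:
  fixes b K :: "nat \<Rightarrow> int"
  assumes "c \<le> q" "r \<le> Suc n" and b: "\<And>i. int (q choose i) + K i + K (Suc i) \<le> b i"
    and K: "\<And>i. 0 \<le> K i" "\<And>j. int e * int (n choose j) \<le> K (Suc (Suc j))"
  shows "int (c choose Suc j) + int e * int (r choose j) \<le> b (Suc j)"
proof -
  have "int e * int (r choose j) \<le> int e * int (Suc n choose j)"
    using binomial_right_mono[OF assms(2)] by (intro mult_left_mono) simp_all
  also have "\<dots> \<le> K (Suc j) + K (Suc (Suc j))"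
    by (rule choose_Suc_mult_le[OF K])
  finally show ?thesis
    using b[of "Suc j"] binomial_right_mono[OF assms(1), of "Suc j"] by linarith
qed

lemma extremal_boundI:
  fixes b K :: "nat \<Rightarrow> int"
  assumes c: "1 \<le> c" "c \<le> q" and b: "\<And>i. int (q choose i) + K i + K (Suc i) \<le> b i"
    and K: "\<And>i. 0 \<le> K i" "\<And>j. int e * int (n choose j) \<le> K (Suc (Suc j))"
    and e: "e \<in> {1, 2}" "c \<le> n + e + 1"
  shows "extremal_bound c b"
proof -
  have b0: "1 \<le> b 0"
    using b[of 0] K(1)[of 0] K(1)[of "Suc 0"] by simp
  note bSuc = binomial_lower_bound_Suc[OF c(2) _ b K]
  show ?thesis
  proof (cases "e = 1 \<or> c = 1")
    case True
    obtain m where m: "c = Suc m"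
      using c(1) by (cases c) auto
    have "coeff (extremal_poly1 c) (Suc j) \<le> b (Suc j)" for j
    proof -
      have "int (m choose j) \<le> int e * int (m choose j)"
        using e(1) by auto
      moreover have "m \<le> Suc n"
        using True e(2) m by auto
      ultimately show ?thesis
        using bSuc[of m j] by (simp add: m coeff_extremal_poly1)
    qed
    then have "coeff (extremal_poly1 c) i \<le> b i" for i
      using b0 by (cases i) (simp_all add: m coeff_extremal_poly1)
    then show ?thesis
      by (simp add: extremal_bound_def)
  next
    case False
    then obtain m where m: "c = Suc (Suc m)" "e = 2"
      using c(1) e(1) by (metis One_nat_def Suc_le_D insertE singletonD not0_implies_Suc)
    have "coeff (extremal_poly2 c) i \<le> b i" for i
      using b0 bSuc[of m] e(2) m by (cases i) (simp_all add: coeff_extremal_poly2)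
    then show ?thesis
      using m(1) by (simp add: extremal_bound_def)
  qed
qed

lemma card_subsets_containing:
  assumes "finite D" "d \<notin> D"
  shows "card {B. B \<subseteq> insert d D \<and> d \<in> B \<and> card B = Suc k} = card D choose k"
proof -
  have "bij_betw (insert d) {C. C \<subseteq> D \<and> card C = k} {B. B \<subseteq> insert d D \<and> d \<in> B \<and> card B = Suc k}"
  proof (rule bij_betw_byWitness[where f' = "\<lambda>B. B - {d}"])
    show "\<forall>C\<in>{C. C \<subseteq> D \<and> card C = k}. insert d C - {d} = C"
      using assms(2) by auto
    show "insert d ` {C. C \<subseteq> D \<and> card C = k} \<subseteq> {B. B \<subseteq> insert d D \<and> d \<in> B \<and> card B = Suc k}"
      using assms finite_subset by (fastforce simp: card_insert_if)
    show "(\<lambda>B. B - {d}) ` {B. B \<subseteq> insert d D \<and> d \<in> B \<and> card B = Suc k} \<subseteq> {C. C \<subseteq> D \<and> card C = k}"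
      by auto
  qed auto
  from bij_betw_same_card[OF this] show ?thesis
    unfolding n_subsets[OF assms(1)] ..
qed

lemma min_sets_singletons:
  assumes "{} \<notin> S" "\<Union>S \<subseteq> D" "\<And>d. d \<in> D \<Longrightarrow> {d} \<in> S"
  shows "min_sets S = (\<lambda>d. {d}) ` D"
proof (intro equalityI subsetI)
  fix f assume f: "f \<in> min_sets S"
  then have "f \<in> S" "f \<noteq> {}"
    using assms(1) min_sets_subset by blast+
  then obtain d where "d \<in> f" "d \<in> D"
    using assms(2) by blast
  then have "{d} = f"
    using min_setsD[OF f assms(3)] by blast
  then show "f \<in> (\<lambda>d. {d}) ` D"
    using \<open>d \<in> D\<close> by blast
next
  fix f assume "f \<in> (\<lambda>d. {d}) ` D"
  then obtain d where d: "d \<in> D" "f = {d}"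
    by blast
  have "h = {d}" if "h \<in> S" "h \<subseteq> {d}" for h
    using that assms(1) by (metis subset_singletonD)
  then show "f \<in> min_sets S"
    unfolding d(2) by (intro min_setsI assms(3)[OF d(1)])
qed

lemma exists_transversal:
  assumes "finite F" "{} \<notin> F"
  obtains T where "finite T" "card T \<le> card F" "\<And>f. f \<in> F \<Longrightarrow> f \<inter> T \<noteq> {}"
proof -
  have "\<forall>f\<in>F. \<exists>v. v \<in> f"
    using assms(2) by (metis ex_in_conv)
  then obtain t where "\<forall>f\<in>F. t f \<in> f"
    by (rule bchoice[THEN exE])
  then show ?thesis
    using that[of "t ` F"] assms(1) card_image_le by blast
qed

locale good_cover_generators = generators ty A for ty :: "'k::field itself" and A +
  fixes s :: "nat \<Rightarrow> 'u set" and V :: "'u set" and x :: 'u and D :: "'u set"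
  assumes finite_V: "finite V" and subset_V: "\<Union>(s ` A) \<subseteq> V" and no_unit: "{} \<notin> s ` A"
    and x: "x \<in> \<Union>(min_sets (s ` A))" "{x} \<notin> min_sets (s ` A)"
    and contract_disjoint: "disjoint (contract x (min_sets (s ` A)))"
    and good: "good_cover (min_sets (s ` A)) x D"
begin

abbreviation G :: "'u set set" where "G \<equiv> min_sets (s ` A)"
abbreviation F :: "'u set set" where "F \<equiv> contract x G"
abbreviation t :: "nat \<Rightarrow> 'u set" where "t \<equiv> localize s {x}"

lemma cover: "minimal_cover (deletion x G) D"
  using good by (simp add: good_cover_def)

lemma generator_below:
  assumes "g \<in> A"
  obtains h where "h \<in> G" "h \<subseteq> s g"
  using min_sets_below[of "s ` A" "s g"] finite_generators assms by blast

lemma cover_subset: "D \<subseteq> V - {x}"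
proof
  fix d assume "d \<in> D"
  then obtain g where g: "g \<in> deletion x G" "g \<inter> D = {d}"
    using minimal_cover_private[OF cover] by blast
  then have "g \<in> s ` A" "x \<notin> g"
    using min_sets_subset[of "s ` A"] by (auto simp: deletion_def)
  then show "d \<in> V - {x}"
    using g(2) subset_V by blast
qed

lemma finite_cover: "finite D"
  by (rule minimal_cover_finite[OF cover])

lemma cover_meets:
  assumes "g \<in> A" "x \<notin> s g"
  shows "s g \<inter> D \<noteq> {}"
proof -
  obtain h where h: "h \<in> G" "h \<subseteq> s g"
    using generator_below[OF assms(1)] .
  then have "h \<inter> D \<noteq> {}"
    using minimal_cover_meets[OF cover, of h] assms(2) by (auto simp: deletion_def)
  then show ?thesis
    using h(2) by blast
qed

lemma singleton_minimal:
  assumes "{v} \<in> s ` A"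
  shows "{v} \<in> G"
proof -
  obtain g where "g \<in> A" "s g = {v}"
    using assms by auto
  then obtain h where "h \<in> G" "h \<subseteq> {v}"
    using generator_below by metis
  then show ?thesis
    using no_unit min_sets_subset[of "s ` A"] by (metis subsetD subset_singletonD)
qed

lemma contract_eq: "F = min_sets (t ` A)"
  using contract_localize[OF finite_generators, of x s "{}"] by simp

lemma contract_no_unit: "{} \<notin> F"
  using localize_no_unit[OF finite_generators, of s "{}" x] no_unit x(2) min_sets_subset[of "t ` A"]
  unfolding contract_eq by auto

lemma finite_contract: "finite F"
  unfolding contract_eq using finite_generators min_sets_subset by (metis finite_imageI finite_subset)

lemma betti_contract: "betti V t i = int (card F choose i)"
  unfolding contract_eq
  by (rule betti_disjoint) (use contract_disjoint contract_no_unit finite_V subset_V in \<open>auto simp: contract_eq\<close>)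

lemma graded_betti_contract_nonzero:
  assumes "graded_betti t m i \<noteq> 0"
  obtains S where "S \<subseteq> F" "m = \<Union>S" "card S = i"
  using assms contract_disjoint contract_no_unit homology_dim_disjoint_generators[OF finite_generators, of t m i, where 'k='k]
  unfolding contract_eq graded_betti_def by (auto split: if_splits)

text \<open>Inverting all variables outside \<open>D\<close> and \<open>x\<close> turns the generators without \<open>x\<close> into the variables in \<open>D\<close>.\<close>

lemma graded_betti_localized_to_cover:
  assumes B: "B \<subseteq> D"
  shows "graded_betti (localize s (V - {x} - D)) B (card B) = 1"
proof -
  let ?A = "{g \<in> A. x \<notin> s g}" and ?r = "localize s (V - {x} - D)"
  have "x \<notin> B"
    using B cover_subset by blast
  then have "x \<notin> s g" if "\<Union>(?r ` \<sigma>) = B" "g \<in> \<sigma>" for \<sigma> g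
    using that by blast
  then have restrict: "union_complex A ?r B = union_complex ?A ?r B"
    unfolding union_complex_def by blast
  have r: "?r g = s g \<inter> D" if "g \<in> ?A" for g
    using that subset_V cover_subset by blast
  have ms: "min_sets (?r ` ?A) = (\<lambda>d. {d}) ` D"
  proof (rule min_sets_singletons)
    show "{} \<notin> ?r ` ?A"
      using r cover_meets by fastforce
    show "\<Union>(?r ` ?A) \<subseteq> D"
      using r by blast
    fix d assume "d \<in> D"
    then obtain g where "g \<in> A" "x \<notin> s g" "s g \<inter> D = {d}"
      using minimal_cover_private[OF cover] min_sets_subset[of "s ` A"] by (fastforce simp: deletion_def)
    then show "{d} \<in> ?r ` ?A"
      using r by (intro image_eqI[of _ _ g]) auto
  qed
  have "(\<lambda>d. {d}) ` B \<subseteq> (\<lambda>d. {d}) ` D" "B = \<Union>((\<lambda>d. {d}) ` B)" "card ((\<lambda>d. {d}) ` B) = card B"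
    using B by (auto simp: card_image)
  then have "\<exists>S\<subseteq>min_sets (?r ` ?A). B = \<Union>S \<and> card S = card B"
    unfolding ms by blast
  moreover have "disjoint (min_sets (?r ` ?A))" "{} \<notin> min_sets (?r ` ?A)"
    unfolding ms by (auto simp: disjoint_def)
  ultimately show ?thesis
    using homology_dim_disjoint_generators[of ?A ?r B "card B", where 'k='k] finite_generators
    by (simp add: graded_betti_def restrict)
qed

lemma sum_graded_betti_over_cover:
  assumes "B \<subseteq> D"
  shows "1 \<le> (\<Sum>m\<in>{m \<in> Pow (V - {x}). m \<inter> D = B}. graded_betti s m (card B))"
proof -
  let ?U = "V - {x} - D"
  have "1 \<le> (\<Sum>W\<in>Pow ?U. graded_betti s (B \<union> W) (card B))"
    using graded_betti_localize_le[of ?U B s "card B"] graded_betti_localized_to_cover[OF assms] assms finite_V by auto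
  also have "\<dots> = (\<Sum>m\<in>{m \<in> Pow (V - {x}). m \<inter> D = B}. graded_betti s m (card B))"
    by (rule sum.reindex_bij_witness[of _ "\<lambda>m. m - D" "\<lambda>W. B \<union> W"]) (use assms cover_subset in auto)
  finally show ?thesis .
qed

definition unseen :: "'u set \<Rightarrow> bool" where
  "unseen B \<longleftrightarrow> (\<forall>m\<subseteq>V - {x}. m \<inter> D = B \<longrightarrow> graded_betti t m (card B) = 0 \<or> graded_betti s m (card B) = 0)"

lemma local_rank_ge_unseen: "int (card {B. B \<subseteq> D \<and> card B = i \<and> unseen B}) \<le> local_rank V s x (Suc i)"
proof -
  let ?P = "Pow (V - {x})" and ?B = "{B. B \<subseteq> D \<and> card B = i \<and> unseen B}"
  have fin: "finite ?P" "finite (Pow D)"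
    using finite_V finite_cover by simp_all
  have nonneg: "0 \<le> graded_local_rank s x m (Suc i)" if "m \<in> ?P" for m
    using that by (intro graded_local_rank_nonneg) auto
  have "1 \<le> (\<Sum>m\<in>{m \<in> ?P. m \<inter> D = B}. graded_local_rank s x m (Suc i))" if "B \<in> ?B" for B
  proof -
    have B: "B \<subseteq> D" "card B = i" "unseen B"
      using that by simp_all
    have "graded_betti s m i \<le> graded_local_rank s x m (Suc i)" if m: "m \<in> ?P" "m \<inter> D = B" for m
    proof -
      have "graded_betti t m i = 0 \<or> graded_betti s m i = 0"
        using B(2,3) m by (auto simp: unseen_def)
      moreover have "x \<notin> m"
        using m(1) by auto
      ultimately show ?thesis
        using graded_betti_le_localized[of x m s i] nonneg[OF m(1)] by auto
    qed
    then show ?thesis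
      using sum_graded_betti_over_cover[OF B(1)] B(2) by (force intro: order_trans sum_mono)
  qed
  then have "(\<Sum>B\<in>?B. 1) \<le> (\<Sum>B\<in>?B. \<Sum>m\<in>{m \<in> ?P. m \<inter> D = B}. graded_local_rank s x m (Suc i))"
    by (rule sum_mono)
  then have "int (card ?B) \<le> (\<Sum>B\<in>?B. \<Sum>m\<in>{m \<in> ?P. m \<inter> D = B}. graded_local_rank s x m (Suc i))"
    by simp
  also have "\<dots> \<le> (\<Sum>B\<in>Pow D. \<Sum>m\<in>{m \<in> ?P. m \<inter> D = B}. graded_local_rank s x m (Suc i))"
    using fin nonneg by (intro sum_mono2 sum_nonneg) auto
  also have "\<dots> = local_rank V s x (Suc i)"
    unfolding local_rank_def using fin by (intro sum.group) auto
  finally show ?thesis .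
qed

lemma unseen_of_uncovered:
  assumes "d \<in> B" "d \<notin> \<Union>F"
  shows "unseen B"
  unfolding unseen_def
proof (intro allI impI disjI1, rule ccontr)
  fix m assume "m \<inter> D = B" "graded_betti t m (card B) \<noteq> 0"
  then obtain S where "S \<subseteq> F" "m = \<Union>S"
    using graded_betti_contract_nonzero by blast
  then show False
    using \<open>m \<inter> D = B\<close> assms by blast
qed

lemma unseen_of_split_edge:
  assumes f: "f \<in> F" "p \<in> f" "q \<in> f" and B: "p \<in> B" "q \<in> D" "q \<notin> B"
  shows "unseen B"
  unfolding unseen_def
proof (intro allI impI disjI1, rule ccontr)
  fix m assume m: "m \<inter> D = B" "graded_betti t m (card B) \<noteq> 0"
  then obtain S where S: "S \<subseteq> F" "m = \<Union>S"
    using graded_betti_contract_nonzero by blast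
  then obtain h where h: "h \<in> S" "p \<in> h"
    using m(1) B(1) by blast
  then have "h = f"
    using disjointD[OF contract_disjoint, of h f] S(1) f(1,2) by blast
  then show False
    using h(1) S(2) f(3) m(1) B(2,3) by blast
qed

lemma unseen_of_variables:
  assumes variables: "\<forall>f\<in>F. \<exists>v. f = {v}" and B: "B \<subseteq> D" "d \<in> B" "{d} \<notin> G"
  shows "unseen B"
  unfolding unseen_def
proof (intro allI impI, rule ccontr)
  fix m assume m: "m \<subseteq> V - {x}" "m \<inter> D = B"
    and seen: "\<not> (graded_betti t m (card B) = 0 \<or> graded_betti s m (card B) = 0)"
  then obtain S where S: "S \<subseteq> F" "m = \<Union>S" "card S = card B"
    using graded_betti_contract_nonzero by blast
  have fin: "finite S" "finite m"
    using finite_subset[OF S(1) finite_contract] finite_subset[OF m(1)] finite_V by auto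
  have "m \<subseteq> the_elem ` S"
    using S(1,2) variables by force
  then have "card m \<le> card B"
    using surj_card_le[OF fin(1)] S(3) by metis
  then have "B = m"
    using card_seteq[OF fin(2)] m(2) by blast
  then have "insert d (B - {d}) = B" "Suc (card (B - {d})) = card B"
    using B(2) card.remove[OF fin(2), of d] by auto
  then have "graded_betti s (insert d (B - {d})) (Suc (card (B - {d}))) \<noteq> 0"
    using seen \<open>B = m\<close> by simp
  then have "{d} \<in> s ` A"
    using graded_betti_top_degree[of "B - {d}" d s] fin(2) \<open>B = m\<close> by simp
  then show False
    using singleton_minimal B(3) by blast
qed

lemma card_unseen_of_vertex:
  assumes d: "d \<in> D" and unseen: "\<And>B. B \<subseteq> D \<Longrightarrow> d \<in> B \<Longrightarrow> unseen B"
  shows "card (D - {d}) choose j \<le> card {B. B \<subseteq> D \<and> card B = Suc j \<and> unseen B}"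
proof -
  have sub: "{B. B \<subseteq> insert d (D - {d}) \<and> d \<in> B \<and> card B = Suc j} \<subseteq> {B. B \<subseteq> D \<and> card B = Suc j \<and> unseen B}"
    using unseen d by auto
  show ?thesis
    using card_subsets_containing[of "D - {d}" d j] card_mono[OF _ sub] finite_cover by simp
qed

lemma card_unseen_of_split_edge:
  assumes f: "f \<in> F" "p \<in> D \<inter> f" "q \<in> D \<inter> f" "p \<noteq> q"
  shows "2 * (card (D - {p, q}) choose j) \<le> card {B. B \<subseteq> D \<and> card B = Suc j \<and> unseen B}"
proof -
  let ?containing = "\<lambda>d. {B. B \<subseteq> insert d (D - {p, q}) \<and> d \<in> B \<and> card B = Suc j}"
  let ?unseen = "{B. B \<subseteq> D \<and> card B = Suc j \<and> unseen B}"
  have fin: "finite ?unseen"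
    using finite_cover by simp
  have sub: "?containing p \<subseteq> ?unseen" "?containing q \<subseteq> ?unseen"
    using f unseen_of_split_edge[of f p q] unseen_of_split_edge[of f q p] by auto
  have "?containing p \<inter> ?containing q = {}"
    using f(4) by auto
  then have "card (?containing p) + card (?containing q) = card (?containing p \<union> ?containing q)"
    using card_Un_disjoint[OF finite_subset[OF sub(1) fin] finite_subset[OF sub(2) fin]] by simp
  also have "\<dots> \<le> card ?unseen"
    using sub by (intro card_mono[OF fin]) blast
  finally show ?thesis
    using card_subsets_containing[of "D - {p, q}" p j] card_subsets_containing[of "D - {p, q}" q j] finite_cover
    by simp
qed

lemma many_unseen:
  obtains e n where "e \<in> {1, 2}" "card D = n + e"
    "\<And>j. e * (n choose j) \<le> card {B. B \<subseteq> D \<and> card B = Suc j \<and> unseen B}"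
proof -
  note found = that
  have one: ?thesis if d: "d \<in> D" and "\<And>B. B \<subseteq> D \<Longrightarrow> d \<in> B \<Longrightarrow> unseen B" for d
    using found[of 1 "card (D - {d})"] card_unseen_of_vertex[OF that] card.remove[OF finite_cover d] by simp
  from good show ?thesis
    unfolding good_cover_def
  proof (elim conjE disjE bexE)
    fix d assume "d \<in> D" "d \<notin> \<Union>F"
    then show ?thesis
      by (intro one unseen_of_uncovered)
  next
    fix f p q assume f: "f \<in> F" "p \<in> D \<inter> f" "q \<in> D \<inter> f" "p \<noteq> q"
    have "card (D - {p, q}) = card D - 2" "2 \<le> card D"
      using f card_Diff_subset[of "{p, q}" D] card_mono[OF finite_cover, of "{p, q}"] by auto
    then show ?thesis
      using found[of 2 "card (D - {p, q})"] card_unseen_of_split_edge[OF f] by simp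
  next
    fix d assume "\<forall>f\<in>F. \<exists>v. f = {v}" "d \<in> D" "{d} \<notin> G"
    then show ?thesis
      by (intro one unseen_of_variables)
  qed
qed

theorem betti_extremal_bound:
  assumes c: "1 \<le> c" "\<And>E. finite E \<Longrightarrow> (\<And>g. g \<in> A \<Longrightarrow> s g \<inter> E \<noteq> {}) \<Longrightarrow> c \<le> card E"
  shows "extremal_bound c (betti V s)"
proof -
  obtain e n where en: "e \<in> {1, 2}" "card D = n + e"
      "\<And>j. e * (n choose j) \<le> card {B. B \<subseteq> D \<and> card B = Suc j \<and> unseen B}"
    using many_unseen by blast
  obtain T where T: "finite T" "card T \<le> card F" "\<And>f. f \<in> F \<Longrightarrow> f \<inter> T \<noteq> {}"
    using exists_transversal[OF finite_contract contract_no_unit] by blast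
  have "s g \<inter> T \<noteq> {}" if g: "g \<in> A" for g
  proof -
    obtain f where "f \<in> F" "f \<subseteq> t g"
      using min_sets_below[OF finite_imageI[OF finite_generators] imageI[OF g]] unfolding contract_eq .
    then show ?thesis
      using T(3) by blast
  qed
  then have "c \<le> card F"
    using c(2)[OF T(1)] T(2) by fastforce
  have "s g \<inter> insert x D \<noteq> {}" if "g \<in> A" for g
    using cover_meets[OF that] by blast
  then have "c \<le> card (insert x D)"
    using finite_cover by (intro c(2)) auto
  then have "c \<le> n + e + 1"
    using en(2) finite_cover by (auto simp: card_insert_if split: if_splits)
  moreover have "x \<in> V"
    using x(1) subset_V min_sets_subset[of "s ` A"] by blast
  then have "int (card F choose i) + local_rank V s x i + local_rank V s x (Suc i) \<le> betti V s i" for i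
    using betti_exact[OF finite_V, of x s i] betti_contract by simp
  moreover have "int e * int (n choose j) \<le> local_rank V s x (Suc (Suc j))" for j
  proof -
    have "int e * int (n choose j) \<le> int (card {B. B \<subseteq> D \<and> card B = Suc j \<and> unseen B})"
      using en(3)[of j] unfolding of_nat_mult[symmetric] of_nat_le_iff .
    also have "\<dots> \<le> local_rank V s x (Suc (Suc j))"
      by (rule local_rank_ge_unseen)
    finally show ?thesis .
  qed
  ultimately show ?thesis
    by (intro extremal_boundI[OF c(1) \<open>c \<le> card F\<close> _ local_rank_nonneg _ en(1)])
qed

end

context generators
begin

lemma betti_extremal_bound_nearly_ci:
  assumes V: "finite V" "\<Union>(s ` A) \<subseteq> V" and no_unit: "{} \<notin> s ` A"
    and nci: "nearly_complete_intersection (min_sets (s ` A))"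
    and c: "1 \<le> c" "\<And>E. finite E \<Longrightarrow> (\<And>g. g \<in> A \<Longrightarrow> s g \<inter> E \<noteq> {}) \<Longrightarrow> c \<le> card E"
  shows "extremal_bound c (betti V s)"
proof -
  interpret nearly_complete_intersection "min_sets (s ` A)"
    by (rule nci)
  obtain x D where "x \<in> \<Union>(min_sets (s ` A))" "{x} \<notin> min_sets (s ` A)" "good_cover (min_sets (s ` A)) x D"
    using exists_good_cover .
  then interpret good_cover_generators ty A s V x D
    using V no_unit contract_disjoint by unfold_locales
  show ?thesis
    by (rule betti_extremal_bound[OF c])
qed

lemma maximal_localization_nearly_ci:
  assumes fin: "\<And>g. g \<in> A \<Longrightarrow> finite (s g)" and no_unit: "{} \<notin> s ` A"
    and V: "finite V" "\<Union>(s ` A) \<subseteq> V" and not_disjoint: "\<not> disjoint (min_sets (s ` A))"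
  obtains U where "U \<subseteq> V" "{} \<notin> localize s U ` A" "nearly_complete_intersection (min_sets (localize s U ` A))"
proof -
  let ?C = "{U. U \<subseteq> V \<and> {} \<notin> localize s U ` A \<and> \<not> disjoint (min_sets (localize s U ` A))}"
  have "finite ?C" "{} \<in> ?C"
    using V(1) no_unit not_disjoint by simp_all
  then obtain U where U: "U \<in> ?C" and maximal: "\<And>W. W \<in> ?C \<Longrightarrow> U \<subseteq> W \<Longrightarrow> U = W"
    using finite_has_maximal[of ?C] by (metis (lifting) empty_iff)
  let ?s = "localize s U"
  let ?G = "min_sets (?s ` A)"
  have "nearly_complete_intersection ?G"
  proof
    show "finite ?G"
      using finite_generators min_sets_subset by (metis finite_imageI finite_subset)
    show "finite g" if "g \<in> ?G" for g
      using subsetD[OF min_sets_subset that] fin by auto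
    show "{} \<notin> ?G"
      using U min_sets_subset[of "?s ` A"] by blast
    show "g = h" if "g \<in> ?G" "h \<in> ?G" "g \<subseteq> h" for g h
      using min_setsD[OF that(2) subsetD[OF min_sets_subset that(1)] that(3)] .
    show "\<not> disjoint ?G"
      using U by simp
    fix x assume x: "x \<in> \<Union>?G" "{x} \<notin> ?G"
    obtain g where g: "g \<in> A" "x \<in> s g" "x \<notin> U"
      using x(1) min_sets_subset[of "?s ` A"] by blast
    have "{} \<notin> localize s (insert x U) ` A"
      using U x(2) by (intro localize_no_unit[OF finite_generators]) simp_all
    moreover have "insert x U \<notin> ?C"
      using maximal[of "insert x U"] g(3) by blast
    moreover have "insert x U \<subseteq> V"
      using U g(1,2) V(2) by blast
    ultimately show "disjoint (contract x ?G)"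
      unfolding contract_localize[OF finite_generators] by blast
  qed
  then show ?thesis
    using that U by blast
qed

theorem betti_lower_bound:
  assumes fin: "\<And>g. g \<in> A \<Longrightarrow> finite (s g)" and no_unit: "{} \<notin> s ` A"
    and V: "finite V" "\<Union>(s ` A) \<subseteq> V" and not_disjoint: "\<not> disjoint (min_sets (s ` A))"
    and c: "1 \<le> c" "\<And>E. finite E \<Longrightarrow> (\<And>g. g \<in> A \<Longrightarrow> s g \<inter> E \<noteq> {}) \<Longrightarrow> c \<le> card E"
  shows "extremal_bound c (betti V s)"
proof -
  obtain U where U: "U \<subseteq> V" "{} \<notin> localize s U ` A" "nearly_complete_intersection (min_sets (localize s U ` A))"
    using maximal_localization_nearly_ci[OF fin no_unit V not_disjoint] .
  have "extremal_bound c (betti V (localize s U))"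
  proof (rule betti_extremal_bound_nearly_ci[OF V(1) _ U(2,3) c(1)])
    show "\<Union>(localize s U ` A) \<subseteq> V"
      using V(2) by blast
    fix E assume E: "finite E" "\<And>g. g \<in> A \<Longrightarrow> localize s U g \<inter> E \<noteq> {}"
    show "c \<le> card E"
      by (rule c(2)[OF E(1)]) (use E(2) in blast)
  qed
  then show ?thesis
    by (rule extremal_bound_mono[OF _ betti_localize_le[OF V(1) finite_subset[OF U(1) V(1)] U(1)]])
qed

end

section \<open>Monomial ideals\<close>

abbreviation lookup :: "('a \<Rightarrow>\<^sub>0 'b::zero) \<Rightarrow> 'a \<Rightarrow> 'b" where
  "lookup \<equiv> Poly_Mapping.lookup"

abbreviation keys :: "('a \<Rightarrow>\<^sub>0 'b::zero) \<Rightarrow> 'a set" where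
  "keys \<equiv> Poly_Mapping.keys"

abbreviation single :: "'a \<Rightarrow> 'b::zero \<Rightarrow> 'a \<Rightarrow>\<^sub>0 'b" where
  "single \<equiv> Poly_Mapping.single"

abbreviation monom_of :: "('v \<Rightarrow>\<^sub>0 nat) \<Rightarrow> ('v, 'k::field) mpoly" where
  "monom_of \<alpha> \<equiv> single \<alpha> 1"

definition exp_le :: "('v \<Rightarrow>\<^sub>0 nat) \<Rightarrow> ('v \<Rightarrow>\<^sub>0 nat) \<Rightarrow> bool" where
  "exp_le \<alpha> \<beta> \<longleftrightarrow> (\<forall>v. lookup \<alpha> v \<le> lookup \<beta> v)"

lemma exp_le_refl: "exp_le \<alpha> \<alpha>"
  by (simp add: exp_le_def)

lemma exp_le_trans: "exp_le \<alpha> \<beta> \<Longrightarrow> exp_le \<beta> \<gamma> \<Longrightarrow> exp_le \<alpha> \<gamma>"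
  unfolding exp_le_def by (meson order_trans)

lemma exp_le_antisym: "exp_le \<alpha> \<beta> \<Longrightarrow> exp_le \<beta> \<alpha> \<Longrightarrow> \<alpha> = \<beta>"
  by (intro poly_mapping_eqI order_antisym) (simp_all add: exp_le_def)

lemma exp_le_add: "exp_le \<alpha> (\<alpha> + \<beta>)" "exp_le \<alpha> (\<beta> + \<alpha>)"
  by (simp_all add: exp_le_def lookup_add)

lemma exp_diff_add: "exp_le \<alpha> \<beta> \<Longrightarrow> \<beta> - \<alpha> + \<alpha> = \<beta>"
  by (intro poly_mapping_eqI) (simp add: lookup_add lookup_minus exp_le_def)

lemma lookup_mult_sum:
  fixes f g :: "('a::monoid_add) \<Rightarrow>\<^sub>0 'b::semiring_0"
  shows "lookup (f * g) k = (\<Sum>l\<in>keys f. \<Sum>r\<in>keys g. if k = l + r then lookup f l * lookup g r else 0)"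
proof -
  have inner: "(\<Sum>r. lookup g r when k = l + r) = (\<Sum>r\<in>keys g. lookup g r when k = l + r)" for l
    by (rule Sum_any.expand_superset) (auto simp: in_keys_iff)
  have "lookup (f * g) k = (\<Sum>l. lookup f l * (\<Sum>r\<in>keys g. lookup g r when k = l + r))"
    unfolding lookup_mult inner ..
  also have "\<dots> = (\<Sum>l\<in>keys f. lookup f l * (\<Sum>r\<in>keys g. lookup g r when k = l + r))"
    by (rule Sum_any.expand_superset) (auto simp: in_keys_iff)
  also have "\<dots> = (\<Sum>l\<in>keys f. \<Sum>r\<in>keys g. if k = l + r then lookup f l * lookup g r else 0)"
    unfolding sum_distrib_left by (intro sum.cong) (auto simp: when_def)
  finally show ?thesis .
qed

lemma lookup_mult_unique:
  fixes f g :: "('a::monoid_add) \<Rightarrow>\<^sub>0 'b::semiring_0"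
  assumes "\<And>l r. l \<in> keys f \<Longrightarrow> r \<in> keys g \<Longrightarrow> p + q = l + r \<Longrightarrow> l = p \<and> r = q"
  shows "lookup (f * g) (p + q) = lookup f p * lookup g q"
proof -
  have "(if p + q = l + r then lookup f l * lookup g r else 0) =
      (if r = q then if l = p then lookup f p * lookup g q else 0 else 0)"
    if "l \<in> keys f" "r \<in> keys g" for l r
  proof (cases "l = p \<and> r = q")
    case False
    then have "p + q \<noteq> l + r"
      using assms[OF that] by blast
    then show ?thesis
      using False by auto
  qed simp
  then have "lookup (f * g) (p + q) =
      (\<Sum>l\<in>keys f. \<Sum>r\<in>keys g. if r = q then if l = p then lookup f p * lookup g q else 0 else 0)"
    unfolding lookup_mult_sum by (intro sum.cong refl)
  also have "\<dots> = lookup f p * lookup g q"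
    by (cases "lookup g q = 0") (simp_all add: in_keys_iff)
  finally show ?thesis .
qed

lemma lookup_single_mult:
  fixes f :: "('v, 'k::field) mpoly"
  shows "lookup (single \<alpha> c * f) \<gamma> = (if exp_le \<alpha> \<gamma> then c * lookup f (\<gamma> - \<alpha>) else 0)"
proof (cases "exp_le \<alpha> \<gamma>")
  case True
  have "lookup (single \<alpha> c * f) (\<alpha> + (\<gamma> - \<alpha>)) = lookup (single \<alpha> c) \<alpha> * lookup f (\<gamma> - \<alpha>)"
    by (rule lookup_mult_unique) (auto split: if_splits)
  then show ?thesis
    using exp_diff_add[OF True] True by (simp add: add.commute)
next
  case False
  then have "\<gamma> \<notin> keys (single \<alpha> c * f)"
    using keys_mult[of "single \<alpha> c" f] exp_le_add by (fastforce split: if_splits)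
  then show ?thesis
    using False by (simp add: in_keys_iff)
qed

lemma sum_single_lookup: "f = (\<Sum>\<gamma>\<in>keys f. single \<gamma> (lookup f \<gamma>))"
  by (rule poly_mapping_eqI) (simp add: lookup_sum lookup_single when_def in_keys_iff sum.delta')

lemma is_ideal_ideal_gen: "is_ideal (ideal_gen A)"
  by (auto simp: is_ideal_def ideal_gen_def)

lemma ideal_gen_superset: "A \<subseteq> ideal_gen A"
  by (auto simp: ideal_gen_def)

lemma ideal_gen_least: "is_ideal J \<Longrightarrow> A \<subseteq> J \<Longrightarrow> ideal_gen A \<subseteq> J"
  by (auto simp: ideal_gen_def)

lemma ideal_gen_mono: "A \<subseteq> B \<Longrightarrow> ideal_gen A \<subseteq> ideal_gen B"
  by (auto simp: ideal_gen_def)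

lemma ideal_zero: "is_ideal J \<Longrightarrow> 0 \<in> J"
  and ideal_add: "is_ideal J \<Longrightarrow> x \<in> J \<Longrightarrow> y \<in> J \<Longrightarrow> x + y \<in> J"
  and ideal_mult: "is_ideal J \<Longrightarrow> x \<in> J \<Longrightarrow> r * x \<in> J"
  by (auto simp: is_ideal_def)

lemma ideal_sum: "is_ideal J \<Longrightarrow> (\<And>i. i \<in> S \<Longrightarrow> f i \<in> J) \<Longrightarrow> sum f S \<in> J"
  by (induction S rule: infinite_finite_induct) (auto simp: ideal_zero ideal_add)

lemma ideal_diff: "is_ideal J \<Longrightarrow> x \<in> J \<Longrightarrow> y \<in> J \<Longrightarrow> x - y \<in> J"
  using ideal_add[of J x "- 1 * y"] ideal_mult[of J y "- 1"] by simp

lemma is_ideal_keys_subset: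
  assumes "\<And>\<alpha> \<beta>. \<alpha> \<in> S \<Longrightarrow> \<beta> + \<alpha> \<in> S"
  shows "is_ideal {f :: ('v, 'k::field) mpoly. keys f \<subseteq> S}"
  unfolding is_ideal_def
proof (intro conjI ballI allI)
  fix f g :: "('v, 'k) mpoly"
  assume "f \<in> {f. keys f \<subseteq> S}" "g \<in> {f. keys f \<subseteq> S}"
  then show "f + g \<in> {f. keys f \<subseteq> S}"
    using Poly_Mapping.keys_add[of f g] by auto
next
  fix r f :: "('v, 'k) mpoly"
  assume f: "f \<in> {f. keys f \<subseteq> S}"
  show "r * f \<in> {f. keys f \<subseteq> S}"
  proof (intro CollectI subsetI)
    fix \<gamma> assume "\<gamma> \<in> keys (r * f)"
    then obtain \<beta> \<alpha> where "\<gamma> = \<beta> + \<alpha>" "\<alpha> \<in> keys f"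
      using keys_mult[of r f] by blast
    then show "\<gamma> \<in> S"
      using f assms by blast
  qed
qed simp

theorem mem_monomial_ideal_iff:
  "(f :: ('v, 'k::field) mpoly) \<in> ideal_gen (monom_of ` G) \<longleftrightarrow> (\<forall>\<gamma>\<in>keys f. \<exists>\<alpha>\<in>G. exp_le \<alpha> \<gamma>)"
proof
  let ?S = "{\<gamma>. \<exists>\<alpha>\<in>G. exp_le \<alpha> \<gamma>}"
  have up: "\<beta> + \<gamma> \<in> ?S" if "\<gamma> \<in> ?S" for \<beta> \<gamma>
    using that exp_le_trans exp_le_add by blast
  have "monom_of ` G \<subseteq> {f :: ('v, 'k) mpoly. keys f \<subseteq> ?S}"
    by (auto intro: exp_le_refl)
  from ideal_gen_least[OF is_ideal_keys_subset[OF up] this]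
  show "f \<in> ideal_gen (monom_of ` G) \<Longrightarrow> \<forall>\<gamma>\<in>keys f. \<exists>\<alpha>\<in>G. exp_le \<alpha> \<gamma>"
    by auto
next
  assume below: "\<forall>\<gamma>\<in>keys f. \<exists>\<alpha>\<in>G. exp_le \<alpha> \<gamma>"
  have "(\<Sum>\<gamma>\<in>keys f. single \<gamma> (lookup f \<gamma>)) \<in> ideal_gen (monom_of ` G)"
  proof (rule ideal_sum[OF is_ideal_ideal_gen])
    fix \<gamma> assume "\<gamma> \<in> keys f"
    then obtain \<alpha> where \<alpha>: "\<alpha> \<in> G" "exp_le \<alpha> \<gamma>"
      using below by blast
    have "single \<gamma> (lookup f \<gamma>) = single (\<gamma> - \<alpha>) (lookup f \<gamma>) * monom_of \<alpha>"
      by (simp add: mult_single exp_diff_add[OF \<alpha>(2)])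
    also have "\<dots> \<in> ideal_gen (monom_of ` G)"
      using \<alpha>(1) by (intro ideal_mult[OF is_ideal_ideal_gen] subsetD[OF ideal_gen_superset] imageI)
    finally show "single \<gamma> (lookup f \<gamma>) \<in> ideal_gen (monom_of ` G)" .
  qed
  then show "f \<in> ideal_gen (monom_of ` G)"
    using sum_single_lookup[of f] by simp
qed

lemma monomial_ideal_eqI:
  assumes "H \<subseteq> G" "\<And>\<alpha>. \<alpha> \<in> G \<Longrightarrow> \<exists>\<beta>\<in>H. exp_le \<beta> \<alpha>"
  shows "ideal_gen (monom_of ` H) = (ideal_gen (monom_of ` G) :: ('v, 'k::field) mpoly set)"
proof
  show "ideal_gen (monom_of ` H) \<subseteq> (ideal_gen (monom_of ` G) :: ('v, 'k) mpoly set)"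
    by (rule ideal_gen_mono[OF image_mono[OF assms(1)]])
  show "ideal_gen (monom_of ` G) \<subseteq> (ideal_gen (monom_of ` H) :: ('v, 'k) mpoly set)"
    using assms(2) by (intro ideal_gen_least[OF is_ideal_ideal_gen]) (auto simp: mem_monomial_ideal_iff)
qed

lemma monomial_ideal_finite_generators:
  assumes I: "monomial_ideal (I :: ('v::finite, 'k::field) mpoly set)" and T: "finite T" "I = ideal_gen T"
  obtains E where "finite E" "I = ideal_gen (monom_of ` E)"
proof -
  obtain M :: "('v, 'k) mpoly set" where M: "\<forall>g\<in>M. monomial g" "I = ideal_gen M"
    using I by (auto simp: monomial_ideal_def)
  define G where "G = {\<alpha>. (monom_of \<alpha> :: ('v, 'k) mpoly) \<in> M}"
  have "M = monom_of ` G"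
    using M(1) by (auto simp: G_def monomial_def)
  then have I_G: "I = ideal_gen (monom_of ` G)"
    using M(2) by simp
  let ?K = "\<Union>f\<in>T. keys f"
  have "\<forall>\<gamma>\<in>?K. \<exists>\<alpha>. \<alpha> \<in> G \<and> exp_le \<alpha> \<gamma>"
    using T(2) ideal_gen_superset[of T] I_G mem_monomial_ideal_iff[of _ G, where 'k='k] by blast
  from bchoice[OF this] obtain h where h: "\<forall>\<gamma>\<in>?K. h \<gamma> \<in> G \<and> exp_le (h \<gamma>) \<gamma>" ..
  have "I = ideal_gen (monom_of ` h ` ?K)"
  proof
    have "T \<subseteq> ideal_gen (monom_of ` h ` ?K)"
      unfolding subset_iff mem_monomial_ideal_iff using h by blast
    then show "I \<subseteq> ideal_gen (monom_of ` h ` ?K)"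
      unfolding T(2) by (rule ideal_gen_least[OF is_ideal_ideal_gen])
    show "ideal_gen (monom_of ` h ` ?K) \<subseteq> I"
      unfolding I_G using h by (intro ideal_gen_mono image_mono) blast
  qed
  then show ?thesis
    using that[of "h ` ?K"] T(1) by simp
qed

lemma monomial_nonzerodivisor:
  fixes g :: "('v, 'k::field) mpoly"
  assumes coprime: "\<And>\<beta> v. \<beta> \<in> E \<Longrightarrow> lookup \<beta> v = 0 \<or> lookup \<alpha> v = 0"
    and "monom_of \<alpha> * g \<in> ideal_gen (monom_of ` E)"
  shows "g \<in> ideal_gen (monom_of ` E)"
  unfolding mem_monomial_ideal_iff
proof
  fix \<gamma> assume "\<gamma> \<in> keys g"
  then have "\<alpha> + \<gamma> \<in> keys (monom_of \<alpha> * g)"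
    by (simp add: in_keys_iff lookup_single_mult exp_le_add)
  then obtain \<beta> where \<beta>: "\<beta> \<in> E" "exp_le \<beta> (\<alpha> + \<gamma>)"
    using assms(2) unfolding mem_monomial_ideal_iff by blast
  have "lookup \<beta> v \<le> lookup \<gamma> v" for v
    using coprime[OF \<beta>(1), of v] \<beta>(2) unfolding exp_le_def lookup_add by (metis add.left_neutral zero_le)
  then show "\<exists>\<beta>\<in>E. exp_le \<beta> \<gamma>"
    using \<beta>(1) unfolding exp_le_def by blast
qed

theorem complete_intersection_coprime_monomials:
  assumes E: "finite E"
    and coprime: "\<And>\<alpha> \<beta> v. \<alpha> \<in> E \<Longrightarrow> \<beta> \<in> E \<Longrightarrow> \<alpha> \<noteq> \<beta> \<Longrightarrow> lookup \<alpha> v = 0 \<or> lookup \<beta> v = 0"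
    and proper: "ideal_gen (monom_of ` E) \<noteq> (UNIV :: ('v::finite, 'k::field) mpoly set)"
  shows "complete_intersection (ideal_gen (monom_of ` E) :: ('v, 'k) mpoly set)"
proof -
  obtain es where es: "set es = E" "distinct es"
    using finite_distinct_list[OF E] by blast
  let ?fs = "map monom_of es :: ('v, 'k) mpoly list"
  have "regular_sequence ?fs"
    unfolding regular_sequence_def
  proof (intro conjI allI impI)
    show "ideal_gen (set ?fs) \<noteq> UNIV"
      using proper es by simp
    fix i and g :: "('v, 'k) mpoly"
    assume i: "i < length ?fs" and mem: "?fs ! i * g \<in> ideal_gen (set (take i ?fs))"
    have take: "set (take i ?fs) = monom_of ` set (take i es)"
      by (simp add: take_map)
    have "lookup \<beta> v = 0 \<or> lookup (es ! i) v = 0" if "\<beta> \<in> set (take i es)" for \<beta> v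
    proof (rule coprime)
      show "\<beta> \<in> E" "es ! i \<in> E"
        using that i es(1) by (auto dest: in_set_takeD)
      show "\<beta> \<noteq> es ! i"
        using that i es(2) by (auto simp: in_set_conv_nth nth_eq_iff_index_eq)
    qed
    then show "g \<in> ideal_gen (set (take i ?fs))"
      using monomial_nonzerodivisor[of "set (take i es)" "es ! i" g] mem i unfolding take by simp
  qed
  then show ?thesis
    unfolding complete_intersection_def using es by (intro exI[of _ ?fs]) simp
qed

section \<open>Heights of monomial primes\<close>

definition var_prime :: "'v set \<Rightarrow> ('v, 'k::field) mpoly set" where
  "var_prime A = {f. keys f \<subseteq> {\<gamma>. \<exists>v\<in>A. lookup \<gamma> v > 0}}"

lemma is_ideal_var_prime: "is_ideal (var_prime A)"
  unfolding var_prime_def by (rule is_ideal_keys_subset) (auto simp: lookup_add)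

lemma var_prime_empty: "var_prime {} = {0}"
  by (auto simp: var_prime_def)

text \<open>The library orders exponents only over linearly ordered variables; an injection of the variables into the
  naturals transports that order to an arbitrary finite set of variables.\<close>

definition nat_exponent :: "('v::finite \<Rightarrow>\<^sub>0 nat) \<Rightarrow> (nat \<Rightarrow>\<^sub>0 nat)" where
  "nat_exponent \<alpha> = (\<Sum>v\<in>UNIV. single ((SOME e :: 'v \<Rightarrow> nat. inj e) v) (lookup \<alpha> v))"

lemma nat_exponent_add: "nat_exponent (\<alpha> + \<beta>) = nat_exponent \<alpha> + nat_exponent \<beta>"
  by (simp add: nat_exponent_def lookup_add single_add sum.distrib)

lemma inj_nat_exponent: "inj (nat_exponent :: ('v::finite \<Rightarrow>\<^sub>0 nat) \<Rightarrow> _)"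
proof (rule injI)
  fix \<alpha> \<beta> :: "'v \<Rightarrow>\<^sub>0 nat" assume eq: "nat_exponent \<alpha> = nat_exponent \<beta>"
  define e where "e = (SOME e :: 'v \<Rightarrow> nat. inj e)"
  have "\<exists>e :: 'v \<Rightarrow> nat. inj e"
    using finite_imp_inj_to_nat_seg[of "UNIV :: 'v set"] by auto
  then have e: "inj e"
    unfolding e_def by (rule someI_ex)
  have "lookup (nat_exponent \<gamma>) (e v) = lookup \<gamma> v" for \<gamma> :: "'v \<Rightarrow>\<^sub>0 nat" and v
  proof -
    have "lookup (nat_exponent \<gamma>) (e v) = (\<Sum>u\<in>UNIV. if u = v then lookup \<gamma> u else 0)"
      unfolding nat_exponent_def e_def[symmetric] lookup_sum lookup_single when_def
      using inj_eq[OF e] by (intro sum.cong) auto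
    then show ?thesis
      by simp
  qed
  then show "\<alpha> = \<beta>"
    by (intro poly_mapping_eqI) (metis eq)
qed

lemma exists_unique_sum:
  fixes S T :: "('v::finite \<Rightarrow>\<^sub>0 nat) set"
  assumes "finite S" "S \<noteq> {}" "finite T" "T \<noteq> {}"
  obtains p q where "p \<in> S" "q \<in> T" "\<And>l r. l \<in> S \<Longrightarrow> r \<in> T \<Longrightarrow> p + q = l + r \<Longrightarrow> l = p \<and> r = q"
proof -
  have largest: "\<exists>p\<in>U. \<forall>l\<in>U. nat_exponent l \<le> nat_exponent p" if "finite U" "U \<noteq> {}"
    for U :: "('v \<Rightarrow>\<^sub>0 nat) set"
  proof -
    have "Max (nat_exponent ` U) \<in> nat_exponent ` U"
      using that by (intro Max_in) auto
    then obtain p where "p \<in> U" "nat_exponent p = Max (nat_exponent ` U)"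
      by auto
    then show ?thesis
      using that(1) by (intro bexI[of _ p]) simp_all
  qed
  obtain p q where p: "p \<in> S" "\<And>l. l \<in> S \<Longrightarrow> nat_exponent l \<le> nat_exponent p"
    and q: "q \<in> T" "\<And>r. r \<in> T \<Longrightarrow> nat_exponent r \<le> nat_exponent q"
    using largest[OF assms(1,2)] largest[OF assms(3,4)] by blast
  have "l = p \<and> r = q" if lr: "l \<in> S" "r \<in> T" "p + q = l + r" for l r
  proof -
    have sum: "nat_exponent l + nat_exponent r = nat_exponent p + nat_exponent q"
      using lr(3) by (metis nat_exponent_add)
    have "nat_exponent l = nat_exponent p"
    proof (rule ccontr)
      assume "nat_exponent l \<noteq> nat_exponent p"
      then have "nat_exponent l + nat_exponent r < nat_exponent p + nat_exponent q"
        using p(2)[OF lr(1)] q(2)[OF lr(2)] by (intro add_less_le_mono) auto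
      then show False
        using sum by simp
    qed
    then have "l = p"
      by (rule injD[OF inj_nat_exponent])
    then show ?thesis
      using lr(3) by simp
  qed
  then show ?thesis
    using that p(1) q(1) by blast
qed

lemma is_prime_var_prime: "is_prime_ideal (var_prime A :: ('v::finite, 'k::field) mpoly set)"
  unfolding is_prime_ideal_def
proof (intro conjI allI impI)
  have "(1 :: ('v, 'k) mpoly) \<notin> var_prime A"
    by (simp add: var_prime_def)
  then show "var_prime A \<noteq> (UNIV :: ('v, 'k) mpoly set)"
    by blast
  fix f g :: "('v, 'k) mpoly"
  let ?N = "{\<gamma>. \<forall>v\<in>A. lookup \<gamma> v = 0}"
  have mem: "h \<in> var_prime A \<longleftrightarrow> keys h \<inter> ?N = {}" for h :: "('v, 'k) mpoly"
    by (auto simp: var_prime_def)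
  assume fg: "f * g \<in> var_prime A"
  show "f \<in> var_prime A \<or> g \<in> var_prime A"
  proof (rule ccontr)
    assume "\<not> ?thesis"
    then have "keys f \<inter> ?N \<noteq> {}" "keys g \<inter> ?N \<noteq> {}"
      by (simp_all add: mem)
    then obtain p q where pq: "p \<in> keys f \<inter> ?N" "q \<in> keys g \<inter> ?N"
      and unique: "\<And>l r. l \<in> keys f \<inter> ?N \<Longrightarrow> r \<in> keys g \<inter> ?N \<Longrightarrow> p + q = l + r \<Longrightarrow> l = p \<and> r = q"
      using exists_unique_sum[of "keys f \<inter> ?N" "keys g \<inter> ?N"] finite_keys by (metis (no_types, lifting) finite_Int)
    have "l = p \<and> r = q" if lr: "l \<in> keys f" "r \<in> keys g" "p + q = l + r" for l r
    proof -
      have "lookup l v + lookup r v = 0" if "v \<in> A" for v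
        using that pq lr(3)[symmetric] by (simp flip: lookup_add) (simp add: lookup_add)
      then show ?thesis
        using unique lr by auto
    qed
    then have "lookup (f * g) (p + q) = lookup f p * lookup g q"
      by (rule lookup_mult_unique)
    then have "p + q \<in> keys (f * g) \<inter> ?N"
      using pq by (simp add: in_keys_iff lookup_add)
    then show False
      using fg mem by blast
  qed
qed (rule is_ideal_var_prime)

definition exponent_box :: "'v set \<Rightarrow> nat \<Rightarrow> ('v \<Rightarrow>\<^sub>0 nat) set" where
  "exponent_box A d = {\<gamma>. (\<forall>v. lookup \<gamma> v \<le> d) \<and> (\<forall>v\<in>A. lookup \<gamma> v = 0)}"

lemma bij_betw_exponent_box:
  "bij_betw (\<lambda>\<gamma>. restrict (lookup \<gamma>) (- A)) (exponent_box A d) (PiE (- A :: 'v::finite set) (\<lambda>_. {..d}))"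
proof (rule bij_betw_byWitness[where f' = "\<lambda>h. Abs_poly_mapping (\<lambda>v. if v \<in> A then 0 else h v)"])
  have lookup_Abs: "lookup (Abs_poly_mapping h) = h" for h :: "'v \<Rightarrow> nat"
    by (simp add: lookup_Abs_poly_mapping)
  show "\<forall>\<gamma>\<in>exponent_box A d. Abs_poly_mapping (\<lambda>v. if v \<in> A then 0 else restrict (lookup \<gamma>) (- A) v) = \<gamma>"
    by (intro ballI poly_mapping_eqI) (auto simp: lookup_Abs exponent_box_def)
  show "\<forall>h\<in>PiE (- A) (\<lambda>_. {..d}). restrict (lookup (Abs_poly_mapping (\<lambda>v. if v \<in> A then 0 else h v))) (- A) = h"
    unfolding lookup_Abs by (auto simp: restrict_def PiE_def extensional_def fun_eq_iff)
  show "(\<lambda>\<gamma>. restrict (lookup \<gamma>) (- A)) ` exponent_box A d \<subseteq> PiE (- A) (\<lambda>_. {..d})"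
    by (auto simp: exponent_box_def)
  show "(\<lambda>h. Abs_poly_mapping (\<lambda>v. if v \<in> A then 0 else h v)) ` PiE (- A) (\<lambda>_. {..d}) \<subseteq> exponent_box A d"
    unfolding exponent_box_def by (auto simp: lookup_Abs PiE_def Pi_def)
qed

lemma finite_exponent_box: "finite (exponent_box (A :: 'v::finite set) d)"
  using bij_betw_finite[OF bij_betw_exponent_box[of A d]] by (simp add: finite_PiE)

lemma card_exponent_box: "card (exponent_box (A :: 'v::finite set) d) = Suc d ^ card (- A)"
  using bij_betw_same_card[OF bij_betw_exponent_box[of A d]] by (simp add: card_PiE)

lemma exponent_box_mono: "a \<le> b \<Longrightarrow> exponent_box A a \<subseteq> exponent_box A b"
  by (auto simp: exponent_box_def intro: order_trans)

abbreviation bounded_polys :: "nat \<Rightarrow> ('v::finite, 'k::field) mpoly set" where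
  "bounded_polys d \<equiv> {f. keys f \<subseteq> exponent_box {} d}"

lemma bounded_polys_mono: "f \<in> bounded_polys a \<Longrightarrow> a \<le> b \<Longrightarrow> f \<in> bounded_polys b"
  using exponent_box_mono by blast

lemma bounded_polys_mult: "f \<in> bounded_polys a \<Longrightarrow> g \<in> bounded_polys b \<Longrightarrow> f * g \<in> bounded_polys (a + b)"
  using keys_mult[of f g] by (fastforce simp: exponent_box_def lookup_add add_mono)

lemma bounded_polys_power: "f \<in> bounded_polys a \<Longrightarrow> f ^ n \<in> bounded_polys (n * a)"
  by (induction n) (simp add: exponent_box_def, simp add: bounded_polys_mult del: mem_Collect_eq)

lemma exists_bounded_polys: "\<exists>a. (f :: ('v::finite, 'k::field) mpoly) \<in> bounded_polys a"
proof -
  let ?S = "(\<lambda>(\<gamma>, v). lookup \<gamma> v) ` (keys f \<times> (UNIV :: 'v set))"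
  have "lookup \<gamma> v \<le> Max ?S" if "\<gamma> \<in> keys f" for \<gamma> v
    using that by (intro Max_ge) auto
  then show ?thesis
    by (intro exI[of _ "Max ?S"]) (auto simp: exponent_box_def)
qed

definition independent_mod :: "('v::finite, 'k::field) mpoly set \<Rightarrow> nat \<Rightarrow> (nat \<Rightarrow> ('v, 'k) mpoly) \<Rightarrow> bool" where
  "independent_mod P n u \<longleftrightarrow> (\<forall>c. (\<Sum>j<n. single 0 (c j) * u j) \<in> P \<longrightarrow> (\<forall>j<n. c j = 0))"

lemma independent_modD: "independent_mod P n u \<Longrightarrow> (\<Sum>j<n. single 0 (c j) * u j) \<in> P \<Longrightarrow> j < n \<Longrightarrow> c j = 0"
  by (auto simp: independent_mod_def)

lemma sum_lessThan_add: "(\<Sum>j<a + b. g j) = (\<Sum>j<a. g j) + (\<Sum>j<b. g (a + j :: nat))"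
  by (induction b) (auto simp: add.assoc)

text \<open>Reduce a relation modulo \<open>Q\<close>, then cancel \<open>f\<close>.\<close>

lemma independent_mod_append:
  fixes f :: "('v::finite, 'k::field) mpoly"
  assumes P: "is_prime_ideal P" and Q: "is_ideal Q" and "P \<subseteq> Q" and f: "f \<in> Q" "f \<notin> P"
    and u: "independent_mod Q n u" and w: "independent_mod P m w"
  shows "independent_mod P (n + m) (\<lambda>j. if j < n then u j else f * w (j - n))"
  unfolding independent_mod_def
proof (intro allI impI)
  fix c j
  let ?term = "\<lambda>j. single 0 (c j) * (if j < n then u j else f * w (j - n))"
  let ?low = "\<Sum>j<n. single 0 (c j) * u j"
  let ?high = "\<Sum>j<m. single 0 (c (n + j)) * w j"
  assume relation: "(\<Sum>j<n + m. ?term j) \<in> P" and j: "j < n + m"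
  have "(\<Sum>j<n + m. ?term j) = ?low + f * ?high"
    unfolding sum_lessThan_add by (simp add: sum_distrib_left mult.left_commute)
  then have split: "?low + f * ?high \<in> P"
    using relation by simp
  have "f * ?high \<in> Q"
    using ideal_mult[OF Q f(1), of ?high] by (simp add: mult.commute)
  then have "(?low + f * ?high) - f * ?high \<in> Q"
    using split \<open>P \<subseteq> Q\<close> by (intro ideal_diff[OF Q]) auto
  then have low: "c i = 0" if "i < n" for i
    using independent_modD[OF u] that by simp
  then have "f * ?high \<in> P"
    using split by simp
  then have "?high \<in> P"
    using P f(2) unfolding is_prime_ideal_def by blast
  then have high: "c (n + i) = 0" if "i < m" for i
    using independent_modD[OF w, of "\<lambda>i. c (n + i)"] that by simp
  show "c j = 0"
    using low[of j] high[of "j - n"] j by (cases "j < n") auto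
qed

lemma independent_mod_powers:
  fixes f :: "('v::finite, 'k::field) mpoly"
  assumes PQ: "is_prime_ideal P" "is_ideal Q" "P \<subseteq> Q" "f \<in> Q" "f \<notin> P" and n: "n > 0"
    and u: "independent_mod Q n u"
  shows "independent_mod P (d * n) (\<lambda>j. f ^ (j div n) * u (j mod n))"
proof (induction d)
  case 0
  show ?case
    by (simp add: independent_mod_def)
next
  case (Suc d)
  have "(\<lambda>j. if j < n then u j else f * (f ^ ((j - n) div n) * u ((j - n) mod n))) = (\<lambda>j. f ^ (j div n) * u (j mod n))"
    using n by (auto simp: fun_eq_iff le_div_geq le_mod_geq mult.assoc)
  then show ?case
    using independent_mod_append[OF PQ u Suc.IH] by simp
qed

definition bounded_independent_mod :: "('v::finite, 'k::field) mpoly set \<Rightarrow> nat \<Rightarrow> nat \<Rightarrow> bool" where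
  "bounded_independent_mod P n a \<longleftrightarrow> (\<exists>u. independent_mod P n u \<and> (\<forall>j<n. u j \<in> bounded_polys a))"

lemma bounded_independent_mod_step:
  fixes f :: "('v::finite, 'k::field) mpoly"
  assumes PQ: "is_prime_ideal P" "is_ideal Q" "P \<subseteq> Q" "f \<in> Q" "f \<notin> P" and f: "f \<in> bounded_polys e"
    and Q: "bounded_independent_mod Q n a" and n: "n > 0"
  shows "bounded_independent_mod P (Suc d * n) (d * e + a)"
proof -
  obtain u where u: "independent_mod Q n u" "\<And>j. j < n \<Longrightarrow> u j \<in> bounded_polys a"
    using Q unfolding bounded_independent_mod_def by blast
  have "f ^ (j div n) * u (j mod n) \<in> bounded_polys (d * e + a)" if "j < Suc d * n" for j
  proof (rule bounded_polys_mono[OF bounded_polys_mult[OF bounded_polys_power[OF f] u(2)]])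
    show "j mod n < n"
      using n by simp
    have "j div n \<le> d"
      using that n by (metis div_less_iff_less_mult less_Suc_eq_le)
    then show "j div n * e + a \<le> d * e + a"
      by simp
  qed
  then show ?thesis
    using independent_mod_powers[OF PQ n u(1)] unfolding bounded_independent_mod_def by blast
qed

lemma bounded_independent_mod_chain:
  fixes P :: "nat \<Rightarrow> ('v::finite, 'k::field) mpoly set"
  assumes "\<forall>i\<le>h. is_prime_ideal (P i)" "\<forall>i<h. P i \<subset> P (Suc i)"
  shows "\<exists>C. \<forall>d n a. bounded_independent_mod (P h) n a \<longrightarrow> n > 0 \<longrightarrow>
    bounded_independent_mod (P 0) (Suc d ^ h * n) (d * C + a)"
  using assms
proof (induction h)
  case 0
  show ?case
    by (rule exI[of _ 0]) simp
next
  case (Suc h)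
  then obtain C where C: "\<And>d n a. bounded_independent_mod (P h) n a \<Longrightarrow> n > 0 \<Longrightarrow>
      bounded_independent_mod (P 0) (Suc d ^ h * n) (d * C + a)"
    by auto
  obtain f where f: "f \<in> P (Suc h)" "f \<notin> P h"
    using Suc.prems(2) by blast
  obtain e where e: "f \<in> bounded_polys e"
    using exists_bounded_polys by blast
  have primes: "is_prime_ideal (P h)" "is_ideal (P (Suc h))" "P h \<subseteq> P (Suc h)"
    using Suc.prems by (auto simp: is_prime_ideal_def)
  have "bounded_independent_mod (P 0) (Suc d ^ Suc h * n) (d * (C + e) + a)"
    if "bounded_independent_mod (P (Suc h)) n a" "n > 0" for d n a
    using C[OF bounded_independent_mod_step[OF primes f e that], of d d] that(2) by (simp add: algebra_simps)
  then show ?case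
    by blast
qed

lemma bounded_independent_mod_var_prime:
  "bounded_independent_mod (var_prime A :: ('v::finite, 'k::field) mpoly set) (Suc d ^ card (- A)) d"
proof -
  let ?n = "Suc d ^ card (- A)"
  obtain e where e: "bij_betw e {..<?n} (exponent_box A d)"
    using ex_bij_betw_nat_finite[OF finite_exponent_box[of A d]] by (auto simp: card_exponent_box lessThan_atLeast0)
  then have in_box: "e j \<in> exponent_box A d" if "j < ?n" for j
    using that by (auto simp: bij_betw_def)
  let ?u = "\<lambda>j. monom_of (e j) :: ('v, 'k) mpoly"
  have "c j = 0" if sum: "(\<Sum>i<?n. single 0 (c i) * ?u i) \<in> var_prime A" and j: "j < ?n" for c j
  proof (rule ccontr)
    have "lookup (\<Sum>i<?n. single 0 (c i) * ?u i) (e j) = (\<Sum>i<?n. if i = j then c i else 0)"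
      unfolding lookup_sum mult_single lookup_single when_def
      using e j by (intro sum.cong) (auto simp: bij_betw_def inj_on_def)
    moreover assume "c j \<noteq> 0"
    ultimately have "e j \<in> keys (\<Sum>i<?n. single 0 (c i) * ?u i)"
      using j by (simp add: in_keys_iff)
    then show False
      using sum in_box[OF j] by (auto simp: var_prime_def exponent_box_def)
  qed
  moreover have "?u j \<in> bounded_polys d" if "j < ?n" for j
    using in_box[OF that] by (auto simp: exponent_box_def)
  ultimately show ?thesis
    unfolding bounded_independent_mod_def independent_mod_def by (intro exI[of _ ?u]) blast
qed

lemma bounded_independent_mod_le:
  assumes "bounded_independent_mod (P :: ('v::finite, 'k::field) mpoly set) n a" "0 \<in> P"
  shows "n \<le> Suc a ^ card (UNIV :: 'v set)"
proof -
  obtain u where u: "independent_mod P n u" "\<And>j. j < n \<Longrightarrow> keys (u j) \<subseteq> exponent_box {} a"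
    using assms(1) unfolding bounded_independent_mod_def by blast
  define L where "L = (\<lambda>(c :: nat \<Rightarrow> 'k) \<gamma>. \<Sum>j<n. c j * lookup (u j) \<gamma>)"
  have linear: "fun_linear L"
    unfolding L_def by (rule fun_linearI) (auto simp: algebra_simps sum.distrib sum_distrib_left)
  let ?V = "supported_on {..<n} :: (nat \<Rightarrow> 'k) set"
  have L_eq: "L c = lookup (\<Sum>j<n. single 0 (c j) * u j)" for c
    unfolding L_def by (rule ext) (simp add: lookup_sum lookup_single_mult exp_le_def)
  have "c = 0" if c: "c \<in> ?V" "L c = 0" for c
  proof
    fix j
    have "(\<Sum>j<n. single 0 (c j) * u j) = 0"
      using c(2) unfolding L_eq by (intro poly_mapping_eqI) simp
    then show "c j = 0 j"
      using independent_modD[OF u(1), of c j] assms(2) supported_onD[OF c(1), of j] by (cases "j < n") auto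
  qed
  then have "{c \<in> ?V. L c = 0} = {0}"
    by (auto simp: L_def fun_eq_iff)
  then have "n = fun_vs.dim (L ` ?V)"
    using fun_rank_nullity[OF linear subspace_supported_on[of "{..<n}"] _ order_refl]
    by (simp add: fun_dim_zero dim_supported_on)
  also have "\<dots> \<le> fun_vs.dim (supported_on (exponent_box ({} :: 'v set) a) :: (_ \<Rightarrow> 'k) set)"
  proof (rule fun_dim_mono[OF _ finite_exponent_box order_refl], rule image_subsetI)
    fix c
    have "lookup (u j) \<gamma> = 0" if "j < n" "\<gamma> \<notin> exponent_box {} a" for j \<gamma>
      using u(2)[OF that(1)] that(2) by (auto simp: in_keys_iff)
    then show "L c \<in> supported_on (exponent_box {} a)"
      by (auto simp: L_def supported_on_def intro!: sum.neutral)
  qed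
  finally show ?thesis
    using card_exponent_box[of "{} :: 'v set" a] by (simp add: dim_supported_on[OF finite_exponent_box])
qed

theorem prime_height_var_prime_le:
  "prime_height (var_prime A :: ('v::finite, 'k::field) mpoly set) \<le> enat (card A)"
  unfolding prime_height_def
proof (rule Sup_least, elim CollectE exE conjE)
  fix x h and P :: "nat \<Rightarrow> ('v, 'k) mpoly set"
  assume x: "x = enat h" and P: "\<forall>i\<le>h. is_prime_ideal (P i)" "\<forall>i<h. P i \<subset> P (Suc i)" "P h = var_prime A"
  let ?v = "card (UNIV :: 'v set)"
  obtain C where C: "\<And>d n a. bounded_independent_mod (P h) n a \<Longrightarrow> n > 0 \<Longrightarrow>
      bounded_independent_mod (P 0) (Suc d ^ h * n) (d * C + a)"
    using bounded_independent_mod_chain[OF P(1,2)] by blast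
  have zero: "0 \<in> P 0"
    using P(1) by (auto simp: is_prime_ideal_def is_ideal_def)
  define M where "M = Suc C ^ ?v"
  have bound: "Suc M ^ h * Suc M ^ card (- A) \<le> Suc (M * C + M) ^ ?v"
    by (rule bounded_independent_mod_le[OF C zero]) (simp_all add: P(3) bounded_independent_mod_var_prime)
  show "x \<le> enat (card A)"
  proof (rule ccontr)
    assume "\<not> ?thesis"
    then have "Suc ?v \<le> h + card (- A)"
      using x card_mono[of UNIV A] by (simp add: Compl_eq_Diff_UNIV card_Diff_subset)
    then have "Suc M ^ Suc ?v \<le> Suc M ^ (h + card (- A))"
      by (intro power_increasing) auto
    also have "\<dots> \<le> Suc (M * C + M) ^ ?v"
      using bound by (simp add: power_add)
    also have "\<dots> \<le> (Suc C * Suc M) ^ ?v"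
      by (intro power_mono) auto
    also have "\<dots> = M * Suc M ^ ?v"
      by (simp only: power_mult_distrib M_def)
    finally show False
      by simp
  qed
qed

lemma zero_ideal_of_height_0:
  fixes I :: "('v::finite, 'k::field) mpoly set"
  assumes "is_ideal I" "ideal_height I = 0"
  shows "I = {0}"
proof -
  let ?Q = "{Q. is_prime_ideal Q \<and> I \<subseteq> Q}"
  have "?Q \<noteq> {}"
    using assms(2) unfolding ideal_height_def by (metis Inf_enat_def image_is_empty infinity_ne_i0 zero_enat_def)
  then have "ideal_height I \<in> prime_height ` ?Q"
    unfolding ideal_height_def by (metis (no_types) equals0I image_eqI wellorder_InfI)
  then obtain Q where Q: "is_prime_ideal Q" "I \<subseteq> Q" "prime_height Q = 0"
    using assms(2) by auto
  have "Q = {0}"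
  proof (rule ccontr)
    assume "Q \<noteq> {0}"
    moreover have "0 \<in> Q"
      using Q(1) by (simp add: is_prime_ideal_def is_ideal_def)
    ultimately have "{0} \<subset> Q"
      by blast
    let ?P = "\<lambda>i :: nat. if i = 0 then {0} else Q"
    have "is_prime_ideal ({0} :: ('v, 'k) mpoly set)"
      using is_prime_var_prime[of "{}"] by (simp add: var_prime_empty)
    then have "enat 1 \<le> prime_height Q"
      unfolding prime_height_def
      by (intro Sup_upper CollectI exI[of _ "1::nat"] exI[of _ ?P] conjI refl) (use Q(1) \<open>{0} \<subset> Q\<close> in simp_all)
    then show False
      using Q(3) by (simp add: zero_enat_def)
  qed
  then show ?thesis
    using Q(2) ideal_zero[OF assms(1)] by blast
qed

lemma complete_intersection_zero: "complete_intersection ({0} :: ('v::finite, 'k::field) mpoly set)"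
proof -
  have zero: "ideal_gen (monom_of ` {}) = ({0} :: ('v, 'k) mpoly set)"
    by (auto simp: mem_monomial_ideal_iff[of _ "{}"] simp del: image_empty)
  moreover have "{0} \<noteq> (UNIV :: ('v, 'k) mpoly set)"
    by (metis UNIV_I singletonD zero_neq_one)
  ultimately have "complete_intersection (ideal_gen (monom_of ` {}) :: ('v, 'k) mpoly set)"
    by (intro complete_intersection_coprime_monomials) simp_all
  then show ?thesis
    unfolding zero .
qed

section \<open>Comparison of free resolutions\<close>

definition mat_mult :: "'z set \<Rightarrow> ('y \<Rightarrow> 'z \<Rightarrow> 'a::comm_ring_1) \<Rightarrow> ('z \<Rightarrow> 'x \<Rightarrow> 'a) \<Rightarrow> 'y \<Rightarrow> 'x \<Rightarrow> 'a" where
  "mat_mult Z A B = (\<lambda>y x. \<Sum>z\<in>Z. A y z * B z x)"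

definition mat_vec :: "'x set \<Rightarrow> ('y \<Rightarrow> 'x \<Rightarrow> 'a::comm_ring_1) \<Rightarrow> ('x \<Rightarrow> 'a) \<Rightarrow> 'y \<Rightarrow> 'a" where
  "mat_vec X A v = (\<lambda>y. \<Sum>x\<in>X. A y x * v x)"

definition mat_supported :: "'y set \<Rightarrow> 'x set \<Rightarrow> ('y \<Rightarrow> 'x \<Rightarrow> 'a::comm_ring_1) set" where
  "mat_supported Y X = {A. \<forall>y x. y \<notin> Y \<or> x \<notin> X \<longrightarrow> A y x = 0}"

definition identity_mat :: "'x set \<Rightarrow> 'x \<Rightarrow> 'x \<Rightarrow> 'a::comm_ring_1" where
  "identity_mat X = (\<lambda>y x. if y = x \<and> x \<in> X then 1 else 0)"

lemma mat_mult_column: "(\<lambda>y. mat_mult Z A B y x) = mat_vec Z A (\<lambda>z. B z x)"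
  by (simp add: mat_mult_def mat_vec_def)

lemma mat_mult_assoc: "mat_mult Z A (mat_mult W B C) = mat_mult W (mat_mult Z A B) C"
proof (intro ext)
  fix y x
  have "mat_mult Z A (mat_mult W B C) y x = (\<Sum>z\<in>Z. \<Sum>w\<in>W. A y z * B z w * C w x)"
    by (simp add: mat_mult_def sum_distrib_left mult.assoc)
  also have "\<dots> = (\<Sum>w\<in>W. \<Sum>z\<in>Z. A y z * B z w * C w x)"
    by (rule sum.swap)
  also have "\<dots> = mat_mult W (mat_mult Z A B) C y x"
    by (simp add: mat_mult_def sum_distrib_right)
  finally show "mat_mult Z A (mat_mult W B C) y x = mat_mult W (mat_mult Z A B) C y x" .
qed

lemma mat_vec_mat_vec: "mat_vec Z A (mat_vec X B v) = mat_vec X (mat_mult Z A B) v"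
  using mat_mult_assoc[of Z A X B "\<lambda>x _. v x"] by (simp add: mat_mult_def mat_vec_def fun_eq_iff)

lemma mat_mult_0 [simp]: "mat_mult Z A 0 = 0" "mat_mult Z 0 B = 0"
  by (simp_all add: mat_mult_def fun_eq_iff)

lemma mat_vec_0 [simp]: "mat_vec X 0 v = 0" "mat_vec X A 0 = 0"
  by (simp_all add: mat_vec_def fun_eq_iff)

lemma mat_mult_diff:
  "mat_mult Z A (B - C) = mat_mult Z A B - mat_mult Z A C" "mat_mult Z (A - B) C = mat_mult Z A C - mat_mult Z B C"
  by (simp_all add: mat_mult_def fun_eq_iff algebra_simps sum_subtractf)

lemma mat_vec_add_mat: "mat_vec X (A + B) v = mat_vec X A v + mat_vec X B v"
  by (simp add: mat_vec_def fun_eq_iff algebra_simps sum.distrib)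

lemma fun_linear_mat_vec: "fun_linear (mat_vec X (A :: 'y \<Rightarrow> 'x \<Rightarrow> 'k::field))"
  by (rule fun_linearI) (auto simp: mat_vec_def algebra_simps sum.distrib sum_distrib_left)

lemma mat_supported_row: "A \<in> mat_supported Y X \<Longrightarrow> y \<notin> Y \<Longrightarrow> A y x = 0"
  and mat_supported_column: "A \<in> mat_supported Y X \<Longrightarrow> x \<notin> X \<Longrightarrow> A y x = 0"
  by (auto simp: mat_supported_def)

lemma mat_supported_diff: "A \<in> mat_supported Y X \<Longrightarrow> B \<in> mat_supported Y X \<Longrightarrow> A - B \<in> mat_supported Y X"
  by (auto simp: mat_supported_def)

lemma mat_supported_mult:
  assumes "A \<in> mat_supported Y Z" "B \<in> mat_supported W X"
  shows "mat_mult V A B \<in> mat_supported Y X"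
  using mat_supported_row[OF assms(1)] mat_supported_column[OF assms(2)]
  by (auto simp: mat_supported_def mat_mult_def)

lemma mat_vec_supported: "A \<in> mat_supported Y X \<Longrightarrow> mat_vec Z A v \<in> supported_on Y"
  by (simp add: mat_vec_def supported_on_def mat_supported_row)

lemma column_supported: "A \<in> mat_supported Y X \<Longrightarrow> (\<lambda>y. A y x) \<in> supported_on Y"
  by (simp add: supported_on_def mat_supported_row)

lemma identity_mat_supported: "identity_mat X \<in> mat_supported X X"
  by (auto simp: identity_mat_def mat_supported_def)

lemma mat_vec_identity:
  assumes "finite X" "v \<in> supported_on X"
  shows "mat_vec X (identity_mat X) v = v"
proof
  fix y
  have "mat_vec X (identity_mat X) v y = (\<Sum>x\<in>X. if x = y then v y else 0)"
    unfolding mat_vec_def identity_mat_def by (intro sum.cong) auto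
  then show "mat_vec X (identity_mat X) v y = v y"
    using assms(1) supported_onD[OF assms(2), of y] by auto
qed

lemma mat_mult_identity_left:
  assumes "finite X" "B \<in> mat_supported X W"
  shows "mat_mult X (identity_mat X) B = B"
proof (intro ext)
  fix y x
  have "(\<lambda>y. mat_mult X (identity_mat X) B y x) = (\<lambda>y. B y x)"
    unfolding mat_mult_column by (rule mat_vec_identity[OF assms(1) column_supported[OF assms(2)]])
  then show "mat_mult X (identity_mat X) B y x = B y x"
    by (rule fun_cong)
qed

lemma mat_mult_identity_right:
  assumes "finite X" "B \<in> mat_supported W X"
  shows "mat_mult X B (identity_mat X) = B"
proof (intro ext)
  fix y x
  have "mat_mult X B (identity_mat X) y x = (\<Sum>z\<in>X. if z = x then B y x else 0)"
    unfolding mat_mult_def identity_mat_def by (intro sum.cong) auto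
  then show "mat_mult X B (identity_mat X) y x = B y x"
    using assms(1) mat_supported_column[OF assms(2), of x y] by auto
qed

lemma mat_vec_unit_fun:
  assumes "finite X" "x \<in> X"
  shows "mat_vec X A (unit_fun x) = (\<lambda>y. A y x)"
proof
  fix y
  have "mat_vec X A (unit_fun x) y = (\<Sum>z\<in>X. if z = x then A y x else 0)"
    unfolding mat_vec_def by (rule sum.cong) (auto simp: unit_fun_def)
  then show "mat_vec X A (unit_fun x) y = A y x"
    using assms by simp
qed

locale free_resolution =
  fixes X :: "nat \<Rightarrow> 'x set" and D :: "nat \<Rightarrow> 'x \<Rightarrow> 'x \<Rightarrow> 'a::comm_ring_1" and I :: "'a set" and p :: 'x
  assumes finite_basis: "\<And>i. finite (X i)" and basis_0: "X 0 = {p}"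
    and differential_supported: "\<And>i. D i \<in> mat_supported (X i) (X (Suc i))"
    and image_0: "(\<lambda>w. mat_vec (X (Suc 0)) (D 0) w p) ` supported_on (X (Suc 0)) = I"
    and exact: "\<And>i. {v \<in> supported_on (X (Suc i)). mat_vec (X (Suc i)) (D i) v = 0} =
      mat_vec (X (Suc (Suc i))) (D (Suc i)) ` supported_on (X (Suc (Suc i)))"
begin

definition syzygies :: "nat \<Rightarrow> ('x \<Rightarrow> 'a) set" where
  "syzygies i = (case i of 0 \<Rightarrow> {v \<in> supported_on (X 0). v p \<in> I}
     | Suc j \<Rightarrow> {v \<in> supported_on (X (Suc j)). mat_vec (X (Suc j)) (D j) v = 0})"

lemma syzygies_eq_image: "syzygies i = mat_vec (X (Suc i)) (D i) ` supported_on (X (Suc i))"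
proof (cases i)
  case 0
  let ?d = "mat_vec (X (Suc 0)) (D 0)"
  have d: "?d w \<in> supported_on {p}" for w
    using mat_vec_supported[OF differential_supported[of 0]] by (simp add: basis_0)
  have "syzygies 0 = ?d ` supported_on (X (Suc 0))"
  proof (intro equalityI subsetI)
    fix v assume "v \<in> syzygies 0"
    then have v: "v \<in> supported_on {p}" "v p \<in> I"
      by (simp_all add: syzygies_def basis_0)
    then obtain w where w: "w \<in> supported_on (X (Suc 0))" "v p = ?d w p"
      using image_0 by blast
    have "v y = ?d w y" for y
      using w(2) supported_onD[OF v(1), of y] supported_onD[OF d, of y w] by (cases "y = p") simp_all
    then show "v \<in> ?d ` supported_on (X (Suc 0))"
      using w(1) by (intro image_eqI[of _ _ w]) auto
  next
    fix v assume "v \<in> ?d ` supported_on (X (Suc 0))"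
    then show "v \<in> syzygies 0"
      using image_0 d by (auto simp: syzygies_def basis_0)
  qed
  then show ?thesis
    using 0 by simp
next
  case (Suc j)
  then show ?thesis
    using exact by (simp add: syzygies_def)
qed

lemma differential_column_syzygy: "(\<lambda>y. D i y x) \<in> syzygies i"
proof (cases "x \<in> X (Suc i)")
  case True
  then show ?thesis
    unfolding syzygies_eq_image
    by (intro image_eqI[of _ _ "unit_fun x"]) (simp_all add: mat_vec_unit_fun finite_basis unit_fun_supported_on)
next
  case False
  then have "(\<lambda>y. D i y x) = 0"
    using mat_supported_column[OF differential_supported[of i]] by auto
  then show ?thesis
    unfolding syzygies_eq_image by (intro image_eqI[of _ _ 0]) simp_all
qed

lemma ideal_gen_first_differential:
  assumes I: "is_ideal I"
  shows "I = ideal_gen (D 0 p ` X (Suc 0))"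
proof
  have "D 0 p x \<in> I" for x
    using differential_column_syzygy[of 0 x] by (simp add: syzygies_def)
  then show "ideal_gen (D 0 p ` X (Suc 0)) \<subseteq> I"
    by (intro ideal_gen_least[OF I]) auto
  show "I \<subseteq> ideal_gen (D 0 p ` X (Suc 0))"
  proof
    fix f assume "f \<in> I"
    then obtain w where "f = mat_vec (X (Suc 0)) (D 0) w p"
      using image_0 by blast
    then have "f = (\<Sum>x\<in>X (Suc 0). w x * D 0 p x)"
      by (simp add: mat_vec_def mult.commute)
    also have "\<dots> \<in> ideal_gen (D 0 p ` X (Suc 0))"
      by (intro ideal_sum ideal_mult is_ideal_ideal_gen subsetD[OF ideal_gen_superset] imageI)
    finally show "f \<in> ideal_gen (D 0 p ` X (Suc 0))" .
  qed
qed

lemma differential_differential: "mat_mult (X (Suc i)) (D i) (D (Suc i)) = 0"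
proof (intro ext)
  fix y x
  have "mat_vec (X (Suc i)) (D i) (\<lambda>y. D (Suc i) y x) = 0"
    using differential_column_syzygy[of "Suc i" x] by (simp add: syzygies_def)
  then have "(\<lambda>y. mat_mult (X (Suc i)) (D i) (D (Suc i)) y x) = 0"
    by (simp only: mat_mult_column)
  then show "mat_mult (X (Suc i)) (D i) (D (Suc i)) y x = 0 y x"
    by (simp add: fun_eq_iff)
qed

lemma syzygies_SucI:
  assumes "B \<in> mat_supported (X (Suc i)) W" "mat_mult (X (Suc i)) (D i) B = 0"
  shows "(\<lambda>y. B y x) \<in> syzygies (Suc i)"
proof -
  have "mat_vec (X (Suc i)) (D i) (\<lambda>y. B y x) = 0"
    unfolding mat_mult_column[symmetric] assms(2) by (simp add: fun_eq_iff)
  then show ?thesis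
    using column_supported[OF assms(1)] by (simp add: syzygies_def)
qed

lemma lift_through_differential:
  assumes B: "B \<in> mat_supported (X i) W" and syz: "\<And>x. (\<lambda>y. B y x) \<in> syzygies i"
  obtains C where "C \<in> mat_supported (X (Suc i)) W" "mat_mult (X (Suc i)) (D i) C = B"
proof -
  have "\<forall>x. \<exists>w. w \<in> supported_on (X (Suc i)) \<and> mat_vec (X (Suc i)) (D i) w = (\<lambda>y. B y x)"
    using syz unfolding syzygies_eq_image by (metis imageE)
  from choice[OF this] obtain w where w: "\<forall>x. w x \<in> supported_on (X (Suc i)) \<and>
      mat_vec (X (Suc i)) (D i) (w x) = (\<lambda>y. B y x)" ..
  define C where "C = (\<lambda>z x. if x \<in> W then w x z else 0)"
  have "mat_mult (X (Suc i)) (D i) C y x = B y x" for y x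
  proof (cases "x \<in> W")
    case True
    then have "mat_mult (X (Suc i)) (D i) C y x = mat_vec (X (Suc i)) (D i) (w x) y"
      by (simp add: C_def mat_mult_def mat_vec_def)
    then show ?thesis
      using w by simp
  next
    case False
    then show ?thesis
      using mat_supported_column[OF B] by (simp add: C_def mat_mult_def)
  qed
  moreover have "C \<in> mat_supported (X (Suc i)) W"
    using w by (auto simp: C_def mat_supported_def supported_on_def)
  ultimately show ?thesis
    using that by blast
qed

lemma exists_null_homotopy:
  assumes supp: "\<And>i. t i \<in> mat_supported (X i) (X i)" and t0: "t 0 = 0"
    and comm: "\<And>i. mat_mult (X (Suc i)) (D i) (t (Suc i)) = mat_mult (X i) (t i) (D i)"
  obtains h where "\<And>i. h i \<in> mat_supported (X (Suc i)) (X i)"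
    "\<And>i. mat_mult (X (Suc (Suc i))) (D (Suc i)) (h (Suc i)) = t (Suc i) - mat_mult (X i) (h i) (D i)"
proof -
  let ?P = "\<lambda>n h. h \<in> mat_supported (X (Suc n)) (X n) \<and>
    mat_mult (X (Suc n)) (D n) (t (Suc n) - mat_mult (X n) h (D n)) = 0"
  let ?Q = "\<lambda>n h h'. mat_mult (X (Suc (Suc n))) (D (Suc n)) h' = t (Suc n) - mat_mult (X n) h (D n)"
  have "\<exists>h. \<forall>n. ?P n (h n) \<and> ?Q n (h n) (h (Suc n))"
  proof (rule dependent_nat_choice)
    show "\<exists>h. ?P 0 h"
      by (rule exI[of _ 0]) (simp add: comm t0 mat_supported_def)
  next
    fix h n assume h: "?P n h"
    let ?B = "t (Suc n) - mat_mult (X n) h (D n)"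
    have B: "?B \<in> mat_supported (X (Suc n)) (X (Suc n))"
      by (rule mat_supported_diff[OF supp mat_supported_mult[OF conjunct1[OF h] differential_supported]])
    obtain h' where h': "h' \<in> mat_supported (X (Suc (Suc n))) (X (Suc n))" "?Q n h h'"
      using lift_through_differential[OF B syzygies_SucI[OF B conjunct2[OF h]]] .
    have "mat_mult (X (Suc (Suc n))) (D (Suc n)) (t (Suc (Suc n)) - mat_mult (X (Suc n)) h' (D (Suc n))) =
        mat_mult (X (Suc n)) (t (Suc n)) (D (Suc n)) - mat_mult (X (Suc n)) ?B (D (Suc n))"
      unfolding mat_mult_diff(1) comm mat_mult_assoc h'(2) ..
    also have "\<dots> = mat_mult (X n) h (mat_mult (X (Suc n)) (D n) (D (Suc n)))"
      unfolding mat_mult_diff(2) mat_mult_assoc by simp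
    also have "\<dots> = 0"
      by (simp add: differential_differential)
    finally show "\<exists>h'. ?P (Suc n) h' \<and> ?Q n h h'"
      using h' by blast
  qed
  then show ?thesis
    using that by blast
qed

end

definition comparison_map ::
  "(nat \<Rightarrow> 'x set) \<Rightarrow> (nat \<Rightarrow> 'x \<Rightarrow> 'x \<Rightarrow> 'a::comm_ring_1) \<Rightarrow> 'x \<Rightarrow>
   (nat \<Rightarrow> 'y set) \<Rightarrow> (nat \<Rightarrow> 'y \<Rightarrow> 'y \<Rightarrow> 'a) \<Rightarrow> 'y \<Rightarrow> (nat \<Rightarrow> 'y \<Rightarrow> 'x \<Rightarrow> 'a) \<Rightarrow> bool" where
  "comparison_map X D p Y E q f \<longleftrightarrow> (\<forall>i. f i \<in> mat_supported (Y i) (X i)) \<and> f 0 q p = 1 \<and>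
     (\<forall>i. mat_mult (Y (Suc i)) (E i) (f (Suc i)) = mat_mult (X i) (f i) (D i))"

lemma
  assumes "comparison_map X D p Y E q f"
  shows comparison_map_supported: "f i \<in> mat_supported (Y i) (X i)"
    and comparison_map_0: "f 0 q p = 1"
    and comparison_map_commute: "mat_mult (Y (Suc i)) (E i) (f (Suc i)) = mat_mult (X i) (f i) (D i)"
  using assms unfolding comparison_map_def by blast+

theorem exists_comparison_map:
  fixes X :: "nat \<Rightarrow> 'x set" and Y :: "nat \<Rightarrow> 'y set" and I :: "'a::comm_ring_1 set"
  assumes F: "free_resolution X D I p" and T: "free_resolution Y E I q"
  obtains f where "comparison_map X D p Y E q f"
proof -
  interpret F: free_resolution X D I p
    by (rule F)
  interpret T: free_resolution Y E I q
    by (rule T)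
  let ?P = "\<lambda>n f. f \<in> mat_supported (Y n) (X n) \<and> (n = 0 \<longrightarrow> f q p = 1) \<and>
    (\<forall>x. (\<lambda>y. mat_mult (X n) f (D n) y x) \<in> T.syzygies n)"
  let ?Q = "\<lambda>n f f'. mat_mult (Y (Suc n)) (E n) f' = mat_mult (X n) f (D n)"
  have "\<exists>f. \<forall>n. ?P n (f n) \<and> ?Q n (f n) (f (Suc n))"
  proof (rule dependent_nat_choice)
    let ?f = "\<lambda>y x. if y = q \<and> x = p then 1 else 0 :: 'a"
    have supp: "?f \<in> mat_supported (Y 0) (X 0)"
      by (auto simp: mat_supported_def F.basis_0 T.basis_0)
    have "mat_mult (X 0) ?f (D 0) q x = D 0 p x" for x
      by (simp add: mat_mult_def F.basis_0)
    moreover have "D 0 p x \<in> I" for x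
      using F.differential_column_syzygy[of 0 x] by (simp add: F.syzygies_def)
    ultimately have "(\<lambda>y. mat_mult (X 0) ?f (D 0) y x) \<in> T.syzygies 0" for x
      using column_supported[OF mat_supported_mult[OF supp F.differential_supported[of 0], of "X 0"]]
      by (simp add: T.syzygies_def)
    then have "?P 0 ?f"
      using supp by simp
    then show "\<exists>f. ?P 0 f"
      by (rule exI[of _ ?f])
  next
    fix f n assume f: "?P n f"
    have B: "mat_mult (X n) f (D n) \<in> mat_supported (Y n) (X (Suc n))"
      by (rule mat_supported_mult[OF conjunct1[OF f] F.differential_supported])
    obtain f' where f': "f' \<in> mat_supported (Y (Suc n)) (X (Suc n))" "?Q n f f'"
      using T.lift_through_differential[OF B] f by blast
    have "mat_mult (Y (Suc n)) (E n) (mat_mult (X (Suc n)) f' (D (Suc n))) =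
        mat_mult (X n) f (mat_mult (X (Suc n)) (D n) (D (Suc n)))"
      unfolding mat_mult_assoc f'(2) ..
    then have "mat_mult (Y (Suc n)) (E n) (mat_mult (X (Suc n)) f' (D (Suc n))) = 0"
      by (simp add: F.differential_differential)
    then have "?P (Suc n) f'"
      using f'(1) T.syzygies_SucI[OF mat_supported_mult[OF f'(1) F.differential_supported]] by blast
    then show "\<exists>f'. ?P (Suc n) f' \<and> ?Q n f f'"
      using f'(2) by blast
  qed
  then show ?thesis
    using that unfolding comparison_map_def by blast
qed

lemma composite_homotopic_to_identity:
  fixes X :: "nat \<Rightarrow> 'x set" and Y :: "nat \<Rightarrow> 'y set" and I :: "'a::comm_ring_1 set"
  assumes F: "free_resolution X D I p" and Y0: "Y 0 = {q}"
    and f: "comparison_map X D p Y E q f" and g: "comparison_map Y E q X D p g"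
  obtains h where "\<And>i. h i \<in> mat_supported (X (Suc i)) (X i)" "mat_mult (Y 0) (g 0) (f 0) = identity_mat (X 0)"
    "\<And>i. mat_mult (Y (Suc i)) (g (Suc i)) (f (Suc i)) =
      identity_mat (X (Suc i)) + mat_mult (X (Suc (Suc i))) (D (Suc i)) (h (Suc i)) + mat_mult (X i) (h i) (D i)"
proof -
  interpret F: free_resolution X D I p
    by (rule F)
  let ?t = "\<lambda>i. mat_mult (Y i) (g i) (f i) - identity_mat (X i)"
  have t0: "?t 0 = 0"
  proof (intro ext)
    fix y x
    show "?t 0 y x = 0 y x"
      using comparison_map_0[OF f] comparison_map_0[OF g] mat_supported_row[OF comparison_map_supported[OF g, of 0], of y]
        mat_supported_column[OF comparison_map_supported[OF f, of 0], of x]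
      by (cases "y = p"; cases "x = p") (auto simp: mat_mult_def F.basis_0 Y0 identity_mat_def)
  qed
  have supp: "?t i \<in> mat_supported (X i) (X i)" for i
    by (rule mat_supported_diff[OF mat_supported_mult[OF comparison_map_supported[OF g] comparison_map_supported[OF f]]
        identity_mat_supported])
  have comm: "mat_mult (X (Suc i)) (D i) (?t (Suc i)) = mat_mult (X i) (?t i) (D i)" for i
  proof -
    have "mat_mult (X (Suc i)) (D i) (mat_mult (Y (Suc i)) (g (Suc i)) (f (Suc i))) =
        mat_mult (Y i) (g i) (mat_mult (Y (Suc i)) (E i) (f (Suc i)))"
      unfolding mat_mult_assoc comparison_map_commute[OF g] ..
    also have "\<dots> = mat_mult (X i) (mat_mult (Y i) (g i) (f i)) (D i)"
      unfolding comparison_map_commute[OF f] mat_mult_assoc ..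
    finally show ?thesis
      unfolding mat_mult_diff mat_mult_identity_left[OF F.finite_basis F.differential_supported]
        mat_mult_identity_right[OF F.finite_basis F.differential_supported] by simp
  qed
  obtain h where h: "\<And>i. h i \<in> mat_supported (X (Suc i)) (X i)"
    "\<And>i. mat_mult (X (Suc (Suc i))) (D (Suc i)) (h (Suc i)) = ?t (Suc i) - mat_mult (X i) (h i) (D i)"
    using F.exists_null_homotopy[of ?t, OF supp t0 comm] by blast
  have "mat_mult (Y 0) (g 0) (f 0) = identity_mat (X 0)"
    using t0 by simp
  moreover have "mat_mult (Y (Suc i)) (g (Suc i)) (f (Suc i)) = identity_mat (X (Suc i)) +
      mat_mult (X (Suc (Suc i))) (D (Suc i)) (h (Suc i)) + mat_mult (X i) (h i) (D i)" for i
    unfolding h(2) by simp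
  ultimately show ?thesis
    using that h(1) by blast
qed

locale ring_hom_to_field =
  fixes eps :: "'a::comm_ring_1 \<Rightarrow> 'k::field"
  assumes eps_add: "eps (a + b) = eps a + eps b" and eps_mult: "eps (a * b) = eps a * eps b" and eps_1: "eps 1 = 1"
begin

lemma eps_0: "eps 0 = 0"
  by (metis add_left_cancel add.right_neutral eps_add)

lemma eps_sum: "eps (sum f S) = (\<Sum>x\<in>S. eps (f x))"
  by (induction S rule: infinite_finite_induct) (auto simp: eps_0 eps_add)

definition reduce :: "('y \<Rightarrow> 'x \<Rightarrow> 'a) \<Rightarrow> 'y \<Rightarrow> 'x \<Rightarrow> 'k" where
  "reduce A = (\<lambda>y x. eps (A y x))"

lemma reduce_mult: "reduce (mat_mult Z A B) = mat_mult Z (reduce A) (reduce B)"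
  by (simp add: reduce_def mat_mult_def eps_sum eps_mult)

lemma reduce_add: "reduce (A + B) = reduce A + reduce B"
  by (simp add: reduce_def fun_eq_iff eps_add)

lemma reduce_0: "reduce 0 = 0"
  by (simp add: reduce_def fun_eq_iff eps_0)

lemma reduce_supported: "A \<in> mat_supported Y X \<Longrightarrow> reduce A \<in> mat_supported Y X"
  by (auto simp: reduce_def mat_supported_def eps_0)

lemma reduce_identity: "reduce (identity_mat X) = identity_mat X"
  by (simp add: reduce_def identity_mat_def fun_eq_iff eps_0 eps_1)

end

definition complex_cycles :: "(nat \<Rightarrow> 'y set) \<Rightarrow> (nat \<Rightarrow> 'y \<Rightarrow> 'y \<Rightarrow> 'k::field) \<Rightarrow> nat \<Rightarrow> ('y \<Rightarrow> 'k) set" where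
  "complex_cycles Y E i =
     {v \<in> supported_on (Y i). case i of 0 \<Rightarrow> True | Suc j \<Rightarrow> mat_vec (Y (Suc j)) (E j) v = 0}"

definition complex_boundaries :: "(nat \<Rightarrow> 'y set) \<Rightarrow> (nat \<Rightarrow> 'y \<Rightarrow> 'y \<Rightarrow> 'k::field) \<Rightarrow> nat \<Rightarrow> ('y \<Rightarrow> 'k) set" where
  "complex_boundaries Y E i = mat_vec (Y (Suc i)) (E i) ` supported_on (Y (Suc i))"

lemma complex_cycles_supported: "complex_cycles Y E i \<subseteq> supported_on (Y i)"
  by (auto simp: complex_cycles_def)

lemma complex_cyclesI:
  "v \<in> supported_on (Y i) \<Longrightarrow> (\<And>j. i = Suc j \<Longrightarrow> mat_vec (Y (Suc j)) (E j) v = 0) \<Longrightarrow> v \<in> complex_cycles Y E i"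
  by (auto simp: complex_cycles_def split: nat.split)

lemma complex_cycles_SucD: "v \<in> complex_cycles Y E (Suc j) \<Longrightarrow> mat_vec (Y (Suc j)) (E j) v = 0"
  by (simp add: complex_cycles_def)

lemma subspace_complex_cycles: "fun_vs.subspace (complex_cycles Y E i :: ('y \<Rightarrow> 'k::field) set)"
proof (cases i)
  case 0
  then show ?thesis
    by (simp add: complex_cycles_def subspace_supported_on)
next
  case (Suc j)
  then show ?thesis
    using subspace_linear_constraint[OF fun_linear_mat_vec subspace_supported_on fun_vs.subspace_single_0]
    by (simp add: complex_cycles_def)
qed

lemma subspace_complex_boundaries: "fun_vs.subspace (complex_boundaries Y E i)"
  unfolding complex_boundaries_def
  by (rule fun_vs_pair.linear_subspace_image[OF fun_linear_mat_vec subspace_supported_on])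

text \<open>A resolution that becomes zero under \<open>eps\<close> computes the homology, after \<open>eps\<close>, of any other resolution.\<close>

locale minimal_comparison = ring_hom_to_field eps + F: free_resolution X D I p + T: free_resolution Y E I q
  for eps :: "'a::comm_ring_1 \<Rightarrow> 'k::field"
    and X :: "nat \<Rightarrow> 'x set" and D :: "nat \<Rightarrow> 'x \<Rightarrow> 'x \<Rightarrow> 'a" and I p
    and Y :: "nat \<Rightarrow> 'y set" and E :: "nat \<Rightarrow> 'y \<Rightarrow> 'y \<Rightarrow> 'a" and q +
  fixes f :: "nat \<Rightarrow> 'y \<Rightarrow> 'x \<Rightarrow> 'a" and g :: "nat \<Rightarrow> 'x \<Rightarrow> 'y \<Rightarrow> 'a"
  assumes minimal: "\<And>i. reduce (D i) = 0"
    and f: "comparison_map X D p Y E q f" and g: "comparison_map Y E q X D p g"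
begin

lemma reduce_g_f: "mat_mult (Y i) (reduce (g i)) (reduce (f i)) = identity_mat (X i)"
proof -
  obtain h where "mat_mult (Y 0) (g 0) (f 0) = identity_mat (X 0)"
    "\<And>i. mat_mult (Y (Suc i)) (g (Suc i)) (f (Suc i)) =
      identity_mat (X (Suc i)) + mat_mult (X (Suc (Suc i))) (D (Suc i)) (h (Suc i)) + mat_mult (X i) (h i) (D i)"
    using composite_homotopic_to_identity[OF F.free_resolution_axioms T.basis_0 f g] by blast
  then have "reduce (mat_mult (Y i) (g i) (f i)) = identity_mat (X i)"
    by (cases i) (simp_all add: reduce_add reduce_mult[of "X _"] reduce_identity minimal)
  then show ?thesis
    by (simp add: reduce_mult)
qed

lemma reduce_E_f: "mat_mult (Y (Suc i)) (reduce (E i)) (reduce (f (Suc i))) = 0"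
  unfolding reduce_mult[symmetric] comparison_map_commute[OF f] by (simp add: reduce_mult minimal)

lemma reduce_g_E: "mat_mult (Y i) (reduce (g i)) (reduce (E i)) = 0"
  unfolding reduce_mult[symmetric] comparison_map_commute[OF g, symmetric] by (simp add: reduce_mult minimal)

lemma reduce_E_E: "mat_mult (Y (Suc i)) (reduce (E i)) (reduce (E (Suc i))) = 0"
  unfolding reduce_mult[symmetric] T.differential_differential reduce_0 ..

abbreviation Z :: "nat \<Rightarrow> ('y \<Rightarrow> 'k) set" where
  "Z \<equiv> complex_cycles Y (\<lambda>i. reduce (E i))"

abbreviation B :: "nat \<Rightarrow> ('y \<Rightarrow> 'k) set" where
  "B \<equiv> complex_boundaries Y (\<lambda>i. reduce (E i))"

lemma boundary_of_kernel:
  assumes v: "v \<in> Z i" and gv: "mat_vec (Y i) (reduce (g i)) v = 0"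
  shows "v \<in> B i"
proof -
  have vY: "v \<in> supported_on (Y i)"
    using v complex_cycles_supported by blast
  have fg: "mat_vec (Y i) (reduce (mat_mult (X i) (f i) (g i))) v = 0"
    by (simp add: reduce_mult mat_vec_mat_vec[symmetric] gv)
  obtain h where h: "\<And>i. h i \<in> mat_supported (Y (Suc i)) (Y i)"
    and id0: "mat_mult (X 0) (f 0) (g 0) = identity_mat (Y 0)"
    and homotopy: "\<And>i. mat_mult (X (Suc i)) (f (Suc i)) (g (Suc i)) =
      identity_mat (Y (Suc i)) + mat_mult (Y (Suc (Suc i))) (E (Suc i)) (h (Suc i)) + mat_mult (Y i) (h i) (E i)"
    using composite_homotopic_to_identity[OF T.free_resolution_axioms F.basis_0 g f] by blast
  show ?thesis
  proof (cases i)
    case 0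
    then have "v = 0"
      using fg id0 mat_vec_identity[OF T.finite_basis vY] by (simp add: reduce_identity)
    then show ?thesis
      unfolding complex_boundaries_def by (intro image_eqI[of _ _ 0]) simp_all
  next
    case (Suc j)
    let ?w = "mat_vec (Y i) (reduce (h i)) v"
    have "mat_vec (Y i) (mat_mult (Y j) (reduce (h j)) (reduce (E j))) v = 0"
      using complex_cycles_SucD[of v Y "\<lambda>i. reduce (E i)" j] v Suc by (simp add: mat_vec_mat_vec[symmetric])
    then have "v + mat_vec (Y (Suc i)) (reduce (E i)) ?w = 0"
      using fg Suc homotopy[of j] mat_vec_identity[OF T.finite_basis vY]
      by (simp add: reduce_add reduce_mult reduce_identity mat_vec_add_mat mat_vec_mat_vec)
    then have "v = mat_vec (Y (Suc i)) (reduce (E i)) (- ?w)"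
      by (simp add: fun_vs_pair.linear_neg[OF fun_linear_mat_vec] eq_neg_iff_add_eq_0)
    moreover have "- ?w \<in> supported_on (Y (Suc i))"
      using mat_vec_supported[OF reduce_supported[OF h]] by (auto simp: supported_on_def)
    ultimately show ?thesis
      unfolding complex_boundaries_def by (rule image_eqI)
  qed
qed

lemma kernel_of_boundary:
  assumes "v \<in> B i"
  shows "v \<in> Z i" "mat_vec (Y i) (reduce (g i)) v = 0"
proof -
  obtain w where w: "v = mat_vec (Y (Suc i)) (reduce (E i)) w"
    using assms by (auto simp: complex_boundaries_def)
  show "v \<in> Z i"
    unfolding w by (rule complex_cyclesI)
      (simp_all add: mat_vec_supported[OF reduce_supported[OF T.differential_supported]] mat_vec_mat_vec reduce_E_E)
  show "mat_vec (Y i) (reduce (g i)) v = 0"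
    unfolding w by (simp add: mat_vec_mat_vec reduce_g_E)
qed

lemma image_of_cycles: "mat_vec (Y i) (reduce (g i)) ` Z i = supported_on (X i)"
proof (intro equalityI subsetI)
  fix u :: "'x \<Rightarrow> 'k" assume u: "u \<in> supported_on (X i)"
  let ?v = "mat_vec (X i) (reduce (f i)) u"
  have "?v \<in> Z i"
    by (rule complex_cyclesI)
      (simp_all add: mat_vec_supported[OF reduce_supported[OF comparison_map_supported[OF f]]] mat_vec_mat_vec reduce_E_f)
  moreover have "u = mat_vec (Y i) (reduce (g i)) ?v"
    by (simp add: mat_vec_mat_vec reduce_g_f mat_vec_identity[OF F.finite_basis u])
  ultimately show "u \<in> mat_vec (Y i) (reduce (g i)) ` Z i"
    by (intro image_eqI[of u _ ?v])
qed (auto simp: mat_vec_supported[OF reduce_supported[OF comparison_map_supported[OF g]]])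

lemma rank_eq_homology_dim: "fun_vs.dim (Z i) = fun_vs.dim (B i) + card (X i)"
proof -
  have "{v \<in> Z i. mat_vec (Y i) (reduce (g i)) v = 0} = B i"
    using boundary_of_kernel kernel_of_boundary by blast
  then show ?thesis
    using fun_rank_nullity[OF fun_linear_mat_vec[of "Y i" "reduce (g i)"] subspace_complex_cycles
        T.finite_basis complex_cycles_supported[of Y "\<lambda>i. reduce (E i)" i]]
    by (simp add: image_of_cycles dim_supported_on F.finite_basis)
qed

end

theorem (in ring_hom_to_field) minimal_resolution_rank:
  assumes F: "free_resolution X D I p" and T: "free_resolution Y E I q" and minimal: "\<And>i. reduce (D i) = 0"
  shows "fun_vs.dim (complex_cycles Y (\<lambda>i. reduce (E i)) i) =
    fun_vs.dim (complex_boundaries Y (\<lambda>i. reduce (E i)) i) + card (X i)"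
proof -
  obtain f where f: "comparison_map X D p Y E q f"
    using exists_comparison_map[OF F T] .
  obtain g where g: "comparison_map Y E q X D p g"
    using exists_comparison_map[OF T F] .
  interpret minimal_comparison eps X D I p Y E q f g
    by (intro minimal_comparison.intro minimal_comparison_axioms.intro ring_hom_to_field_axioms F T minimal f g)
  show ?thesis
    by (rule rank_eq_homology_dim)
qed

section \<open>The Taylor resolution\<close>

definition exp_lcm :: "('v::finite \<Rightarrow>\<^sub>0 nat) set \<Rightarrow> 'v \<Rightarrow>\<^sub>0 nat" where
  "exp_lcm S = Abs_poly_mapping (\<lambda>v. Max (insert 0 ((\<lambda>\<alpha>. lookup \<alpha> v) ` S)))"

lemma lookup_exp_lcm: "lookup (exp_lcm S) v = Max (insert 0 ((\<lambda>\<alpha>. lookup \<alpha> v) ` S))"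
  unfolding exp_lcm_def by (subst lookup_Abs_poly_mapping) auto

lemma exp_lcm_le_iff: "finite S \<Longrightarrow> exp_le (exp_lcm S) \<gamma> \<longleftrightarrow> (\<forall>\<alpha>\<in>S. exp_le \<alpha> \<gamma>)"
  by (auto simp: exp_le_def lookup_exp_lcm)

lemma exp_lcm_mono: "finite S \<Longrightarrow> T \<subseteq> S \<Longrightarrow> exp_le (exp_lcm T) (exp_lcm S)"
  using exp_lcm_le_iff[of S "exp_lcm S"] exp_lcm_le_iff[of T "exp_lcm S"] finite_subset[of T S]
  by (auto simp: exp_le_refl)

lemma exp_lcm_empty: "exp_lcm {} = 0"
  by (rule poly_mapping_eqI) (simp add: lookup_exp_lcm)

lemma exp_lcm_singleton: "exp_lcm {\<alpha>} = \<alpha>"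
  by (rule poly_mapping_eqI) (simp add: lookup_exp_lcm)

definition polarize :: "('v \<Rightarrow>\<^sub>0 nat) \<Rightarrow> ('v \<times> nat) set" where
  "polarize \<alpha> = {(v, j). j < lookup \<alpha> v}"

lemma finite_polarize: "finite (polarize (\<alpha> :: 'v::finite \<Rightarrow>\<^sub>0 nat))"
proof -
  have "polarize \<alpha> = (SIGMA v:UNIV. {..<lookup \<alpha> v})"
    by (auto simp: polarize_def)
  then show ?thesis
    by simp
qed

lemma polarize_subset_iff: "polarize \<alpha> \<subseteq> polarize \<beta> \<longleftrightarrow> exp_le \<alpha> \<beta>"
proof
  assume sub: "polarize \<alpha> \<subseteq> polarize \<beta>"
  have "lookup \<alpha> v \<le> lookup \<beta> v" for v
  proof (rule ccontr)
    assume "\<not> ?thesis"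
    then have "(v, lookup \<beta> v) \<in> polarize \<alpha> - polarize \<beta>"
      by (simp add: polarize_def)
    then show False
      using sub by blast
  qed
  then show "exp_le \<alpha> \<beta>"
    by (simp add: exp_le_def)
qed (auto simp: polarize_def exp_le_def intro: less_le_trans)

lemma polarize_eq_iff: "polarize \<alpha> = polarize \<beta> \<longleftrightarrow> \<alpha> = \<beta>"
  using exp_le_antisym by (auto simp: set_eq_subset polarize_subset_iff exp_le_refl)

lemma polarize_empty_iff: "polarize \<alpha> = {} \<longleftrightarrow> \<alpha> = 0"
  using polarize_eq_iff[of \<alpha> 0] by (simp add: polarize_def)

lemma polarize_exp_lcm: "finite S \<Longrightarrow> polarize (exp_lcm S) = \<Union>(polarize ` S)"
  by (auto simp: polarize_def lookup_exp_lcm Max_gr_iff)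

lemma ring_hom_constant_term: "ring_hom_to_field (\<lambda>f :: ('v, 'k::field) mpoly. lookup f 0)"
proof
  fix f g :: "('v, 'k) mpoly"
  have zero: "l = 0" if "l + r = 0" for l r :: "'v \<Rightarrow>\<^sub>0 nat"
  proof (rule exp_le_antisym)
    show "exp_le l 0"
      using exp_le_add(1)[of l r] unfolding that .
  qed (simp add: exp_le_def)
  have "lookup (f * g) (0 + 0) = lookup f 0 * lookup g 0"
  proof (rule lookup_mult_unique)
    fix l r :: "'v \<Rightarrow>\<^sub>0 nat" assume "0 + 0 = l + r"
    from this[symmetric] show "l = 0 \<and> r = 0"
      using zero[of l r] zero[of r l] by (simp add: add.commute)
  qed
  then show "lookup (f * g) 0 = lookup f 0 * lookup g 0"
    by simp
qed (simp_all add: lookup_add)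

interpretation constant_term: ring_hom_to_field "\<lambda>f :: ('v, 'k::field) mpoly. lookup f 0"
  by (rule ring_hom_constant_term)

locale taylor_complex = generators ty A for ty :: "'k::field itself" and A :: "nat set" +
  fixes a :: "nat \<Rightarrow> 'v::finite \<Rightarrow>\<^sub>0 nat"
begin

definition weight :: "nat set \<Rightarrow> 'v \<Rightarrow>\<^sub>0 nat" where
  "weight \<sigma> = exp_lcm (a ` \<sigma>)"

definition basis :: "nat \<Rightarrow> nat set set" where
  "basis i = level (Pow A) i"

definition differential :: "nat \<Rightarrow> nat set \<Rightarrow> nat set \<Rightarrow> ('v, 'k) mpoly" where
  "differential i \<tau> \<sigma> = (if \<tau> \<in> basis i \<and> \<sigma> \<in> basis (Suc i) \<and> \<tau> \<subseteq> \<sigma>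
     then single (weight \<sigma> - weight \<tau>) (vertex_sign (the_elem (\<sigma> - \<tau>)) \<tau>) else 0)"

abbreviation apply_differential :: "nat \<Rightarrow> (nat set \<Rightarrow> ('v, 'k) mpoly) \<Rightarrow> nat set \<Rightarrow> ('v, 'k) mpoly" where
  "apply_differential i \<equiv> mat_vec (basis (Suc i)) (differential i)"

lemma mem_basis: "\<sigma> \<in> basis i \<longleftrightarrow> \<sigma> \<subseteq> A \<and> card \<sigma> = i"
  by (auto simp: basis_def level_def)

lemma finite_face: "\<sigma> \<subseteq> A \<Longrightarrow> finite \<sigma>"
  using finite_generators finite_subset by blast

lemma finite_taylor_basis: "finite (basis i)"
  using finite_generators by (simp add: basis_def level_def)

lemma weight_mono: "\<sigma> \<subseteq> A \<Longrightarrow> \<tau> \<subseteq> \<sigma> \<Longrightarrow> exp_le (weight \<tau>) (weight \<sigma>)"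
  using finite_face[of \<sigma>] by (auto simp: weight_def intro!: exp_lcm_mono)

lemma differential_supported: "differential i \<in> mat_supported (basis i) (basis (Suc i))"
  by (auto simp: differential_def mat_supported_def)

lemma differential_insert:
  assumes "\<tau> \<in> basis i" "g \<in> A - \<tau>"
  shows "differential i \<tau> (insert g \<tau>) = single (weight (insert g \<tau>) - weight \<tau>) (vertex_sign g \<tau>)"
proof -
  have "insert g \<tau> - \<tau> = {g}"
    using assms(2) by auto
  then show ?thesis
    using assms finite_face[of \<tau>] by (simp add: differential_def mem_basis subset_insertI)
qed

lemma cofaces_eq:
  assumes "\<tau> \<in> basis i"
  shows "{\<sigma> \<in> basis (Suc i). \<tau> \<subseteq> \<sigma>} = (\<lambda>g. insert g \<tau>) ` (A - \<tau>)"
proof (intro equalityI subsetI)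
  fix \<sigma> assume "\<sigma> \<in> {\<sigma> \<in> basis (Suc i). \<tau> \<subseteq> \<sigma>}"
  then have \<sigma>: "\<sigma> \<subseteq> A" "card \<sigma> = Suc i" "\<tau> \<subseteq> \<sigma>"
    by (auto simp: mem_basis)
  then have "card (\<sigma> - \<tau>) = 1"
    using assms finite_face[of \<tau>] by (simp add: mem_basis card_Diff_subset)
  then obtain g where "\<sigma> - \<tau> = {g}"
    by (auto simp: card_1_singleton_iff)
  then have "g \<in> A - \<tau>" "\<sigma> = insert g \<tau>"
    using \<sigma> by auto
  then show "\<sigma> \<in> (\<lambda>g. insert g \<tau>) ` (A - \<tau>)"
    by blast
qed (use assms finite_face in \<open>auto simp: mem_basis\<close>)

lemma sum_cofaces:
  assumes "\<tau> \<in> basis i" "\<And>\<sigma>. \<not> \<tau> \<subseteq> \<sigma> \<Longrightarrow> f \<sigma> = 0"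
  shows "(\<Sum>\<sigma>\<in>basis (Suc i). f \<sigma>) = (\<Sum>g\<in>A - \<tau>. f (insert g \<tau>))"
proof -
  have "(\<Sum>\<sigma>\<in>basis (Suc i). f \<sigma>) = (\<Sum>\<sigma>\<in>{\<sigma> \<in> basis (Suc i). \<tau> \<subseteq> \<sigma>}. f \<sigma>)"
    using assms(2) finite_taylor_basis by (intro sum.mono_neutral_right) auto
  also have "\<dots> = (\<Sum>g\<in>A - \<tau>. f (insert g \<tau>))"
    unfolding cofaces_eq[OF assms(1)] by (subst sum.reindex) (auto simp: inj_on_def)
  finally show ?thesis .
qed

lemma apply_differential_eq:
  assumes "\<tau> \<in> basis i"
  shows "apply_differential i w \<tau> =
    (\<Sum>g\<in>A - \<tau>. single (weight (insert g \<tau>) - weight \<tau>) (vertex_sign g \<tau>) * w (insert g \<tau>))"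
proof -
  have "apply_differential i w \<tau> = (\<Sum>g\<in>A - \<tau>. differential i \<tau> (insert g \<tau>) * w (insert g \<tau>))"
    unfolding mat_vec_def by (rule sum_cofaces[OF assms]) (simp add: differential_def)
  also have "\<dots> = (\<Sum>g\<in>A - \<tau>. single (weight (insert g \<tau>) - weight \<tau>) (vertex_sign g \<tau>) * w (insert g \<tau>))"
    by (rule sum.cong[OF refl]) (simp only: differential_insert[OF assms])
  finally show ?thesis .
qed

definition below :: "('v \<Rightarrow>\<^sub>0 nat) \<Rightarrow> nat set" where
  "below \<gamma> = {g \<in> A. exp_le (a g) \<gamma>}"

lemma subset_below_iff: "\<sigma> \<subseteq> below \<gamma> \<longleftrightarrow> \<sigma> \<subseteq> A \<and> exp_le (weight \<sigma>) \<gamma>"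
proof (cases "\<sigma> \<subseteq> A")
  case True
  then have "exp_le (weight \<sigma>) \<gamma> \<longleftrightarrow> (\<forall>g\<in>\<sigma>. exp_le (a g) \<gamma>)"
    using exp_lcm_le_iff[of "a ` \<sigma>" \<gamma>] finite_face by (simp add: weight_def)
  then show ?thesis
    using True by (auto simp: below_def)
qed (auto simp: below_def)

lemma below_subset: "below \<gamma> \<subseteq> A"
  by (auto simp: below_def)

lemma set_complex_below: "set_complex (Pow (below \<gamma>))"
  by (rule set_complex_Pow[OF finite_face[OF below_subset]])

lemma level_below: "level (Pow (below \<gamma>)) i = {\<sigma> \<in> basis i. \<sigma> \<subseteq> below \<gamma>}"
  using below_subset[of \<gamma>] by (auto simp: level_def mem_basis)

text \<open>The degree \<open>\<gamma>\<close> part of a chain of the Taylor complex: a chain of the full simplex on the generators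
  dividing the monomial with exponent \<open>\<gamma>\<close>.\<close>

definition strand :: "(nat set \<Rightarrow> ('v, 'k) mpoly) \<Rightarrow> ('v \<Rightarrow>\<^sub>0 nat) \<Rightarrow> nat set \<Rightarrow> 'k" where
  "strand w \<gamma> \<sigma> = (if \<sigma> \<subseteq> below \<gamma> then lookup (w \<sigma>) (\<gamma> - weight \<sigma>) else 0)"

lemma strand_supported: "w \<in> supported_on (basis i) \<Longrightarrow> strand w \<gamma> \<in> supported_on (level (Pow (below \<gamma>)) i)"
  by (auto simp: strand_def supported_on_def level_below)

lemma strand_zero: "strand 0 \<gamma> = 0"
  by (simp add: strand_def fun_eq_iff)

lemma lookup_eq_strand: "\<sigma> \<subseteq> A \<Longrightarrow> lookup (w \<sigma>) \<beta> = strand w (\<beta> + weight \<sigma>) \<sigma>"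
  by (simp add: strand_def subset_below_iff exp_le_add)

lemma strand_inject:
  assumes "u \<in> supported_on (basis i)" "w \<in> supported_on (basis i)" "\<And>\<gamma>. strand u \<gamma> = strand w \<gamma>"
  shows "u = w"
proof
  fix \<sigma> show "u \<sigma> = w \<sigma>"
  proof (cases "\<sigma> \<in> basis i")
    case True
    then show ?thesis
      by (intro poly_mapping_eqI) (simp add: lookup_eq_strand mem_basis assms(3))
  next
    case False
    then show ?thesis
      using supported_onD[OF assms(1)] supported_onD[OF assms(2)] by simp
  qed
qed

lemma finite_strand_support:
  assumes "\<sigma> \<subseteq> A"
  shows "finite {\<gamma>. strand w \<gamma> \<sigma> \<noteq> 0}"
proof (rule finite_subset)
  show "{\<gamma>. strand w \<gamma> \<sigma> \<noteq> 0} \<subseteq> (\<lambda>\<beta>. \<beta> + weight \<sigma>) ` keys (w \<sigma>)"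
  proof
    fix \<gamma> assume "\<gamma> \<in> {\<gamma>. strand w \<gamma> \<sigma> \<noteq> 0}"
    then have "exp_le (weight \<sigma>) \<gamma>" "\<gamma> - weight \<sigma> \<in> keys (w \<sigma>)"
      by (auto simp: strand_def subset_below_iff in_keys_iff split: if_splits)
    then show "\<gamma> \<in> (\<lambda>\<beta>. \<beta> + weight \<sigma>) ` keys (w \<sigma>)"
      by (intro image_eqI[of _ _ "\<gamma> - weight \<sigma>"]) (simp_all add: exp_diff_add)
  qed
qed simp

lemma exists_chain_with_strands:
  assumes supp: "\<And>\<gamma>. u \<gamma> \<in> supported_on (level (Pow (below \<gamma>)) i)"
    and fin: "\<And>\<sigma>. \<sigma> \<subseteq> A \<Longrightarrow> finite {\<gamma>. u \<gamma> \<sigma> \<noteq> 0}"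
  obtains w where "w \<in> supported_on (basis i)" "\<And>\<gamma>. strand w \<gamma> = u \<gamma>"
proof -
  define w :: "nat set \<Rightarrow> ('v, 'k) mpoly" where
    "w = (\<lambda>\<sigma>. if \<sigma> \<in> basis i then Abs_poly_mapping (\<lambda>\<beta>. u (\<beta> + weight \<sigma>) \<sigma>) else 0)"
  have w: "lookup (w \<sigma>) \<beta> = u (\<beta> + weight \<sigma>) \<sigma>" if "\<sigma> \<in> basis i" for \<sigma> \<beta>
  proof -
    have "finite {\<beta>. u (\<beta> + weight \<sigma>) \<sigma> \<noteq> 0}"
      using finite_vimageI[OF fin, of \<sigma> "\<lambda>\<beta>. \<beta> + weight \<sigma>"] that by (simp add: vimage_def mem_basis inj_def)
    then show ?thesis
      using that by (simp add: w_def)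
  qed
  have "strand w \<gamma> \<sigma> = u \<gamma> \<sigma>" for \<gamma> \<sigma>
  proof (cases "\<sigma> \<in> level (Pow (below \<gamma>)) i")
    case True
    then have "\<sigma> \<in> basis i" "\<sigma> \<subseteq> below \<gamma>" "\<gamma> - weight \<sigma> + weight \<sigma> = \<gamma>"
      by (auto simp: level_below subset_below_iff exp_diff_add)
    then show ?thesis
      by (simp add: strand_def w)
  next
    case False
    then show ?thesis
      using supported_onD[OF supp False] by (auto simp: strand_def level_below w_def)
  qed
  then show ?thesis
    by (intro that[of w]) (auto simp: w_def supported_on_def)
qed

lemma lookup_differential_term:
  assumes \<tau>: "\<tau> \<subseteq> below \<gamma>" and g: "g \<in> A"
  shows "lookup (single (weight (insert g \<tau>) - weight \<tau>) c * w (insert g \<tau>)) (\<gamma> - weight \<tau>) = c * strand w \<gamma> (insert g \<tau>)"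
proof -
  have sub: "insert g \<tau> \<subseteq> A"
    using \<tau> g below_subset by blast
  have weight_le: "lookup (weight \<tau>) v \<le> lookup (weight (insert g \<tau>)) v" "lookup (weight \<tau>) v \<le> lookup \<gamma> v" for v
    using weight_mono[OF sub subset_insertI] \<tau> by (simp_all add: subset_below_iff exp_le_def)
  have "exp_le (weight (insert g \<tau>) - weight \<tau>) (\<gamma> - weight \<tau>) \<longleftrightarrow> insert g \<tau> \<subseteq> below \<gamma>"
    using sub by (simp add: subset_below_iff exp_le_def lookup_minus le_diff_iff[OF weight_le])
  moreover have "\<gamma> - weight \<tau> - (weight (insert g \<tau>) - weight \<tau>) = \<gamma> - weight (insert g \<tau>)"
    using weight_le(1) by (intro poly_mapping_eqI) (simp add: lookup_minus)
  ultimately show ?thesis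
    by (simp add: lookup_single_mult strand_def)
qed

lemma strand_differential:
  assumes w: "w \<in> supported_on (basis (Suc i))"
  shows "strand (apply_differential i w) \<gamma> = boundary (Pow (below \<gamma>)) (strand w \<gamma>)"
proof
  fix \<tau>
  have strand_w: "strand w \<gamma> \<sigma> = 0" if "\<sigma> \<notin> basis (Suc i)" for \<sigma>
    using supported_onD[OF w that] by (simp add: strand_def)
  consider (basis) "\<tau> \<subseteq> below \<gamma>" "\<tau> \<in> basis i" | (other) "\<tau> \<subseteq> below \<gamma>" "\<tau> \<notin> basis i" | (above) "\<not> \<tau> \<subseteq> below \<gamma>"
    by blast
  then show "strand (apply_differential i w) \<gamma> \<tau> = boundary (Pow (below \<gamma>)) (strand w \<gamma>) \<tau>"
  proof cases
    case basis
    have "strand (apply_differential i w) \<gamma> \<tau> = (\<Sum>g\<in>A - \<tau>. vertex_sign g \<tau> * strand w \<gamma> (insert g \<tau>))"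
      unfolding strand_def[of "apply_differential i w"] apply_differential_eq[OF basis(2)] lookup_sum
      using basis(1) by (simp add: lookup_differential_term)
    also have "\<dots> = (\<Sum>g\<in>link_vertices (Pow (below \<gamma>)) \<tau>. vertex_sign g \<tau> * strand w \<gamma> (insert g \<tau>))"
      using finite_generators basis(1) below_subset[of \<gamma>]
      by (intro sum.mono_neutral_right) (auto simp: link_vertices_def strand_def)
    finally show ?thesis
      using basis(1) by (simp add: boundary_def)
  next
    case other
    then have "card \<tau> \<noteq> i" "finite \<tau>"
      using below_subset[of \<gamma>] finite_face by (auto simp: mem_basis)
    then have "insert g \<tau> \<notin> basis (Suc i)" if "g \<notin> \<tau>" for g
      using that by (simp add: mem_basis)
    then have "boundary (Pow (below \<gamma>)) (strand w \<gamma>) \<tau> = 0"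
      by (simp add: boundary_def link_vertices_def strand_w sum.neutral)
    then show ?thesis
      using mat_vec_supported[OF differential_supported] other(2) by (simp add: strand_def supported_on_def)
  next
    case above
    then show ?thesis
      by (simp add: strand_def boundary_def)
  qed
qed

lemma lift_through_taylor_differential:
  assumes v: "v \<in> supported_on (basis i)" and cycle: "\<And>\<gamma>. boundary (Pow (below \<gamma>)) (strand v \<gamma>) = 0"
    and acyclic: "\<And>\<gamma>. below \<gamma> = {} \<Longrightarrow> strand v \<gamma> = 0"
  obtains w where "w \<in> supported_on (basis (Suc i))" "apply_differential i w = v"
proof -
  define g where "g = (\<lambda>\<gamma>. SOME g. g \<in> below \<gamma>)"
  define u where "u = (\<lambda>\<gamma>. cone (g \<gamma>) (strand v \<gamma>))"
  have u: "u \<gamma> \<in> supported_on (level (Pow (below \<gamma>)) (Suc i)) \<and> boundary (Pow (below \<gamma>)) (u \<gamma>) = strand v \<gamma>" for \<gamma>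
  proof (cases "below \<gamma> = {}")
    case True
    then show ?thesis
      by (simp add: u_def acyclic cone_zero fun_vs_pair.linear_0[OF fun_linear_boundary])
  next
    case False
    then have tog: "toggle_closed (g \<gamma>) (Pow (below \<gamma>))"
      using some_in_eq[of "below \<gamma>"] by (auto simp: toggle_closed_def g_def)
    have "strand v \<gamma> \<in> cycles (Pow (below \<gamma>)) i"
      using strand_supported[OF v] cycle by (simp add: cycles_def)
    then show ?thesis
      unfolding u_def
      using cone_level[OF set_complex_below tog strand_supported[OF v]] boundary_cone_cycle[OF set_complex_below tog]
      by blast
  qed
  have "finite {\<gamma>. u \<gamma> \<sigma> \<noteq> 0}" if "\<sigma> \<subseteq> A" for \<sigma>
  proof (rule finite_subset)
    show "{\<gamma>. u \<gamma> \<sigma> \<noteq> 0} \<subseteq> (\<Union>h\<in>\<sigma>. {\<gamma>. strand v \<gamma> (\<sigma> - {h}) \<noteq> 0})"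
      by (auto simp: u_def cone_def)
    show "finite (\<Union>h\<in>\<sigma>. {\<gamma>. strand v \<gamma> (\<sigma> - {h}) \<noteq> 0})"
      using that finite_face[OF that] by (intro finite_UN_I finite_strand_support) auto
  qed
  then obtain w where w: "w \<in> supported_on (basis (Suc i))" "\<And>\<gamma>. strand w \<gamma> = u \<gamma>"
    using exists_chain_with_strands[of u "Suc i"] u by blast
  have "apply_differential i w = v"
    by (rule strand_inject[OF mat_vec_supported[OF differential_supported] v]) (simp add: strand_differential w u)
  with w(1) show ?thesis
    by (rule that)
qed

lemma image_taylor_differential_0:
  "(\<lambda>w. apply_differential 0 w {}) ` supported_on (basis (Suc 0)) = ideal_gen (monom_of ` a ` A)"
    (is "?d ` ?F = ?I")
proof (intro equalityI subsetI)
  fix f assume "f \<in> ?d ` ?F"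
  then obtain w where w: "f = ?d w"
    by blast
  have "{} \<in> basis 0"
    by (simp add: mem_basis)
  then have "f = (\<Sum>g\<in>A. monom_of (a g) * w {g})"
    unfolding w by (simp add: apply_differential_eq weight_def exp_lcm_singleton exp_lcm_empty vertex_sign_def)
  also have "\<dots> = (\<Sum>g\<in>A. w {g} * monom_of (a g))"
    by (simp only: mult.commute)
  also have "\<dots> \<in> ?I"
    by (intro ideal_sum ideal_mult is_ideal_ideal_gen subsetD[OF ideal_gen_superset] imageI)
  finally show "f \<in> ?I" .
next
  fix f assume f: "f \<in> ?I"
  define v :: "nat set \<Rightarrow> ('v, 'k) mpoly" where "v = (\<lambda>\<sigma>. if \<sigma> = {} then f else 0)"
  have v: "v \<in> supported_on (basis 0)"
    by (auto simp: v_def supported_on_def mem_basis)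
  have "strand v \<gamma> = 0" if "below \<gamma> = {}" for \<gamma>
  proof -
    have "\<gamma> \<notin> keys f"
      using f that by (auto simp: mem_monomial_ideal_iff below_def)
    then show ?thesis
      using that by (auto simp: strand_def v_def weight_def exp_lcm_empty in_keys_iff)
  qed
  then obtain w where "w \<in> ?F" "apply_differential 0 w = v"
    using lift_through_taylor_differential[OF v boundary_level_0[OF set_complex_below strand_supported[OF v]]] by blast
  then show "f \<in> ?d ` ?F"
    by (intro image_eqI[of _ _ w]) (simp_all add: v_def)
qed

theorem taylor_resolution: "free_resolution basis differential (ideal_gen (monom_of ` a ` A)) {}"
proof
  show "basis 0 = {{}}"
    using finite_face by (auto simp: mem_basis)
  show "(\<lambda>w. apply_differential 0 w {}) ` supported_on (basis (Suc 0)) = ideal_gen (monom_of ` a ` A)"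
    by (rule image_taylor_differential_0)
  fix i
  show "{v \<in> supported_on (basis (Suc i)). apply_differential i v = 0} =
      apply_differential (Suc i) ` supported_on (basis (Suc (Suc i)))"
  proof (intro equalityI subsetI)
    fix v assume v: "v \<in> {v \<in> supported_on (basis (Suc i)). apply_differential i v = 0}"
    then have supp: "v \<in> supported_on (basis (Suc i))"
      by simp
    have "boundary (Pow (below \<gamma>)) (strand v \<gamma>) = 0" for \<gamma>
      using v by (simp add: strand_differential[OF supp, symmetric] strand_zero)
    moreover have "strand v \<gamma> = 0" if "below \<gamma> = {}" for \<gamma>
      using supported_onD[OF strand_supported[OF supp, of \<gamma>]] that by (auto simp: level_def fun_eq_iff)
    ultimately obtain w where "w \<in> supported_on (basis (Suc (Suc i)))" "apply_differential (Suc i) w = v"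
      by (rule lift_through_taylor_differential[OF supp])
    then show "v \<in> apply_differential (Suc i) ` supported_on (basis (Suc (Suc i)))"
      by blast
  next
    fix v assume "v \<in> apply_differential (Suc i) ` supported_on (basis (Suc (Suc i)))"
    then obtain w where w: "w \<in> supported_on (basis (Suc (Suc i)))" "v = apply_differential (Suc i) w"
      by blast
    have v: "v \<in> supported_on (basis (Suc i))"
      unfolding w(2) by (rule mat_vec_supported[OF differential_supported])
    have "strand (apply_differential i v) \<gamma> = strand 0 \<gamma>" for \<gamma>
      unfolding strand_differential[OF v] unfolding w(2) strand_differential[OF w(1)]
      by (simp add: strand_zero boundary_boundary[OF set_complex_below])
    then have "apply_differential i v = 0"
      by (intro strand_inject[OF mat_vec_supported[OF differential_supported] zero_supported_on])
    then show "v \<in> {v \<in> supported_on (basis (Suc i)). apply_differential i v = 0}"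
      using v by simp
  qed
qed (rule finite_taylor_basis differential_supported)+

abbreviation block :: "('v \<times> nat) set \<Rightarrow> nat set set" where
  "block \<equiv> union_complex A (polarize \<circ> a)"

abbreviation reduced_differential :: "nat \<Rightarrow> nat set \<Rightarrow> nat set \<Rightarrow> 'k" where
  "reduced_differential i \<equiv> constant_term.reduce (differential i)"

abbreviation apply_reduced :: "nat \<Rightarrow> (nat set \<Rightarrow> 'k) \<Rightarrow> nat set \<Rightarrow> 'k" where
  "apply_reduced i \<equiv> mat_vec (basis (Suc i)) (reduced_differential i)"

lemma mem_block: "\<sigma> \<in> block m \<longleftrightarrow> \<sigma> \<subseteq> A \<and> polarize (weight \<sigma>) = m"
  using finite_face[of \<sigma>] by (auto simp: union_complex_def weight_def polarize_exp_lcm image_image)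

lemma set_complex_block: "set_complex (block m)"
  by (rule set_complex_union_complex[OF finite_generators])

lemma level_block_subset: "level (block m) i \<subseteq> basis i"
  by (auto simp: level_def mem_block mem_basis)

lemma coord_proj_block_level: "v \<in> supported_on (basis i) \<Longrightarrow> coord_proj (block m) v \<in> supported_on (level (block m) i)"
  by (auto simp: supported_on_def coord_proj_def level_def mem_basis mem_block)

lemma link_vertices_block: "\<tau> \<in> block m \<Longrightarrow> link_vertices (block m) \<tau> = {g \<in> A - \<tau>. weight (insert g \<tau>) = weight \<tau>}"
  by (auto simp: link_vertices_def mem_block polarize_eq_iff)

lemma reduced_differential_insert:
  assumes "\<tau> \<in> basis i" "g \<in> A - \<tau>"
  shows "reduced_differential i \<tau> (insert g \<tau>) = (if weight (insert g \<tau>) = weight \<tau> then vertex_sign g \<tau> else 0)"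
proof -
  have "exp_le (weight \<tau>) (weight (insert g \<tau>))"
    using assms by (intro weight_mono) (auto simp: mem_basis)
  then have "weight (insert g \<tau>) - weight \<tau> = 0 \<longleftrightarrow> weight (insert g \<tau>) = weight \<tau>"
    using exp_diff_add by fastforce
  then show ?thesis
    by (simp add: constant_term.reduce_def differential_insert[OF assms] lookup_single when_def)
qed

lemma apply_reduced_eq:
  assumes "\<tau> \<in> basis i"
  shows "apply_reduced i v \<tau> =
    (\<Sum>g\<in>{g \<in> A - \<tau>. weight (insert g \<tau>) = weight \<tau>}. vertex_sign g \<tau> * v (insert g \<tau>))"
proof -
  have "apply_reduced i v \<tau> = (\<Sum>g\<in>A - \<tau>. reduced_differential i \<tau> (insert g \<tau>) * v (insert g \<tau>))"
    unfolding mat_vec_def by (rule sum_cofaces[OF assms]) (simp add: constant_term.reduce_def differential_def)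
  also have "\<dots> = (\<Sum>g\<in>A - \<tau>. if weight (insert g \<tau>) = weight \<tau> then vertex_sign g \<tau> * v (insert g \<tau>) else 0)"
    by (rule sum.cong[OF refl]) (simp add: reduced_differential_insert[OF assms])
  finally show ?thesis
    using finite_generators by (simp add: sum.If_cases Int_def)
qed

lemma apply_reduced_supported: "apply_reduced i v \<in> supported_on (basis i)"
  by (rule mat_vec_supported[OF constant_term.reduce_supported[OF differential_supported]])

lemma coord_proj_apply_reduced:
  assumes v: "v \<in> supported_on (basis (Suc i))"
  shows "coord_proj (block m) (apply_reduced i v) = boundary (block m) v"
proof
  fix \<tau>
  consider (basis) "\<tau> \<in> block m" "\<tau> \<in> basis i" | (other) "\<tau> \<in> block m" "\<tau> \<notin> basis i" | (outside) "\<tau> \<notin> block m"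
    by blast
  then show "coord_proj (block m) (apply_reduced i v) \<tau> = boundary (block m) v \<tau>"
  proof cases
    case basis
    then show ?thesis
      by (simp add: coord_proj_def boundary_def apply_reduced_eq link_vertices_block)
  next
    case other
    then have "card \<tau> \<noteq> i" "finite \<tau>"
      using finite_face by (auto simp: mem_basis mem_block)
    then have "v (insert g \<tau>) = 0" if "g \<in> link_vertices (block m) \<tau>" for g
      using that by (intro supported_onD[OF v]) (auto simp: mem_basis link_vertices_def)
    then show ?thesis
      using other supported_onD[OF apply_reduced_supported other(2)] by (simp add: coord_proj_def boundary_def)
  next
    case outside
    then show ?thesis
      by (simp add: coord_proj_def boundary_def)
  qed
qed

lemma boundary_coord_proj: "boundary X (coord_proj X v) = boundary X v"
  by (rule boundary_cong) (simp add: coord_proj_def)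

lemma apply_reduced_block:
  assumes v: "v \<in> supported_on (level (block m) (Suc i))"
  shows "apply_reduced i v = boundary (block m) v"
proof
  fix \<tau>
  have v': "v \<in> supported_on (basis (Suc i))"
    using v supported_on_mono[OF level_block_subset] by blast
  consider (block) "\<tau> \<in> block m" | (other) m' where "\<tau> \<in> block m'" "m' \<noteq> m" | (outside) "\<not> \<tau> \<subseteq> A"
    by (auto simp: mem_block)
  then show "apply_reduced i v \<tau> = boundary (block m) v \<tau>"
  proof cases
    case block
    then show ?thesis
      using fun_cong[OF coord_proj_apply_reduced[OF v', of m], of \<tau>] by (simp add: coord_proj_def)
  next
    case other
    have "v (insert g \<tau>) = 0" if "g \<in> link_vertices (block m') \<tau>" for g
      using that other(2) by (intro supported_onD[OF v]) (auto simp: link_vertices_def level_def mem_block)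
    then have "boundary (block m') v \<tau> = 0"
      by (simp add: boundary_def)
    then show ?thesis
      using fun_cong[OF coord_proj_apply_reduced[OF v', of m'], of \<tau>] other
      by (auto simp: coord_proj_def boundary_def mem_block)
  next
    case outside
    then show ?thesis
      using supported_onD[OF apply_reduced_supported, of \<tau> i v] by (simp add: boundary_def mem_basis mem_block)
  qed
qed

lemma dim_blocks:
  assumes V: "fun_vs.subspace V" "V \<subseteq> supported_on (basis i)"
    and W: "\<And>m. coord_proj (block m) ` V \<subseteq> W m" "\<And>m. W m \<subseteq> V" "\<And>m. W m \<subseteq> supported_on (block m)"
  shows "fun_vs.dim (V :: (nat set \<Rightarrow> 'k) set) = (\<Sum>m\<in>Pow (\<Union>((polarize \<circ> a) ` A)). fun_vs.dim (W m))"
proof -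
  let ?M = "Pow (\<Union>((polarize \<circ> a) ` A))"
  have "basis i \<subseteq> (\<Union>m\<in>?M. block m)"
    by (fastforce simp: union_complex_def mem_basis)
  then have "V \<subseteq> supported_on (\<Union>m\<in>?M. block m)"
    using V(2) supported_on_mono by blast
  moreover have "disjoint_family_on block ?M"
    by (auto simp: disjoint_family_on_def mem_block)
  moreover have "finite ?M"
    using finite_generators by (simp add: finite_polarize)
  ultimately have "fun_vs.dim V = (\<Sum>m\<in>?M. fun_vs.dim (coord_proj (block m) ` V))"
    using W(1,2) by (intro dim_coord_blocks V(1) set_complex_finite[OF set_complex_block]) blast+
  moreover have "coord_proj (block m) ` V = W m" for m
  proof
    have "w = coord_proj (block m) w" if "w \<in> W m" for w
      using coord_proj_id subsetD[OF W(3) that] by metis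
    then show "W m \<subseteq> coord_proj (block m) ` V"
      using W(2) by blast
  qed (rule W(1))
  ultimately show ?thesis
    by simp
qed

lemma dim_reduced_cycles:
  "fun_vs.dim (complex_cycles basis reduced_differential i) =
    (\<Sum>m\<in>Pow (\<Union>((polarize \<circ> a) ` A)). fun_vs.dim (cycles (block m) i :: (nat set \<Rightarrow> 'k) set))"
proof (rule dim_blocks[OF subspace_complex_cycles complex_cycles_supported _ _ cycles_supported])
  fix m
  show "coord_proj (block m) ` complex_cycles basis reduced_differential i \<subseteq> cycles (block m) i"
  proof (rule image_subsetI)
    fix v assume v: "v \<in> complex_cycles basis reduced_differential i"
    then have supp: "v \<in> supported_on (basis i)"
      using complex_cycles_supported by blast
    note proj = coord_proj_block_level[OF supp, of m]
    have "boundary (block m) (coord_proj (block m) v) = 0"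
    proof (cases i)
      case 0
      then show ?thesis
        using boundary_level_0[OF set_complex_block] proj by simp
    next
      case (Suc j)
      then have "apply_reduced j v = 0"
        using v complex_cycles_SucD by blast
      then show ?thesis
        using coord_proj_apply_reduced[of v j m] supp Suc
        by (simp add: boundary_coord_proj fun_vs_pair.linear_0[OF fun_linear_coord_proj])
    qed
    then show "coord_proj (block m) v \<in> cycles (block m) i"
      using proj by (simp add: cycles_def)
  qed
  show "cycles (block m) i \<subseteq> complex_cycles basis reduced_differential i"
  proof
    fix v :: "nat set \<Rightarrow> 'k" assume "v \<in> cycles (block m) i"
    then have v: "v \<in> supported_on (level (block m) i)" "boundary (block m) v = 0"
      by (simp_all add: cycles_def)
    show "v \<in> complex_cycles basis reduced_differential i"
    proof (rule complex_cyclesI)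
      show "v \<in> supported_on (basis i)"
        using v(1) supported_on_mono[OF level_block_subset] by blast
      show "apply_reduced j v = 0" if "i = Suc j" for j
        using apply_reduced_block[of v m j] v that by simp
    qed
  qed
qed

lemma dim_reduced_boundaries:
  "fun_vs.dim (complex_boundaries basis reduced_differential i) =
    (\<Sum>m\<in>Pow (\<Union>((polarize \<circ> a) ` A)). fun_vs.dim (boundaries (block m) (Suc i) :: (nat set \<Rightarrow> 'k) set))"
proof (rule dim_blocks[OF subspace_complex_boundaries _ _ _ boundaries_supported])
  show "complex_boundaries basis reduced_differential i \<subseteq> supported_on (basis i)"
    using apply_reduced_supported by (auto simp: complex_boundaries_def)
  fix m
  have "coord_proj (block m) (apply_reduced i v) \<in> boundaries (block m) (Suc i)" if "v \<in> supported_on (basis (Suc i))" for v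
    unfolding boundaries_def coord_proj_apply_reduced[OF that]
    using boundary_coord_proj[symmetric] coord_proj_block_level[OF that] by (rule image_eqI)
  then show "coord_proj (block m) ` complex_boundaries basis reduced_differential i \<subseteq> boundaries (block m) (Suc i)"
    by (auto simp: complex_boundaries_def)
  show "boundaries (block m) (Suc i) \<subseteq> complex_boundaries basis reduced_differential i"
    unfolding boundaries_def complex_boundaries_def
  proof (rule image_subsetI)
    fix v :: "nat set \<Rightarrow> 'k" assume v: "v \<in> supported_on (level (block m) (Suc i))"
    then have "v \<in> supported_on (basis (Suc i))"
      using supported_on_mono[OF level_block_subset] by blast
    then show "boundary (block m) v \<in> apply_reduced i ` supported_on (basis (Suc i))"
      using apply_reduced_block[OF v] by (intro image_eqI[of _ _ v]) simp_all
  qed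
qed

theorem minimal_resolution_betti:
  assumes F: "free_resolution X D (ideal_gen (monom_of ` a ` A) :: ('v, 'k) mpoly set) p"
    and minimal: "\<And>i y x. lookup (D i y x) 0 = 0"
  shows "int (card (X i)) = betti (\<Union>((polarize \<circ> a) ` A)) (polarize \<circ> a) i"
proof -
  have "constant_term.reduce (D i) = 0" for i
    by (simp add: constant_term.reduce_def minimal fun_eq_iff)
  from constant_term.minimal_resolution_rank[OF F taylor_resolution this, of i] show ?thesis
    unfolding dim_reduced_cycles dim_reduced_boundaries betti_def graded_betti_def homology_dim_def sum_subtractf
    by (simp flip: of_nat_sum)
qed

end

section \<open>Monomial ideals that are not complete intersections\<close>

lemma complete_intersection_of_disjoint_polarizations:
  fixes G :: "('v::finite \<Rightarrow>\<^sub>0 nat) set"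
  assumes G: "finite G" and disj: "disjoint (min_sets (polarize ` G))"
    and proper: "ideal_gen (monom_of ` G) \<noteq> (UNIV :: ('v, 'k::field) mpoly set)"
  shows "complete_intersection (ideal_gen (monom_of ` G) :: ('v, 'k) mpoly set)"
proof -
  let ?H = "{\<alpha> \<in> G. polarize \<alpha> \<in> min_sets (polarize ` G)}"
  have "\<exists>\<beta>\<in>?H. exp_le \<beta> \<alpha>" if \<alpha>: "\<alpha> \<in> G" for \<alpha>
  proof -
    obtain F where F: "F \<in> min_sets (polarize ` G)" "F \<subseteq> polarize \<alpha>"
      using min_sets_below[OF finite_imageI[OF G] imageI[OF \<alpha>]] .
    then obtain \<beta> where "\<beta> \<in> G" "F = polarize \<beta>"
      using min_sets_subset[of "polarize ` G"] by blast
    then show ?thesis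
      using F by (auto simp: polarize_subset_iff)
  qed
  then have "ideal_gen (monom_of ` ?H) = (ideal_gen (monom_of ` G) :: ('v, 'k) mpoly set)"
    by (intro monomial_ideal_eqI) auto
  moreover have "complete_intersection (ideal_gen (monom_of ` ?H) :: ('v, 'k) mpoly set)"
  proof (rule complete_intersection_coprime_monomials)
    show "finite ?H"
      using G by simp
    show "ideal_gen (monom_of ` ?H) \<noteq> (UNIV :: ('v, 'k) mpoly set)"
      using proper calculation by simp
    fix \<alpha> \<beta> v assume \<alpha>\<beta>: "\<alpha> \<in> ?H" "\<beta> \<in> ?H" "\<alpha> \<noteq> \<beta>"
    then have "polarize \<alpha> \<inter> polarize \<beta> = {}"
      using disjointD[OF disj, of "polarize \<alpha>" "polarize \<beta>"] by (simp add: polarize_eq_iff)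
    then have "(v, 0) \<notin> polarize \<alpha> \<inter> polarize \<beta>"
      by simp
    then show "lookup \<alpha> v = 0 \<or> lookup \<beta> v = 0"
      by (simp add: polarize_def)
  qed
  ultimately show ?thesis
    by simp
qed

lemma ideal_height_le_card_cover:
  fixes G :: "('v::finite \<Rightarrow>\<^sub>0 nat) set"
  assumes C: "finite C" "\<And>\<alpha>. \<alpha> \<in> G \<Longrightarrow> polarize \<alpha> \<inter> C \<noteq> {}"
  shows "ideal_height (ideal_gen (monom_of ` G) :: ('v, 'k::field) mpoly set) \<le> enat (card C)"
proof -
  have "monom_of \<alpha> \<in> (var_prime (fst ` C) :: ('v, 'k) mpoly set)" if \<alpha>: "\<alpha> \<in> G" for \<alpha>
  proof -
    obtain v j where "(v, j) \<in> polarize \<alpha>" "(v, j) \<in> C"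
      using C(2)[OF \<alpha>] by auto
    then have "v \<in> fst ` C" "0 < lookup \<alpha> v"
      by (auto simp: polarize_def intro: rev_image_eqI)
    then show ?thesis
      by (auto simp: var_prime_def)
  qed
  then have "ideal_gen (monom_of ` G) \<subseteq> (var_prime (fst ` C) :: ('v, 'k) mpoly set)"
    by (intro ideal_gen_least[OF is_ideal_var_prime]) blast
  then have "ideal_height (ideal_gen (monom_of ` G) :: ('v, 'k) mpoly set) \<le> prime_height (var_prime (fst ` C) :: ('v, 'k) mpoly set)"
    unfolding ideal_height_def by (intro INF_lower) (simp add: is_prime_var_prime)
  also have "\<dots> \<le> enat (card (fst ` C))"
    by (rule prime_height_var_prime_le)
  also have "\<dots> \<le> enat (card C)"
    using card_image_le[OF C(1), of fst] by simp
  finally show ?thesis .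
qed

lemma ideal_height_UNIV: "ideal_height (UNIV :: 'a::comm_ring_1 set) = \<infinity>"
proof -
  have "{Q. is_prime_ideal Q \<and> (UNIV :: 'a::comm_ring_1 set) \<subseteq> Q} = {}"
    by (auto simp: is_prime_ideal_def)
  then show "ideal_height (UNIV :: 'a set) = \<infinity>"
    by (simp only: ideal_height_def) (simp add: top_enat_def)
qed

lemma monomial_ideal_UNIV: "0 \<in> G \<Longrightarrow> ideal_gen (monom_of ` G) = (UNIV :: ('v, 'k::field) mpoly set)"
  by (auto simp: set_eq_iff mem_monomial_ideal_iff exp_le_def intro!: bexI[of _ 0])

lemma ideal_height_pos:
  fixes I :: "('v::finite, 'k::field) mpoly set"
  assumes "is_ideal I" "ideal_height I = enat c" "\<not> complete_intersection I"
  shows "1 \<le> c"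
  using zero_ideal_of_height_0[OF assms(1)] complete_intersection_zero assms(2,3)
  by (cases c) (auto simp: zero_enat_def)

definition resolution_matrix ::
  "(nat \<Rightarrow> nat) \<Rightarrow> (nat \<Rightarrow> nat \<Rightarrow> nat \<Rightarrow> 'a::comm_ring_1) \<Rightarrow> nat \<Rightarrow> nat \<Rightarrow> nat \<Rightarrow> 'a" where
  "resolution_matrix b d i = (\<lambda>y x. if y < b i \<and> x < b (Suc i) then d (Suc i) y x else 0)"

lemma fvec_eq_supported_on: "fvec m = supported_on {..<m}"
  by (auto simp: fvec_def supported_on_def not_less)

lemma mat_apply_eq_mat_vec:
  "mat_apply (d (Suc i)) (b i) (b (Suc i)) = mat_vec {..<b (Suc i)} (resolution_matrix b d i)"
  by (auto simp: mat_apply_def mat_vec_def resolution_matrix_def fun_eq_iff intro!: sum.cong)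

lemma free_resolution_of_min_graded:
  fixes I :: "('v::finite, 'k::field) mpoly set"
  assumes res: "min_graded_free_res I N b deg d"
  shows "free_resolution (\<lambda>i. {..<b i}) (resolution_matrix b d) I 0"
proof
  have b0: "b 0 = 1" and image: "(\<lambda>v. v 0) ` mat_apply (d (Suc 0)) 1 (b (Suc 0)) ` fvec (b (Suc 0)) = I"
    and exact: "\<And>i. i \<ge> 1 \<Longrightarrow> {v \<in> fvec (b i). mat_apply (d i) (b (i - 1)) (b i) v = (\<lambda>_. 0)} =
      mat_apply (d (Suc i)) (b i) (b (Suc i)) ` fvec (b (Suc i))"
    using res by (simp_all add: min_graded_free_res_def)
  show "{..<b 0} = {0}"
    using b0 by auto
  show "resolution_matrix b d i \<in> mat_supported {..<b i} {..<b (Suc i)}" for i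
    by (simp add: resolution_matrix_def mat_supported_def)
  show "(\<lambda>w. mat_vec {..<b (Suc 0)} (resolution_matrix b d 0) w 0) ` supported_on {..<b (Suc 0)} = I"
    using image mat_apply_eq_mat_vec[of d 0 b] by (simp add: b0 image_image fvec_eq_supported_on)
  show "{v \<in> supported_on {..<b (Suc i)}. mat_vec {..<b (Suc i)} (resolution_matrix b d i) v = 0} =
      mat_vec {..<b (Suc (Suc i))} (resolution_matrix b d (Suc i)) ` supported_on {..<b (Suc (Suc i))}" for i
    using exact[of "Suc i"] by (simp add: mat_apply_eq_mat_vec fvec_eq_supported_on zero_fun_def)
qed simp

lemma resolution_matrix_constant_term:
  assumes "min_graded_free_res I N b deg d"
  shows "lookup (resolution_matrix b d i y x) 0 = 0"
proof -
  have "\<forall>i\<ge>1. \<forall>r<b (i - 1). \<forall>j<b i. d i r j \<in> max_ideal"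
    using assms by (simp add: min_graded_free_res_def)
  from this[rule_format, of "Suc i" y x] show ?thesis
    by (simp add: resolution_matrix_def max_ideal_def)
qed

theorem betti_numbers_extremal_bound:
  fixes I :: "('v::finite, 'k::field) mpoly set"
  assumes I: "monomial_ideal I" and height: "ideal_height I = enat c" and not_ci: "\<not> complete_intersection I"
    and res: "min_graded_free_res I N b deg d"
  shows "extremal_bound c (\<lambda>i. int (b i))"
proof -
  interpret F: free_resolution "\<lambda>i. {..<b i}" "resolution_matrix b d" I 0
    by (rule free_resolution_of_min_graded[OF res])
  have ideal: "is_ideal I"
    using I is_ideal_ideal_gen by (auto simp: monomial_ideal_def)
  obtain G where G: "finite G" "I = ideal_gen (monom_of ` G)"
    using monomial_ideal_finite_generators[OF I _ F.ideal_gen_first_differential[OF ideal]] by auto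
  then obtain es where es: "set es = G"
    using finite_list by blast
  define A a where "A = {..<length es}" and "a = nth es"
  have aA: "a ` A = G"
    unfolding A_def a_def es[symmetric] by (auto simp: set_conv_nth)
  have polarize_A: "(polarize \<circ> a) ` A = polarize ` G"
    unfolding aA[symmetric] image_comp ..
  interpret taylor_complex "TYPE('k)" A a
    by unfold_locales (simp add: A_def)
  have proper: "I \<noteq> UNIV"
    using height by (auto simp: ideal_height_UNIV)
  let ?V = "\<Union>((polarize \<circ> a) ` A)"
  have "betti ?V (polarize \<circ> a) = (\<lambda>i. int (b i))"
    using minimal_resolution_betti[OF F.free_resolution_axioms[unfolded G(2) aA[symmetric]]
        resolution_matrix_constant_term[OF res]] by (simp add: fun_eq_iff)
  moreover have "extremal_bound c (betti ?V (polarize \<circ> a))"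
  proof (rule betti_lower_bound[OF _ _ _ order_refl])
    have "0 \<notin> G"
      using proper G(2) monomial_ideal_UNIV by blast
    then show "{} \<notin> (polarize \<circ> a) ` A"
      unfolding polarize_A by (metis imageE polarize_empty_iff)
    show "\<not> disjoint (min_sets ((polarize \<circ> a) ` A))"
      using not_ci proper complete_intersection_of_disjoint_polarizations[OF G(1)] unfolding polarize_A G(2) by blast
    show "1 \<le> c"
      by (rule ideal_height_pos[OF ideal height not_ci])
    show "c \<le> card C" if "finite C" "\<And>g. g \<in> A \<Longrightarrow> (polarize \<circ> a) g \<inter> C \<noteq> {}" for C
      using ideal_height_le_card_cover[of C G, where 'k='k] that height unfolding G(2) aA[symmetric] by auto
  qed (use finite_generators in \<open>auto simp: finite_polarize\<close>)
  ultimately show ?thesis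
    by simp
qed

section \<open>Sums of Betti numbers\<close>

lemma poly_1_eq_sum_coeff:
  assumes "degree P \<le> n"
  shows "poly P (1 :: 'a::comm_semiring_1) = (\<Sum>i\<le>n. coeff P i)"
  unfolding poly_altdef using assms
  by (intro sum.mono_neutral_cong_left) (auto simp: coeff_eq_0)

lemma poly_1_mono:
  fixes P Q :: "'a::linordered_idom poly"
  assumes "\<And>i. coeff Q i \<le> coeff P i"
  shows "poly Q 1 \<le> poly P 1"
  using assms poly_1_eq_sum_coeff[of P "max (degree P) (degree Q)"] poly_1_eq_sum_coeff[of Q "max (degree P) (degree Q)"]
  by (simp add: sum_mono)

lemma poly_eqI_coeff_le:
  fixes P Q :: "'a::linordered_idom poly"
  assumes coeff_le: "\<And>i. coeff Q i \<le> coeff P i" and value_eq: "poly P 1 = poly Q 1"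
  shows "P = Q"
proof (rule poly_eqI)
  fix i
  let ?n = "max i (degree (P - Q))"
  have "(\<Sum>i\<le>?n. coeff (P - Q) i) = 0"
    using poly_1_eq_sum_coeff[of "P - Q" ?n] value_eq by simp
  then have "\<forall>i\<in>{..?n}. coeff (P - Q) i = 0"
    using coeff_le by (subst (asm) sum_nonneg_eq_0_iff) simp_all
  then show "coeff P i = coeff Q i"
    by simp
qed

lemma extremal_poly1_mult:
  assumes "1 \<le> c"
  shows "extremal_poly1 c * [:1, 1:] ^ 2 = [:1, 3, 2:] * [:1, 1:] ^ c"
proof -
  have "extremal_poly1 c * [:1, 1:] ^ 2 = ([:1, 2:] * [:1, 1:]) * ([:1, 1:] ^ (c - 1) * [:1, 1:] ^ 1)"
    unfolding extremal_poly1_def by (simp only: power2_eq_square power_one_right mult_ac)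
  also have "[:1, 2:] * [:1, 1:] = [:1, 3, 2 :: int:]"
    by simp
  also have "[:1, 1 :: int:] ^ (c - 1) * [:1, 1:] ^ 1 = [:1, 1:] ^ c"
    unfolding power_add[symmetric] using assms by (simp only: le_add_diff_inverse2)
  finally show ?thesis .
qed

lemma extremal_poly2_mult:
  assumes "2 \<le> c"
  shows "extremal_poly2 c * [:1, 1:] ^ 3 = [:1, 5, 5, 1:] * [:1, 1:] ^ c"
proof -
  have "extremal_poly2 c * [:1, 1:] ^ 3 = ([:1, 4, 1:] * [:1, 1:]) * ([:1, 1:] ^ (c - 2) * [:1, 1:] ^ 2)"
    unfolding extremal_poly2_def by (simp only: power2_eq_square power3_eq_cube mult_ac)
  also have "[:1, 4, 1:] * [:1, 1:] = [:1, 5, 5, 1 :: int:]"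
    by simp
  also have "[:1, 1 :: int:] ^ (c - 2) * [:1, 1:] ^ 2 = [:1, 1:] ^ c"
    unfolding power_add[symmetric] using assms by (simp only: le_add_diff_inverse2)
  finally show ?thesis .
qed

lemma poly_1_of_extremal:
  fixes P :: "int poly"
  assumes "1 \<le> c"
    and "P * [:1, 1:] ^ 2 = [:1, 3, 2:] * [:1, 1:] ^ c \<or> P * [:1, 1:] ^ 3 = [:1, 5, 5, 1:] * [:1, 1:] ^ c"
  shows "poly P 1 = 3 * 2 ^ (c - 1)"
proof -
  have "poly P 1 * 2 ^ 2 = 6 * 2 ^ c \<or> poly P 1 * 2 ^ 3 = 12 * 2 ^ c"
    using assms(2) by (elim disj_forward) (drule arg_cong[of _ _ "\<lambda>p. poly p 1"]; simp add: poly_power)+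
  then show ?thesis
    using assms(1) by (cases c) auto
qed

theorem extremal_bound_poly_1:
  assumes c: "1 \<le> c" and bound: "extremal_bound c (coeff P)"
  shows "3 * 2 ^ (c - 1) \<le> poly P 1"
    and "poly P 1 = 3 * 2 ^ (c - 1) \<longleftrightarrow>
      P * [:1, 1:] ^ 2 = [:1, 3, 2:] * [:1, 1:] ^ c \<or> P * [:1, 1:] ^ 3 = [:1, 5, 5, 1:] * [:1, 1:] ^ c"
      (is "_ \<longleftrightarrow> ?extremal P")
proof -
  obtain Q where Q: "?extremal Q" "\<And>i. coeff Q i \<le> coeff P i"
    using bound extremal_poly1_mult[OF c] extremal_poly2_mult[of c] unfolding extremal_bound_def by blast
  note Q_1 = poly_1_of_extremal[OF c Q(1)]
  show "3 * 2 ^ (c - 1) \<le> poly P 1"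
    using poly_1_mono[OF Q(2)] Q_1 by simp
  show "poly P 1 = 3 * 2 ^ (c - 1) \<longleftrightarrow> ?extremal P"
    using poly_1_of_extremal[OF c] poly_eqI_coeff_le[OF Q(2)] Q(1) Q_1 by metis
qed

theorem theorem1p1:
  fixes I :: "('v::finite, 'k::field) mpoly set"
    and c :: nat
  assumes "monomial_ideal I"
    and "ideal_height I = enat c"
    and "\<not> complete_intersection I"
  shows "\<forall>N b deg d. min_graded_free_res I N b deg d \<longrightarrow>
           (\<Sum>i\<le>N. b i) \<ge> 2 ^ c + 2 ^ (c - 1) \<and>
           ((\<Sum>i\<le>N. b i) = 2 ^ c + 2 ^ (c - 1) \<longleftrightarrow>
              (let P = (\<Sum>i\<le>N. monom (int (b i)) i) in
                 P * [:1, 1:] ^ 2 = [:1, 3, 2:] * [:1, 1:] ^ c \<or>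
                 P * [:1, 1:] ^ 3 = [:1, 5, 5, 1:] * [:1, 1:] ^ c))"
proof (intro allI impI)
  fix N b deg d assume res: "min_graded_free_res I N b deg d"
  define P where "P = (\<Sum>i\<le>N. monom (int (b i)) i)"
  have c: "1 \<le> c"
    using assms is_ideal_ideal_gen by (intro ideal_height_pos[of I]) (auto simp: monomial_ideal_def)
  have "coeff P = (\<lambda>i. int (b i))"
    using res by (auto simp: P_def coeff_sum min_graded_free_res_def fun_eq_iff)
  then have bound: "extremal_bound c (coeff P)"
    using betti_numbers_extremal_bound[OF assms res] by simp
  have sum: "poly P 1 = int (\<Sum>i\<le>N. b i)" and bound_eq: "int (2 ^ c + 2 ^ (c - 1)) = 3 * 2 ^ (c - 1)"
    using c by (cases c; simp add: P_def poly_sum poly_monom)+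
  show "(\<Sum>i\<le>N. b i) \<ge> 2 ^ c + 2 ^ (c - 1) \<and>
           ((\<Sum>i\<le>N. b i) = 2 ^ c + 2 ^ (c - 1) \<longleftrightarrow>
              (let P = (\<Sum>i\<le>N. monom (int (b i)) i) in
                 P * [:1, 1:] ^ 2 = [:1, 3, 2:] * [:1, 1:] ^ c \<or>
                 P * [:1, 1:] ^ 3 = [:1, 5, 5, 1:] * [:1, 1:] ^ c))"
    using extremal_bound_poly_1[OF c bound]
    unfolding Let_def P_def[symmetric] sum bound_eq[symmetric] of_nat_le_iff of_nat_eq_iff by simp
qed

end
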